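(* Let $G$ be a locally compact, second countable topological group acting continuously on a locally compact, second countable abelian topological group $A$. Then $H^2_{lcm}(G,A)$ parametrizes the isomorphism classes of locally split extensions of $G$ by $A$. That is, associating to a locally split extension $$1\to A\xrightarrow{\imath}E\xrightarrow{\pi}G\to 1$$ the class in $H^2_{lcm}(G,A)$ of the $2$-cocycle $f_\sigma(s_1,s_2)=\sigma(s_1)\sigma(s_2)\sigma(s_1s_2)^{-1}$, where $\sigma\colon G\to E$ is any measurable section of $\pi$ that is continuous in a neighbourhood of the identity of $G$, gives a well-defined bijection from the set of isomorphism classes of locally split extensions of $G$ by $A$ onto $H^2_{lcm}(G,A)$.
   Context: $A$ is written additively; $G$ acts on $A$ by group automorphisms and the action map $G\times A\to A$ is continuous. Set $C^0_{lcm}(G,A)=A$, and for $n\ge1$ let $C^n_{lcm}(G,A)$ be the group of all (Borel) measurable functions $f\colon G^n\to A$ which are continuous in some neighbourhood of the identity of $G^n$. The coboundary is $$d^nf(s_1,\dots,s_{n+1})=s_1\cdot f(s_2,\dots,s_{n+1})+\sum_{i=1}^n(-1)^i f(s_1,\dots,s_is_{i+1},\dots,s_{n+1})+(-1)^{n+1}f(s_1,\dots,s_n),$$ and $H^n_{lcm}(G,A)=\ker d^n/\operatorname{im}d^{n-1}$ for $n\geq 1$. An extension of $G$ by $A$ is a short exact sequence of topological groups $1\to A\xrightarrow{\imath}E\xrightarrow{\pi}G\to1$: it is exact as a sequence of groups, $\imath,\pi$ are continuous, $\imath$ is a closed map, $\pi$ is an open map, and conjugation in $E$ induces the given action of $G$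 on $A$. It is locally split if there are an open neighbourhood $U$ of the identity in $G$ and a continuous map $\sigma\colon U\to E$ with $\pi\circ\sigma=\mathrm{id}_U$. An isomorphism of extensions is an isomorphism of topological groups $E\to E'$ compatible with the identity maps on $A$ and on $G$. *)

theory Defs
  imports "HOL-Analysis.Analysis" "HOL-Algebra.Bij" "HOL-Algebra.Coset" "HOL-Algebra.FiniteProduct"
begin

section \<open>Topological groups\<close>

record 'a topgroup = "'a monoid" +
  topo :: "'a topology"

definition topological_group :: "'a topgroup \<Rightarrow> bool" where
  "topological_group G \<longleftrightarrow>
     group G \<and> topspace (topo G) = carrier G \<and>
     continuous_map (prod_topology (topo G) (topo G)) (topo G) (\<lambda>(x, y). x \<otimes>\<^bsub>G\<^esub> y) \<and>
     continuous_map (topo G) (topo G) (\<lambda>x. inv\<^bsub>G\<^esub> x)"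

text \<open>The Hausdorff axiom is part of the usual convention for locally compact groups.\<close>

definition lcsc_group :: "'a topgroup \<Rightarrow> bool" where
  "lcsc_group G \<longleftrightarrow>
     topological_group G \<and> Hausdorff_space (topo G) \<and>
     locally_compact_space (topo G) \<and> second_countable (topo G)"

definition borel_of :: "'a topology \<Rightarrow> 'a measure" where
  "borel_of X = sigma (topspace X) {U. openin X U}"

definition continuous_action :: "'g topgroup \<Rightarrow> 'a topgroup \<Rightarrow> ('g \<Rightarrow> 'a \<Rightarrow> 'a) \<Rightarrow> bool" where
  "continuous_action G A act \<longleftrightarrow>
     act \<in> hom G (AutoGroup A) \<and>
     continuous_map (prod_topology (topo G) (topo A)) (topo A) (\<lambda>(g, a). act g a)"


section \<open>Locally continuous measurable cohomology\<close>

text \<open>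
  A point of $G^n$ is an extensional function on \<open>{1..n}\<close>, so that the library's product topology
  applies. The coefficient group, although abelian, is a multiplicative group of the
  algebra library: the coefficient \<open>(-1)^i\<close> of the coboundary appears as an exponent.
  For \<open>n = 0\<close> the space $G^0$ is a single point, all functions on it are measurable and continuous,
  and \<open>lcm_cochains G A 0\<close> is a copy of \<open>A\<close>.
\<close>

abbreviation power_top :: "'g topgroup \<Rightarrow> nat \<Rightarrow> (nat \<Rightarrow> 'g) topology" where
  "power_top G n \<equiv> product_topology (\<lambda>_. topo G) {1..n}"

definition lcm_cochains :: "'g topgroup \<Rightarrow> 'a topgroup \<Rightarrow> nat \<Rightarrow> ((nat \<Rightarrow> 'g) \<Rightarrow> 'a) monoid" where
  "lcm_cochains G A n =
     \<lparr>carrier = {f \<in> extensional (topspace (power_top G n)).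
                   f \<in> measurable (borel_of (power_top G n)) (borel_of (topo A)) \<and>
                   (\<exists>U. openin (power_top G n) U \<and> (\<lambda>i\<in>{1..n}. \<one>\<^bsub>G\<^esub>) \<in> U \<and>
                        continuous_map (subtopology (power_top G n) U) (topo A) f)},
      mult = (\<lambda>f g. \<lambda>s\<in>topspace (power_top G n). f s \<otimes>\<^bsub>A\<^esub> g s),
      one = (\<lambda>s\<in>topspace (power_top G n). \<one>\<^bsub>A\<^esub>)\<rparr>"

text \<open>\<open>merge_at G n i\<close> sends $(s_1,\dots,s_{n+1})$ to $(s_1,\dots,s_i s_{i+1},\dots,s_{n+1})$.\<close>

definition merge_at :: "'g topgroup \<Rightarrow> nat \<Rightarrow> nat \<Rightarrow> (nat \<Rightarrow> 'g) \<Rightarrow> nat \<Rightarrow> 'g" where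
  "merge_at G n i s =
     (\<lambda>k\<in>{1..n}. if k < i then s k else if k = i then s i \<otimes>\<^bsub>G\<^esub> s (i + 1) else s (k + 1))"

definition lcm_coboundary ::
  "'g topgroup \<Rightarrow> 'a topgroup \<Rightarrow> ('g \<Rightarrow> 'a \<Rightarrow> 'a) \<Rightarrow> nat \<Rightarrow>
   ((nat \<Rightarrow> 'g) \<Rightarrow> 'a) \<Rightarrow> (nat \<Rightarrow> 'g) \<Rightarrow> 'a" where
  "lcm_coboundary G A act n f =
     (\<lambda>s\<in>topspace (power_top G (n + 1)).
        act (s 1) (f (\<lambda>k\<in>{1..n}. s (k + 1)))
        \<otimes>\<^bsub>A\<^esub> (\<Otimes>\<^bsub>A\<^esub>i\<in>{1..n}. f (merge_at G n i s) [^]\<^bsub>A\<^esub> ((-1) ^ i :: int))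
        \<otimes>\<^bsub>A\<^esub> f (restrict s {1..n}) [^]\<^bsub>A\<^esub> ((-1) ^ (n + 1) :: int))"

definition lcm_cocycles ::
  "'g topgroup \<Rightarrow> 'a topgroup \<Rightarrow> ('g \<Rightarrow> 'a \<Rightarrow> 'a) \<Rightarrow> nat \<Rightarrow> ((nat \<Rightarrow> 'g) \<Rightarrow> 'a) monoid" where
  "lcm_cocycles G A act n =
     (lcm_cochains G A n)
       \<lparr>carrier := kernel (lcm_cochains G A n) (lcm_cochains G A (n + 1)) (lcm_coboundary G A act n)\<rparr>"

text \<open>The next three definitions are only meaningful for \<open>n \<ge> 1\<close>.\<close>

definition lcm_coboundaries ::
  "'g topgroup \<Rightarrow> 'a topgroup \<Rightarrow> ('g \<Rightarrow> 'a \<Rightarrow> 'a) \<Rightarrow> nat \<Rightarrow> ((nat \<Rightarrow> 'g) \<Rightarrow> 'a) set" where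
  "lcm_coboundaries G A act n =
     lcm_coboundary G A act (n - 1) ` carrier (lcm_cochains G A (n - 1))"

definition lcm_cohomology ::
  "'g topgroup \<Rightarrow> 'a topgroup \<Rightarrow> ('g \<Rightarrow> 'a \<Rightarrow> 'a) \<Rightarrow> nat \<Rightarrow> ((nat \<Rightarrow> 'g) \<Rightarrow> 'a) set monoid" where
  "lcm_cohomology G A act n = lcm_cocycles G A act n Mod lcm_coboundaries G A act n"

definition lcm_class ::
  "'g topgroup \<Rightarrow> 'a topgroup \<Rightarrow> ('g \<Rightarrow> 'a \<Rightarrow> 'a) \<Rightarrow> nat \<Rightarrow>
   ((nat \<Rightarrow> 'g) \<Rightarrow> 'a) \<Rightarrow> ((nat \<Rightarrow> 'g) \<Rightarrow> 'a) set" where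
  "lcm_class G A act n f = lcm_coboundaries G A act n #>\<^bsub>lcm_cocycles G A act n\<^esub> f"


section \<open>Extensions\<close>

record ('a, 'e, 'g) extension =
  total :: "'e topgroup"
  incl :: "'a \<Rightarrow> 'e"
  proj :: "'e \<Rightarrow> 'g"

definition is_extension ::
  "'g topgroup \<Rightarrow> 'a topgroup \<Rightarrow> ('g \<Rightarrow> 'a \<Rightarrow> 'a) \<Rightarrow> ('a, 'e, 'g) extension \<Rightarrow> bool" where
  "is_extension G A act X \<longleftrightarrow>
     topological_group (total X) \<and>
     incl X \<in> hom A (total X) \<and> inj_on (incl X) (carrier A) \<and>
     proj X \<in> hom (total X) G \<and> proj X ` carrier (total X) = carrier G \<and>
     incl X ` carrier A = kernel (total X) G (proj X) \<and>
     continuous_map (topo A) (topo (total X)) (incl X) \<and>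
     closed_map (topo A) (topo (total X)) (incl X) \<and>
     continuous_map (topo (total X)) (topo G) (proj X) \<and>
     open_map (topo (total X)) (topo G) (proj X) \<and>
     (\<forall>e\<in>carrier (total X). \<forall>a\<in>carrier A.
        e \<otimes>\<^bsub>total X\<^esub> incl X a \<otimes>\<^bsub>total X\<^esub> inv\<^bsub>total X\<^esub> e = incl X (act (proj X e) a))"

definition locally_split :: "'g topgroup \<Rightarrow> ('a, 'e, 'g) extension \<Rightarrow> bool" where
  "locally_split G X \<longleftrightarrow>
     (\<exists>U \<sigma>. openin (topo G) U \<and> \<one>\<^bsub>G\<^esub> \<in> U \<and>
            continuous_map (subtopology (topo G) U) (topo (total X)) \<sigma> \<and>
            (\<forall>s\<in>U. proj X (\<sigma> s) = s))"

definition locally_split_extensions ::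
  "'g topgroup \<Rightarrow> 'a topgroup \<Rightarrow> ('g \<Rightarrow> 'a \<Rightarrow> 'a) \<Rightarrow> ('a, 'e, 'g) extension set" where
  "locally_split_extensions G A act = {X. is_extension G A act X \<and> locally_split G X}"

text \<open>The total groups may live on different types.\<close>

definition isomorphic_extensions ::
  "'a topgroup \<Rightarrow> ('a, 'e, 'g) extension \<Rightarrow> ('a, 'f, 'g) extension \<Rightarrow> bool" where
  "isomorphic_extensions A X Y \<longleftrightarrow>
     (\<exists>\<phi>. \<phi> \<in> iso (total X) (total Y) \<and>
          homeomorphic_map (topo (total X)) (topo (total Y)) \<phi> \<and>
          (\<forall>a\<in>carrier A. \<phi> (incl X a) = incl Y a) \<and>
          (\<forall>e\<in>carrier (total X). proj Y (\<phi> e) = proj X e))"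

definition extension_iso_rel ::
  "'g topgroup \<Rightarrow> 'a topgroup \<Rightarrow> ('g \<Rightarrow> 'a \<Rightarrow> 'a) \<Rightarrow>
   (('a, 'e, 'g) extension \<times> ('a, 'e, 'g) extension) set" where
  "extension_iso_rel G A act =
     {(X, Y). X \<in> locally_split_extensions G A act \<and> Y \<in> locally_split_extensions G A act \<and>
              isomorphic_extensions A X Y}"

definition lcm_section :: "'g topgroup \<Rightarrow> ('a, 'e, 'g) extension \<Rightarrow> ('g \<Rightarrow> 'e) \<Rightarrow> bool" where
  "lcm_section G X \<sigma> \<longleftrightarrow>
     \<sigma> \<in> measurable (borel_of (topo G)) (borel_of (topo (total X))) \<and>
     (\<forall>s\<in>carrier G. proj X (\<sigma> s) = s) \<and>
     (\<exists>U. openin (topo G) U \<and> \<one>\<^bsub>G\<^esub> \<in> U \<and>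
          continuous_map (subtopology (topo G) U) (topo (total X)) \<sigma>)"

text \<open>
  The product $\sigma(s_1)\sigma(s_2)\sigma(s_1s_2)^{-1}$ lies in the kernel of the projection,
  that is, in the image of the injective map \<open>incl X\<close>.
\<close>

definition section_cocycle ::
  "'g topgroup \<Rightarrow> 'a topgroup \<Rightarrow> ('a, 'e, 'g) extension \<Rightarrow> ('g \<Rightarrow> 'e) \<Rightarrow> (nat \<Rightarrow> 'g) \<Rightarrow> 'a" where
  "section_cocycle G A X \<sigma> =
     (\<lambda>s\<in>topspace (power_top G 2).
        inv_into (carrier A) (incl X)
          (\<sigma> (s 1) \<otimes>\<^bsub>total X\<^esub> \<sigma> (s 2) \<otimes>\<^bsub>total X\<^esub> inv\<^bsub>total X\<^esub> (\<sigma> (s 1 \<otimes>\<^bsub>G\<^esub> s 2))))"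

end

theory Submission
  imports Defs
begin

text \<open>
  Two measurable sections of a locally split extension differ by a one-cochain, so the class of the
  section cocycle is well defined; if two extensions have sections with the same cocycle, matching
  the coordinates given by the sections is a group isomorphism, continuous near the identity and
  hence everywhere. The point is to realise a given cocycle \<open>f\<close>. The twisted product on
  \<open>A \<times> G\<close> is topologised by declaring a small set \<open>A \<times> U\<close>, with the product topology, and all its
  left translates to be open charts. Since \<open>f\<close> is continuous near the identity, multiplication and
  inversion are continuous there, but conjugation by a fixed element involves values of \<open>f\<close> far from
  the identity, where \<open>f\<close> is only measurable. Its \<open>A\<close>-component on \<open>G\<close> is a measurable map which is a
  crossed homomorphism up to a factor that is continuous near the identity, and the Baire category
  theorem makes every such map continuous near the identity.
\<close>

section \<open>Borel sets and Baire category in abstract topologies\<close>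

text \<open>The product topology on all of A x G is no candidate for a general cocycle, because the
  twisted multiplication involves every value of \<open>f\<close>. A topology generated by left
  translates of one chart is left invariant by construction; multiplication and inversion away from
  the identity then hinge on continuity of conjugations at the identity, and this is the one place
  where regularity has to be gained.

  The gain rests on a difference property: for fixed t, the quotient of k(x) by k(xt) is continuous
  in x near the identity, so continuity at generic points xt is carried back to x. One t must be
  generic for all x under consideration, and Baire allows only countably many conditions at a time;
  continuity is therefore tested on countable sets, which suffices in a first countable space.

  Isomorphism classes form a set only for a fixed type of total groups. The injection
  \<open>code\<close> gives that type room for a copy of A x G; a section splits every extension as
  a set into A x G, so no class is lost.\<close>

lemma space_borel_of [simp]: "space (borel_of X) = topspace X"
  unfolding borel_of_def by (rule space_measure_of) (auto dest: openin_subset)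

lemma sets_borel_of: "sets (borel_of X) = sigma_sets (topspace X) {U. openin X U}"
  unfolding borel_of_def by (rule sets_measure_of) (auto dest: openin_subset)

lemma openin_borel_of: "openin X U \<Longrightarrow> U \<in> sets (borel_of X)"
  by (simp add: sets_borel_of sigma_sets.Basic)

lemma measurable_borel_ofI:
  assumes "f \<in> space M \<rightarrow> topspace Y"
    and "\<And>V. openin Y V \<Longrightarrow> {x \<in> space M. f x \<in> V} \<in> sets M"
  shows "f \<in> measurable M (borel_of Y)"
  unfolding borel_of_def
proof (rule measurable_measure_of)
  show "{U. openin Y U} \<subseteq> Pow (topspace Y)"
    by (auto dest: openin_subset)
qed (use assms in \<open>auto simp: vimage_def Int_def conj_commute\<close>)

lemma measurable_borel_of_preimage:
  "f \<in> measurable M (borel_of Y) \<Longrightarrow> openin Y V \<Longrightarrow> {x \<in> space M. f x \<in> V} \<in> sets M"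
  using measurable_sets[OF _ openin_borel_of, of f M Y V]
  by (simp add: vimage_def Int_def conj_commute)

lemma continuous_imp_borel_measurable:
  "continuous_map X Y f \<Longrightarrow> f \<in> measurable (borel_of X) (borel_of Y)"
  by (rule measurable_borel_ofI) (auto simp: continuous_map_def intro: openin_borel_of)

lemma measurable_continuous_compose:
  assumes "f \<in> measurable M (borel_of X)" and "continuous_map X Y g"
  shows "(\<lambda>x. g (f x)) \<in> measurable M (borel_of Y)"
  using measurable_compose[OF assms(1) continuous_imp_borel_measurable[OF assms(2)]] .

lemma openin_prod_topologyE:
  assumes "openin (prod_topology X Y) S" and "(x, y) \<in> S"
  obtains U V where "openin X U" "openin Y V" "x \<in> U" "y \<in> V" "U \<times> V \<subseteq> S"
  using assms openin_prod_topology_alt[of X Y S] by metis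

text \<open>The two sides of each basic rectangle are kept as a pair, because measurability of a
  pair of maps needs the preimage of each side separately and not only the rectangle.\<close>

lemma second_countable_prod_rectangles:
  assumes "second_countable X" and "second_countable Y"
  obtains I where "countable I" "\<And>p. p \<in> I \<Longrightarrow> openin X (fst p) \<and> openin Y (snd p)"
    "\<And>V x y. openin (prod_topology X Y) V \<Longrightarrow> (x, y) \<in> V \<Longrightarrow>
      \<exists>p\<in>I. x \<in> fst p \<and> y \<in> snd p \<and> fst p \<times> snd p \<subseteq> V"
proof -
  obtain \<B> where \<B>: "countable \<B>" "\<And>B. B \<in> \<B> \<Longrightarrow> openin X B"
      "\<And>U x. openin X U \<Longrightarrow> x \<in> U \<Longrightarrow> \<exists>B\<in>\<B>. x \<in> B \<and> B \<subseteq> U"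
    using \<open>second_countable X\<close> unfolding second_countable_def by metis
  obtain \<C> where \<C>: "countable \<C>" "\<And>B. B \<in> \<C> \<Longrightarrow> openin Y B"
      "\<And>U x. openin Y U \<Longrightarrow> x \<in> U \<Longrightarrow> \<exists>B\<in>\<C>. x \<in> B \<and> B \<subseteq> U"
    using \<open>second_countable Y\<close> unfolding second_countable_def by metis
  show ?thesis
  proof
    show "countable (\<B> \<times> \<C>)"
      using \<B>(1) \<C>(1) by simp
    show "openin X (fst p) \<and> openin Y (snd p)" if "p \<in> \<B> \<times> \<C>" for p
      using that \<B>(2) \<C>(2) by auto
    fix V x y assume "openin (prod_topology X Y) V" "(x, y) \<in> V"
    then obtain U W where UW: "openin X U" "openin Y W" "x \<in> U" "y \<in> W" "U \<times> W \<subseteq> V"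
      by (rule openin_prod_topologyE)
    obtain B C where "B \<in> \<B>" "x \<in> B" "B \<subseteq> U" "C \<in> \<C>" "y \<in> C" "C \<subseteq> W"
      using \<B>(3)[OF UW(1,3)] \<C>(3)[OF UW(2,4)] by blast
    with UW(5) show "\<exists>p\<in>\<B> \<times> \<C>. x \<in> fst p \<and> y \<in> snd p \<and> fst p \<times> snd p \<subseteq> V"
      by (intro bexI[of _ "(B, C)"]) auto
  qed
qed

lemma second_countable_prod_topology:
  assumes "second_countable X" and "second_countable Y"
  shows "second_countable (prod_topology X Y)"
proof -
  obtain I where I: "countable I" "\<And>p. p \<in> I \<Longrightarrow> openin X (fst p) \<and> openin Y (snd p)"
    "\<And>V x y. openin (prod_topology X Y) V \<Longrightarrow> (x, y) \<in> V \<Longrightarrow>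
      \<exists>p\<in>I. x \<in> fst p \<and> y \<in> snd p \<and> fst p \<times> snd p \<subseteq> V"
    by (rule second_countable_prod_rectangles[OF assms]) (rule that)
  show ?thesis
    unfolding second_countable_def
  proof (intro exI conjI ballI allI impI)
    show "countable ((\<lambda>p. fst p \<times> snd p) ` I)"
      using I(1) by simp
    show "openin (prod_topology X Y) V" if "V \<in> (\<lambda>p. fst p \<times> snd p) ` I" for V
      using that I(2) by (auto simp: openin_prod_Times_iff)
    fix V q assume "openin (prod_topology X Y) V \<and> q \<in> V"
    then show "\<exists>W\<in>(\<lambda>p. fst p \<times> snd p) ` I. q \<in> W \<and> W \<subseteq> V"
      using I(3)[of V "fst q" "snd q"] by (auto simp: mem_Times_iff)
  qed
qed

text \<open>Second countability writes an open set of the product as a countable union of open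
  rectangles, so its preimage is a countable union of intersections of measurable sets.\<close>

lemma measurable_borel_of_pair:
  assumes f: "f \<in> measurable M (borel_of X)" and g: "g \<in> measurable M (borel_of Y)"
    and "second_countable X" and "second_countable Y"
  shows "(\<lambda>x. (f x, g x)) \<in> measurable M (borel_of (prod_topology X Y))"
proof (rule measurable_borel_ofI)
  show "(\<lambda>x. (f x, g x)) \<in> space M \<rightarrow> topspace (prod_topology X Y)"
    using measurable_space[OF f] measurable_space[OF g] by auto
next
  fix V assume V: "openin (prod_topology X Y) V"
  obtain J where J: "countable J" "\<And>p. p \<in> J \<Longrightarrow> openin X (fst p) \<and> openin Y (snd p)"
    "\<And>V x y. openin (prod_topology X Y) V \<Longrightarrow> (x, y) \<in> V \<Longrightarrow>
      \<exists>p\<in>J. x \<in> fst p \<and> y \<in> snd p \<and> fst p \<times> snd p \<subseteq> V"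
    by (rule second_countable_prod_rectangles[OF assms(3,4)]) (rule that)
  define I where "I = {p \<in> J. fst p \<times> snd p \<subseteq> V}"
  have "countable I"
    using J(1) by (simp add: I_def)
  have "(x, y) \<in> V \<longleftrightarrow> (\<exists>p\<in>I. x \<in> fst p \<and> y \<in> snd p)" for x y
    using J(3)[OF V, of x y] unfolding I_def by blast
  then have "{x \<in> space M. (f x, g x) \<in> V} =
      (\<Union>p\<in>I. {x \<in> space M. f x \<in> fst p} \<inter> {x \<in> space M. g x \<in> snd p})"
    by auto
  also have "\<dots> \<in> sets M"
    using \<open>countable I\<close> J(2) I_def
    by (intro sets.countable_UN' subsetI)
      (auto intro!: sets.Int measurable_borel_of_preimage[OF f] measurable_borel_of_preimage[OF g])
  finally show "{x \<in> space M. (f x, g x) \<in> V} \<in> sets M" .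
qed

lemma measurable_continuous_compose2:
  assumes "continuous_map (prod_topology X Y) Z (\<lambda>(x, y). h x y)"
    and "f \<in> measurable M (borel_of X)" and "g \<in> measurable M (borel_of Y)"
    and "second_countable X" and "second_countable Y"
  shows "(\<lambda>x. h (f x) (g x)) \<in> measurable M (borel_of Z)"
  using measurable_continuous_compose[OF measurable_borel_of_pair[OF assms(2-5)] assms(1)] by simp

text \<open>Glues countably many continuous pieces that need not agree on overlaps: taking the least
  index cuts the space into disjoint sets, each a difference of open sets, hence Borel. It turns a
  local continuous section and its translates into a global measurable one.\<close>

lemma measurable_first_piece:
  fixes T :: "nat \<Rightarrow> 'x set"
  assumes T: "\<And>n. openin X (T n)" "topspace X \<subseteq> (\<Union>n. T n)"
    and f: "\<And>n. continuous_map (subtopology X (T n)) Y (f n)"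
  shows "(\<lambda>x. f (LEAST n. x \<in> T n) x) \<in> measurable (borel_of X) (borel_of Y)"
proof (rule measurable_borel_ofI)
  let ?n = "\<lambda>x. LEAST n. x \<in> T n"
  have n: "x \<in> T (?n x)" if "x \<in> topspace X" for x
    using T(2) that by (auto intro: LeastI)
  show "(\<lambda>x. f (?n x) x) \<in> space (borel_of X) \<rightarrow> topspace Y"
    using n f by (fastforce simp: continuous_map_def)
  fix V assume V: "openin Y V"
  let ?S = "\<lambda>n. {x \<in> topspace (subtopology X (T n)). f n x \<in> V}"
  have "openin X (?S n)" for n
    using openin_continuous_map_preimage[OF f V] openin_trans_full[OF _ T(1)] by blast
  then have "(\<Union>n. ?S n - (\<Union>m<n. T m)) \<in> sets (borel_of X)"
    using T(1) by (intro sets.countable_UN sets.Diff sets.finite_UN image_subsetI) (auto intro: openin_borel_of)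
  moreover have "{x \<in> space (borel_of X). f (?n x) x \<in> V} = (\<Union>n. ?S n - (\<Union>m<n. T m))" (is "?L = ?R")
  proof
    show "?L \<subseteq> ?R"
    proof
      fix x assume "x \<in> ?L"
      then have "x \<in> ?S (?n x) - (\<Union>m<?n x. T m)"
        using n by (auto dest: not_less_Least)
      then show "x \<in> ?R" by blast
    qed
    show "?R \<subseteq> ?L"
    proof
      fix x assume "x \<in> ?R"
      then obtain n where n: "x \<in> ?S n" "\<And>m. m < n \<Longrightarrow> x \<notin> T m" by blast
      then have "?n x = n"
        by (intro Least_equality) (auto simp: not_less[symmetric])
      with n show "x \<in> ?L" by auto
    qed
  qed
  ultimately show "{x \<in> space (borel_of X). f (?n x) x \<in> V} \<in> sets (borel_of X)"
    by simp
qed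

text \<open>Sets that agree with an open set off a meagre set form a sigma-algebra containing the
  open sets. The comeagre set is stored as a countable family of dense open sets, not as its
  intersection, so families can be merged or translated and Baire's theorem is invoked only once, at
  the end.\<close>

lemma borel_of_Baire_property:
  assumes "S \<in> sets (borel_of X)"
  obtains U \<D> where "openin X U" "countable \<D>"
    "\<And>D. D \<in> \<D> \<Longrightarrow> openin X D \<and> X closure_of D = topspace X"
    "\<And>x. x \<in> topspace X \<Longrightarrow> (\<forall>D\<in>\<D>. x \<in> D) \<Longrightarrow> x \<in> S \<longleftrightarrow> x \<in> U"
proof -
  define P where "P S U \<D> \<longleftrightarrow> openin X U \<and> countable \<D> \<and>
    (\<forall>D\<in>\<D>. openin X D \<and> X closure_of D = topspace X) \<and>
    (\<forall>x\<in>topspace X. (\<forall>D\<in>\<D>. x \<in> D) \<longrightarrow> (x \<in> S \<longleftrightarrow> x \<in> U))" for S U \<D>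
  have "\<exists>U \<D>. P S U \<D>"
    using assms unfolding sets_borel_of
  proof (induction rule: sigma_sets.induct)
    case (Basic S)
    then have "P S S {}" by (simp add: P_def)
    then show ?case by blast
  next
    case Empty
    have "P {} {} {}" by (simp add: P_def)
    then show ?case by blast
  next
    case (Compl S)
    then obtain U \<D> where P: "P S U \<D>" by blast
    then have "openin X U" by (simp add: P_def)
    \<comment> \<open>The complement is approximated by the exterior of \<open>U\<close>. The two
      differ by the boundary of \<open>U\<close>, which is avoided by adding the dense open set
      \<open>U \<union> ?V\<close> to the family.\<close>
    let ?V = "topspace X - X closure_of U"
    have "openin X (U \<union> ?V)"
      using \<open>openin X U\<close> by (simp add: openin_Un openin_diff)
    moreover have "X closure_of (U \<union> ?V) = topspace X"
    proof
      show "X closure_of (U \<union> ?V) \<subseteq> topspace X"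
        by (rule closure_of_subset_topspace)
      have "?V \<subseteq> X closure_of ?V"
        by (rule closure_of_subset) auto
      then show "topspace X \<subseteq> X closure_of (U \<union> ?V)"
        by auto
    qed
    moreover have "U \<subseteq> X closure_of U"
      using \<open>openin X U\<close> by (simp add: closure_of_subset openin_subset)
    moreover have "x \<in> topspace X - S \<longleftrightarrow> x \<in> ?V"
      if "x \<in> topspace X" "\<forall>D\<in>insert (U \<union> ?V) \<D>. x \<in> D" for x
    proof -
      have "x \<in> S \<longleftrightarrow> x \<in> U" "x \<in> U \<or> x \<in> ?V"
        using P that by (simp_all add: P_def)
      with \<open>U \<subseteq> X closure_of U\<close> that(1) show ?thesis
        by auto
    qed
    ultimately have "P (topspace X - S) ?V (insert (U \<union> ?V) \<D>)"
      using P unfolding P_def by (metis closedin_closure_of countable_insert insert_iff openin_diff openin_topspace)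
    then show ?case by blast
  next
    case (Union S)
    then obtain U \<D> where P: "\<And>i. P (S i) (U i) (\<D> i)" by metis
    moreover have "x \<in> (\<Union>i. S i) \<longleftrightarrow> x \<in> (\<Union>i. U i)"
      if "x \<in> topspace X" "\<forall>D\<in>(\<Union>i. \<D> i). x \<in> D" for x
    proof -
      have "x \<in> S i \<longleftrightarrow> x \<in> U i" for i
        using P[of i] that unfolding P_def by simp
      then show ?thesis by simp
    qed
    moreover have "openin X (U i)" "countable (\<D> i)"
      "D \<in> \<D> i \<Longrightarrow> openin X D \<and> X closure_of D = topspace X" for i D
      using P[of i] unfolding P_def by simp_all
    ultimately have "P (\<Union>i. S i) (\<Union>i. U i) (\<Union>i. \<D> i)"
      unfolding P_def by (intro conjI ballI openin_Union countable_UN) auto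
    then show ?case by blast
  qed
  then show ?thesis
    using that unfolding P_def by metis
qed

text \<open>The Baire property is applied to the preimages of a countable base of \<open>Y\<close>;
  inside all exceptional dense open sets these preimages are traces of open sets. The conclusion is
  for every subset \<open>C\<close>, because it will be used on a translate of a countable
  set.\<close>

lemma borel_of_continuous_on_comeagre:
  assumes k: "k \<in> measurable (borel_of X) (borel_of Y)" and "second_countable Y"
  obtains \<D> where "countable \<D>"
    "\<And>D. D \<in> \<D> \<Longrightarrow> openin X D \<and> X closure_of D = topspace X"
    "\<And>C. (\<And>D. D \<in> \<D> \<Longrightarrow> C \<subseteq> D) \<Longrightarrow> continuous_map (subtopology X C) Y k"
proof -
  obtain \<B> where \<B>: "countable \<B>" "\<And>B. B \<in> \<B> \<Longrightarrow> openin Y B"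
      "\<And>U y. openin Y U \<Longrightarrow> y \<in> U \<Longrightarrow> \<exists>B\<in>\<B>. y \<in> B \<and> B \<subseteq> U"
    using \<open>second_countable Y\<close> unfolding second_countable_def by metis
  have "\<exists>U \<D>. openin X U \<and> countable \<D> \<and>
      (\<forall>D\<in>\<D>. openin X D \<and> X closure_of D = topspace X) \<and>
      (\<forall>x\<in>topspace X. (\<forall>D\<in>\<D>. x \<in> D) \<longrightarrow> (k x \<in> B \<longleftrightarrow> x \<in> U))" if "B \<in> \<B>" for B
    using borel_of_Baire_property[OF measurable_borel_of_preimage[OF k \<B>(2)[OF that]]]
    by (smt (verit) mem_Collect_eq space_borel_of)
  then obtain U \<D> where UD: "\<And>B. B \<in> \<B> \<Longrightarrow> openin X (U B) \<and> countable (\<D> B) \<and>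
      (\<forall>D\<in>\<D> B. openin X D \<and> X closure_of D = topspace X) \<and>
      (\<forall>x\<in>topspace X. (\<forall>D\<in>\<D> B. x \<in> D) \<longrightarrow> (k x \<in> B \<longleftrightarrow> x \<in> U B))"
    by metis
  show ?thesis
  proof
    show "countable (\<Union>(\<D> ` \<B>))"
      using \<B>(1) UD by blast
    show "openin X D \<and> X closure_of D = topspace X" if "D \<in> \<Union>(\<D> ` \<B>)" for D
      using that UD by blast
    fix C assume C: "\<And>D. D \<in> \<Union>(\<D> ` \<B>) \<Longrightarrow> C \<subseteq> D"
    show "continuous_map (subtopology X C) Y k"
      unfolding continuous_map_def
    proof (intro conjI allI impI)
      show "k \<in> topspace (subtopology X C) \<rightarrow> topspace Y"
        using measurable_space[OF k] by auto
      fix V assume V: "openin Y V"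
      have *: "k x \<in> B \<longleftrightarrow> x \<in> U B" if "B \<in> \<B>" "x \<in> topspace X" "x \<in> C" for x B
      proof -
        have "\<forall>D\<in>\<D> B. x \<in> D"
          using that C by blast
        with UD that show ?thesis by blast
      qed
      show "openin (subtopology X C) {x \<in> topspace (subtopology X C). k x \<in> V}"
      proof (subst openin_subopen, safe)
        fix x assume x: "x \<in> topspace (subtopology X C)" "k x \<in> V"
        then obtain B where B: "B \<in> \<B>" "k x \<in> B" "B \<subseteq> V"
          using \<B>(3) V by blast
        show "\<exists>T. openin (subtopology X C) T \<and> x \<in> T \<and>
            T \<subseteq> {x \<in> topspace (subtopology X C). k x \<in> V}"
        proof (intro exI conjI)
          show "openin (subtopology X C) (U B \<inter> C)"
            using UD[OF B(1)] by (simp add: openin_subtopology_Int)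
          show "x \<in> U B \<inter> C"
            using *[OF B(1)] x B(2) by auto
          show "U B \<inter> C \<subseteq> {x \<in> topspace (subtopology X C). k x \<in> V}"
            using *[OF B(1)] B UD[OF B(1)] openin_subset by fastforce
        qed
      qed
    qed
  qed
qed

text \<open>A failure of continuity at x is visible on a countable set: pick a bad point in each
  member of a countable neighbourhood base of x and add x itself. This is what reduces continuity to
  countably many conditions for Baire.\<close>

lemma first_countable_continuous_map_countable:
  assumes "first_countable X" and f: "\<And>x. x \<in> topspace X \<Longrightarrow> f x \<in> topspace Y"
    and cont: "\<And>S. countable S \<Longrightarrow> S \<subseteq> topspace X \<Longrightarrow> continuous_map (subtopology X S) Y f"
  shows "continuous_map X Y f"
  unfolding continuous_map_def
proof (intro conjI allI impI)
  show "f \<in> topspace X \<rightarrow> topspace Y"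
    using f by auto
  fix V assume V: "openin Y V"
  show "openin X {x \<in> topspace X. f x \<in> V}"
  proof (subst openin_subopen, rule ccontr)
    assume "\<not> (\<forall>x\<in>{x \<in> topspace X. f x \<in> V}. \<exists>T. openin X T \<and> x \<in> T \<and> T \<subseteq> {x \<in> topspace X. f x \<in> V})"
    then obtain x where x: "x \<in> topspace X" "f x \<in> V"
      and no: "\<And>T. openin X T \<Longrightarrow> x \<in> T \<Longrightarrow> \<not> T \<subseteq> {x \<in> topspace X. f x \<in> V}"
      by blast
    obtain \<B> where \<B>: "countable \<B>" "\<And>B. B \<in> \<B> \<Longrightarrow> openin X B"
        "\<And>U. openin X U \<Longrightarrow> x \<in> U \<Longrightarrow> \<exists>B\<in>\<B>. x \<in> B \<and> B \<subseteq> U"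
      using \<open>first_countable X\<close> x(1) unfolding first_countable_def by metis
    have "\<exists>y. y \<in> B \<and> y \<in> topspace X \<and> f y \<notin> V" if "B \<in> \<B>" "x \<in> B" for B
      using no[OF \<B>(2)[OF that(1)] that(2)] openin_subset[OF \<B>(2)[OF that(1)]] by blast
    then obtain y where y: "\<And>B. B \<in> \<B> \<Longrightarrow> x \<in> B \<Longrightarrow> y B \<in> B \<and> y B \<in> topspace X \<and> f (y B) \<notin> V"
      by metis
    define S where "S = insert x (y ` {B \<in> \<B>. x \<in> B})"
    have "countable S" "S \<subseteq> topspace X"
      using \<B>(1) y x by (auto simp: S_def)
    then have "openin (subtopology X S) {z \<in> topspace (subtopology X S). f z \<in> V}"
      using cont V unfolding continuous_map_def by blast
    then obtain T where T: "openin X T" "{z \<in> topspace (subtopology X S). f z \<in> V} = T \<inter> S"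
      by (auto simp: openin_subtopology)
    have "x \<in> T"
      using x T(2) by (auto simp: S_def)
    then obtain B where B: "B \<in> \<B>" "x \<in> B" "B \<subseteq> T"
      using \<B>(3) T(1) by blast
    then have "y B \<in> T \<inter> S"
      using y by (auto simp: S_def)
    with T(2) y B show False
      by auto
  qed
qed

section \<open>Topological groups\<close>

lemma continuous_map_compose':
  "continuous_map X Y f \<Longrightarrow> continuous_map Y Z g \<Longrightarrow> continuous_map X Z (\<lambda>x. g (f x))"
  using continuous_map_compose[of X Y f Z g] by (simp add: o_def)

lemma continuous_map_ident: "continuous_map X X (\<lambda>x. x)"
  using continuous_map_id[of X] by (simp add: id_def)

lemma continuous_map_local:
  assumes "\<And>x. x \<in> topspace X \<Longrightarrow> \<exists>U. openin X U \<and> x \<in> U \<and> continuous_map (subtopology X U) Y f"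
  shows "continuous_map X Y f"
proof -
  obtain U where U: "\<And>x. x \<in> topspace X \<Longrightarrow>
      openin X (U x) \<and> x \<in> U x \<and> continuous_map (subtopology X (U x)) Y f"
    using assms by metis
  show ?thesis
  proof (rule pasting_lemma[where I = "topspace X" and T = U and f = "\<lambda>_. f"])
    show "\<exists>j. j \<in> topspace X \<and> x \<in> U j \<and> f x = f x" if "x \<in> topspace X" for x
      using that U by blast
  qed (use U in auto)
qed

lemma (in group) mult_inv_cancel:
  assumes "x \<in> carrier G" and "y \<in> carrier G"
  shows "x \<otimes> (inv x \<otimes> y) = y" and "inv x \<otimes> (x \<otimes> y) = y"
  using assms by (simp_all flip: m_assoc)

locale topgroup = group G for G :: "'a topgroup" (structure) +
  assumes topological: "topological_group G"
begin

lemma topspace_topo [simp]: "topspace (topo G) = carrier G"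
  using topological by (simp add: topological_group_def)

lemma continuous_map_mult:
  assumes "continuous_map X (topo G) f" and "continuous_map X (topo G) g"
  shows "continuous_map X (topo G) (\<lambda>x. f x \<otimes> g x)"
proof -
  have "continuous_map (prod_topology (topo G) (topo G)) (topo G) (\<lambda>(x, y). x \<otimes> y)"
    using topological by (simp add: topological_group_def)
  from continuous_map_compose'[OF continuous_map_pairedI[OF assms] this] show ?thesis
    by simp
qed

lemma continuous_map_inv:
  assumes "continuous_map X (topo G) f"
  shows "continuous_map X (topo G) (\<lambda>x. inv (f x))"
  using continuous_map_compose'[OF assms, of "topo G" "\<lambda>x. inv x"] topological
  by (simp add: topological_group_def)

lemma continuous_map_const_carrier: "c \<in> carrier G \<Longrightarrow> continuous_map X (topo G) (\<lambda>x. c)"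
  by simp

lemma continuous_map_carrier: "continuous_map X (topo G) f \<Longrightarrow> x \<in> topspace X \<Longrightarrow> f x \<in> carrier G"
  by (auto simp: continuous_map_def)

lemma openin_carrier: "openin (topo G) U \<Longrightarrow> U \<subseteq> carrier G"
  using openin_subset by fastforce

lemma continuous_map_l_translate: "g \<in> carrier G \<Longrightarrow> continuous_map (topo G) (topo G) (\<lambda>x. g \<otimes> x)"
  by (intro continuous_map_mult continuous_map_const_carrier continuous_map_ident)

lemma continuous_map_r_translate: "g \<in> carrier G \<Longrightarrow> continuous_map (topo G) (topo G) (\<lambda>x. x \<otimes> g)"
  by (intro continuous_map_mult continuous_map_const_carrier continuous_map_ident)

lemma openin_l_translate:
  "g \<in> carrier G \<Longrightarrow> openin (topo G) U \<Longrightarrow> openin (topo G) {x \<in> carrier G. g \<otimes> x \<in> U}"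
  using openin_continuous_map_preimage[OF continuous_map_l_translate] by force

lemma dense_l_translate:
  assumes g: "g \<in> carrier G" and D: "topo G closure_of D = carrier G"
  shows "topo G closure_of {x \<in> carrier G. g \<otimes> x \<in> D} = carrier G"
proof
  show "carrier G \<subseteq> topo G closure_of {x \<in> carrier G. g \<otimes> x \<in> D}"
  proof
    fix x assume x: "x \<in> carrier G"
    show "x \<in> topo G closure_of {x \<in> carrier G. g \<otimes> x \<in> D}"
      unfolding in_closure_of
    proof (intro conjI allI impI)
      fix U assume U: "x \<in> U \<and> openin (topo G) U"
      then have "openin (topo G) {y \<in> carrier G. inv g \<otimes> y \<in> U}" "U \<subseteq> carrier G"
        using openin_l_translate[of "inv g"] g openin_carrier by auto
      moreover have "g \<otimes> x \<in> {y \<in> carrier G. inv g \<otimes> y \<in> U}"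
        using g x U by (simp flip: m_assoc)
      moreover have "\<forall>T. g \<otimes> x \<in> T \<and> openin (topo G) T \<longrightarrow> (\<exists>y. y \<in> D \<and> y \<in> T)"
        using g x D in_closure_of[of "g \<otimes> x" "topo G" D] by simp
      ultimately have "\<exists>y. y \<in> D \<and> y \<in> {y \<in> carrier G. inv g \<otimes> y \<in> U}"
        by presburger
      then obtain y where y: "y \<in> D" "y \<in> carrier G" "inv g \<otimes> y \<in> U"
        by auto
      then have "g \<otimes> (inv g \<otimes> y) \<in> D"
        using g by (simp flip: m_assoc)
      with y g show "\<exists>y. y \<in> {x \<in> carrier G. g \<otimes> x \<in> D} \<and> y \<in> U"
        by (intro exI[of _ "inv g \<otimes> y"]) simp
    qed (use x in simp)
  qed
qed (use closure_of_subset_topspace[of "topo G"] in auto)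

text \<open>Translates of \<open>U\<close> cover the group, and the Lindelof property extracts
  countably many. The identity is put at index 0 so that a construction by least index agrees with
  its first piece near the identity and keeps that piece's continuity.\<close>

lemma second_countable_translates:
  assumes "second_countable (topo G)" and "openin (topo G) U" and "\<one> \<in> U"
  obtains g :: "nat \<Rightarrow> 'a" where "range g \<subseteq> carrier G" "g 0 = \<one>"
    "\<And>x. x \<in> carrier G \<Longrightarrow> \<exists>i. inv (g i) \<otimes> x \<in> U"
proof -
  let ?T = "\<lambda>g. {x \<in> carrier G. inv g \<otimes> x \<in> U}"
  have "Lindelof_space (topo G)"
    using assms(1) by (rule second_countable_imp_Lindelof_space)
  moreover have "openin (topo G) V" if "V \<in> ?T ` carrier G" for V
    using that assms(2) by (auto intro: openin_l_translate)
  moreover have "\<Union>(?T ` carrier G) = topspace (topo G)"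
    using \<open>\<one> \<in> U\<close> by auto
  ultimately obtain \<V> where \<V>: "countable \<V>" "\<V> \<subseteq> ?T ` carrier G" "\<Union>\<V> = carrier G"
    using Lindelof_spaceD[of "topo G" "?T ` carrier G"] by auto
  then obtain I where I: "countable I" "I \<subseteq> carrier G" "\<V> = ?T ` I"
    using countable_subset_image[THEN iffD1, OF conjI, OF \<V>(1,2)] by auto
  \<comment> \<open>Inserting the identity makes the set nonempty, hence enumerable by all naturals;
    \<open>case_nat\<close> below shifts this enumeration and places the identity at index
    0.\<close>
  obtain h :: "nat \<Rightarrow> 'a" where h: "range h = insert \<one> I"
    using I(1) by (metis countable_insert insert_not_empty range_from_nat_into)
  show ?thesis
  proof
    have "h n \<in> carrier G" for n
      using h I(2) rangeI[of h n] by auto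
    then show "range (case_nat \<one> h) \<subseteq> carrier G"
      by (auto split: nat.splits)
    show "\<exists>i. inv (case_nat \<one> h i) \<otimes> x \<in> U" if "x \<in> carrier G" for x
    proof -
      from that \<V>(3) I(3) obtain g where g: "g \<in> I" "inv g \<otimes> x \<in> U"
        by auto
      then obtain n where "g = h n"
        using h by (metis insertI2 rangeE)
      with g show ?thesis
        by (intro exI[of _ "Suc n"]) simp
    qed
  qed simp
qed

end

section \<open>Measurable maps into a topological group\<close>

lemma (in topgroup) measurable_mult:
  assumes "second_countable (topo G)"
    and "f \<in> measurable M (borel_of (topo G))" and "g \<in> measurable M (borel_of (topo G))"
  shows "(\<lambda>x. f x \<otimes> g x) \<in> measurable M (borel_of (topo G))"
proof -
  have "continuous_map (prod_topology (topo G) (topo G)) (topo G) (\<lambda>(x, y). x \<otimes> y)"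
    using topological by (simp add: topological_group_def)
  from measurable_continuous_compose2[OF this assms(2,3,1,1)] show ?thesis .
qed

lemma (in topgroup) measurable_inv:
  "f \<in> measurable M (borel_of (topo G)) \<Longrightarrow> (\<lambda>x. inv (f x)) \<in> measurable M (borel_of (topo G))"
  using topological by (auto simp: topological_group_def intro: measurable_continuous_compose)

lemma (in topgroup) measurable_const_carrier:
  "c \<in> carrier G \<Longrightarrow> (\<lambda>x. c) \<in> measurable M (borel_of (topo G))"
  by simp

lemma topgroup_iff: "topgroup G \<longleftrightarrow> topological_group G"
  by (auto simp: topgroup_def topgroup_axioms_def topological_group_def)

text \<open>Homogeneity: \<phi>(x) = \<phi>(e) \<phi>(e^-1 x), and e^-1 x lies in \<open>V\<close>
  when x is near e.\<close>

lemma hom_continuous_map: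
  assumes "topological_group E" and "topological_group F" and hom: "\<phi> \<in> hom E F"
    and V: "openin (topo E) V" "\<one>\<^bsub>E\<^esub> \<in> V"
    and cont: "continuous_map (subtopology (topo E) V) (topo F) \<phi>"
  shows "continuous_map (topo E) (topo F) \<phi>"
proof (rule continuous_map_local)
  interpret E: topgroup E using assms(1) by (simp add: topgroup_iff)
  interpret F: topgroup F using assms(2) by (simp add: topgroup_iff)
  fix e assume "e \<in> topspace (topo E)"
  then have e: "e \<in> carrier E" by simp
  let ?U = "{x \<in> carrier E. inv\<^bsub>E\<^esub> e \<otimes>\<^bsub>E\<^esub> x \<in> V}"
  have "continuous_map (subtopology (topo E) ?U) (topo F) (\<lambda>x. \<phi> e \<otimes>\<^bsub>F\<^esub> \<phi> (inv\<^bsub>E\<^esub> e \<otimes>\<^bsub>E\<^esub> x))"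
  proof (intro F.continuous_map_mult F.continuous_map_const_carrier)
    show "\<phi> e \<in> carrier F"
      using hom e by (auto simp: hom_def)
    have "continuous_map (subtopology (topo E) ?U) (subtopology (topo E) V) (\<lambda>x. inv\<^bsub>E\<^esub> e \<otimes>\<^bsub>E\<^esub> x)"
      using e by (intro continuous_map_into_subtopology continuous_map_from_subtopology
        E.continuous_map_l_translate) auto
    from continuous_map_compose'[OF this cont]
    show "continuous_map (subtopology (topo E) ?U) (topo F) (\<lambda>x. \<phi> (inv\<^bsub>E\<^esub> e \<otimes>\<^bsub>E\<^esub> x))" .
  qed
  moreover have "\<phi> e \<otimes>\<^bsub>F\<^esub> \<phi> (inv\<^bsub>E\<^esub> e \<otimes>\<^bsub>E\<^esub> x) = \<phi> x" if "x \<in> carrier E" for x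
    using that e by (simp flip: hom_mult[OF hom] E.m_assoc)
  ultimately have "continuous_map (subtopology (topo E) ?U) (topo F) \<phi>"
    by (rule continuous_map_eq) simp
  moreover have "openin (topo E) ?U"
    using E.openin_l_translate e V(1) by simp
  moreover have "e \<in> ?U"
    using e V(2) by simp
  ultimately show "\<exists>U. openin (topo E) U \<and> e \<in> U \<and> continuous_map (subtopology (topo E) U) (topo F) \<phi>"
    by blast
qed

text \<open>
  By Baire, for any countable \<open>S \<subseteq> W\<close> some \<open>t \<in> W'\<close> translates all of \<open>S\<close> into a comeagre set on
  which \<open>k\<close> is continuous; hence \<open>x \<mapsto> k (x t)\<close> and so \<open>k\<close> are continuous on \<open>S\<close>.
\<close>

lemma (in topgroup) borel_continuous_if_differences_continuous:
  assumes "locally_compact_space (topo G)" "Hausdorff_space (topo G)" "first_countable (topo G)"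
    and A: "topological_group A" "second_countable (topo A)"
    and k: "k \<in> measurable (borel_of (topo G)) (borel_of (topo A))"
    and W: "W \<subseteq> carrier G" and W': "openin (topo G) W'" "W' \<noteq> {}"
    and diff: "\<And>t. t \<in> W' \<Longrightarrow>
      continuous_map (subtopology (topo G) W) (topo A) (\<lambda>x. inv\<^bsub>A\<^esub> k (x \<otimes> t) \<otimes>\<^bsub>A\<^esub> k x)"
  shows "continuous_map (subtopology (topo G) W) (topo A) k"
proof (rule first_countable_continuous_map_countable)
  interpret A: topgroup A using A(1) by (simp add: topgroup_iff)
  show "first_countable (subtopology (topo G) W)"
    using assms(3) by (rule first_countable_subtopology)
  have k_carrier: "k x \<in> carrier A" if "x \<in> carrier G" for x
    using measurable_space[OF k] that by simp
  then show "k x \<in> topspace (topo A)" if "x \<in> topspace (subtopology (topo G) W)" for x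
    using that by simp
  fix S assume S: "countable S" "S \<subseteq> topspace (subtopology (topo G) W)"
  then have S_G: "S \<subseteq> carrier G" and S_W: "S \<subseteq> W" by auto
  obtain \<D> where \<D>: "countable \<D>"
    "\<And>D. D \<in> \<D> \<Longrightarrow> openin (topo G) D \<and> topo G closure_of D = topspace (topo G)"
    "\<And>C. (\<And>D. D \<in> \<D> \<Longrightarrow> C \<subseteq> D) \<Longrightarrow> continuous_map (subtopology (topo G) C) (topo A) k"
    using borel_of_continuous_on_comeagre[OF k A(2)] by metis
  \<comment> \<open>The condition that s t falls into D, read as a condition on t, is a left
    translate of D and so again dense and open; there are countably many pairs (s, D).\<close>
  let ?T = "\<lambda>(s, D). {x \<in> carrier G. s \<otimes> x \<in> D}"
  have "topo G closure_of \<Inter>(?T ` (S \<times> \<D>)) = topspace (topo G)"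
  proof (rule Baire_category)
    show "completely_metrizable_space (topo G) \<or> locally_compact_space (topo G) \<and> regular_space (topo G)"
      using assms(1,2) locally_compact_Hausdorff_imp_regular_space by blast
    show "countable (?T ` (S \<times> \<D>))"
      using S(1) \<D>(1) by simp
    fix T assume "T \<in> ?T ` (S \<times> \<D>)"
    then show "openin (topo G) T \<and> topo G closure_of T = topspace (topo G)"
      using \<D>(2) S_G by (auto simp: openin_l_translate dense_l_translate subset_iff)
  qed
  moreover obtain w where w: "w \<in> W'" using W'(2) by blast
  ultimately have "w \<in> topo G closure_of \<Inter>(?T ` (S \<times> \<D>))"
    using openin_subset[OF W'(1)] by auto
  \<comment> \<open>A dense intersection meets the nonempty open \<open>W'\<close>, which yields one
    t that is generic for all s in \<open>S\<close> simultaneously and for which the hypothesis on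
    differences is available.\<close>
  with w W'(1) have "\<exists>t. t \<in> \<Inter>(?T ` (S \<times> \<D>)) \<and> t \<in> W'"
    unfolding in_closure_of by presburger
  then obtain t where t: "t \<in> W'" "\<And>s D. s \<in> S \<Longrightarrow> D \<in> \<D> \<Longrightarrow> s \<otimes> t \<in> D"
    by auto
  have t_G: "t \<in> carrier G" using t(1) openin_carrier[OF W'(1)] by blast
  let ?S = "subtopology (topo G) S"
  have "continuous_map ?S (subtopology (topo G) ((\<lambda>s. s \<otimes> t) ` S)) (\<lambda>x. x \<otimes> t)"
    using t_G by (intro continuous_map_into_subtopology continuous_map_from_subtopology
      continuous_map_r_translate) auto
  moreover have "continuous_map (subtopology (topo G) ((\<lambda>s. s \<otimes> t) ` S)) (topo A) k"
    by (rule \<D>(3)) (use t(2) in auto)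
  ultimately have "continuous_map ?S (topo A) (\<lambda>x. k (x \<otimes> t))"
    by (rule continuous_map_compose')
  moreover have "continuous_map ?S (topo A) (\<lambda>x. inv\<^bsub>A\<^esub> k (x \<otimes> t) \<otimes>\<^bsub>A\<^esub> k x)"
    using diff[OF t(1)] S_W by (rule continuous_map_from_subtopology_mono)
  ultimately have "continuous_map ?S (topo A) (\<lambda>x. k (x \<otimes> t) \<otimes>\<^bsub>A\<^esub> (inv\<^bsub>A\<^esub> k (x \<otimes> t) \<otimes>\<^bsub>A\<^esub> k x))"
    by (rule A.continuous_map_mult)
  then have "continuous_map ?S (topo A) k"
    by (rule continuous_map_eq) (use t_G in \<open>simp add: k_carrier flip: A.m_assoc\<close>)
  then show "continuous_map (subtopology (subtopology (topo G) W) S) (topo A) k"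
    using S_W by (simp add: subtopology_subtopology inf.absorb2)
qed

text \<open>The data from which a group topology is built by left translation.
  \<open>translate\<close> makes overlapping translates of the chart compatible; the three
  conditions at the identity are the classical axioms on a neighbourhood base. Conjugation by an
  arbitrary \<open>e\<close>, and not only by elements of the chart, has to be controlled.\<close>

locale group_chart = group E for E :: "('e, 'm) monoid_scheme" (structure) +
  fixes N :: "'e topology"
  assumes chart_carrier: "topspace N \<subseteq> carrier E"
    and one_chart: "\<one> \<in> topspace N"
    and translate: "\<And>e U. e \<in> carrier E \<Longrightarrow> openin N U \<Longrightarrow> openin N {x \<in> topspace N. e \<otimes> x \<in> U}"
    and mult_nbhd: "\<And>W. openin N W \<Longrightarrow> \<one> \<in> W \<Longrightarrow>
      \<exists>V. openin N V \<and> \<one> \<in> V \<and> (\<forall>x\<in>V. \<forall>y\<in>V. x \<otimes> y \<in> W)"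
    and inv_nbhd: "\<And>W. openin N W \<Longrightarrow> \<one> \<in> W \<Longrightarrow> \<exists>V. openin N V \<and> \<one> \<in> V \<and> (\<forall>x\<in>V. inv x \<in> W)"
    and conj_nbhd: "\<And>e W. e \<in> carrier E \<Longrightarrow> openin N W \<Longrightarrow> \<one> \<in> W \<Longrightarrow>
      \<exists>V. openin N V \<and> \<one> \<in> V \<and> (\<forall>x\<in>V. e \<otimes> x \<otimes> inv e \<in> W)"
begin

text \<open>The final topology for the maps x -> e x from the chart \<open>N\<close>, with
  \<open>e\<close> running through the whole group.\<close>

definition group_topology :: "'e topology" where
  "group_topology =
     topology (\<lambda>U. U \<subseteq> carrier E \<and> (\<forall>e\<in>carrier E. openin N {x \<in> topspace N. e \<otimes> x \<in> U}))"

lemma openin_group_topology: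
  "openin group_topology U \<longleftrightarrow>
     U \<subseteq> carrier E \<and> (\<forall>e\<in>carrier E. openin N {x \<in> topspace N. e \<otimes> x \<in> U})"
proof -
  let ?P = "\<lambda>U. U \<subseteq> carrier E \<and> (\<forall>e\<in>carrier E. openin N {x \<in> topspace N. e \<otimes> x \<in> U})"
  have "istopology ?P"
    unfolding istopology_def
  proof (intro conjI allI impI)
    fix S T assume S: "?P S" and T: "?P T"
    then show "S \<inter> T \<subseteq> carrier E" by blast
    have "{x \<in> topspace N. e \<otimes> x \<in> S \<inter> T} =
        {x \<in> topspace N. e \<otimes> x \<in> S} \<inter> {x \<in> topspace N. e \<otimes> x \<in> T}" for e
      by blast
    with S T show "\<forall>e\<in>carrier E. openin N {x \<in> topspace N. e \<otimes> x \<in> S \<inter> T}"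
      by (auto intro: openin_Int)
  next
    fix \<K> assume K: "\<forall>K\<in>\<K>. ?P K"
    then show "\<Union>\<K> \<subseteq> carrier E" by blast
    have "{x \<in> topspace N. e \<otimes> x \<in> \<Union>\<K>} = (\<Union>K\<in>\<K>. {x \<in> topspace N. e \<otimes> x \<in> K})" for e
      by blast
    with K show "\<forall>e\<in>carrier E. openin N {x \<in> topspace N. e \<otimes> x \<in> \<Union>\<K>}"
      by (auto intro!: openin_Union)
  qed
  then show ?thesis
    by (simp add: group_topology_def topology_inverse')
qed

lemma topspace_group_topology: "topspace group_topology = carrier E"
proof -
  have "{x \<in> topspace N. e \<otimes> x \<in> carrier E} = topspace N" if "e \<in> carrier E" for e
    using that chart_carrier by blast
  then have "openin group_topology (carrier E)"
    by (simp add: openin_group_topology)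
  then show ?thesis
    using openin_group_topology[of "topspace group_topology"] openin_subset by fastforce
qed

text \<open>The pointwise form used for continuity: the neighbourhoods of u are generated by u W
  with W a chart neighbourhood of the identity. Conversely, the points y of the chart with x^-1 y in
  W form an open neighbourhood of x by \<open>translate\<close>, which gives openness of each
  trace.\<close>

lemma openin_group_topology_nbhd:
  "openin group_topology U \<longleftrightarrow>
     U \<subseteq> carrier E \<and> (\<forall>u\<in>U. \<exists>W. openin N W \<and> \<one> \<in> W \<and> (\<forall>w\<in>W. u \<otimes> w \<in> U))"
proof safe
  fix u assume U: "openin group_topology U" and u: "u \<in> U"
  then show "\<exists>W. openin N W \<and> \<one> \<in> W \<and> (\<forall>w\<in>W. u \<otimes> w \<in> U)"
    using one_chart by (intro exI[of _ "{x \<in> topspace N. u \<otimes> x \<in> U}"])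
      (auto simp: openin_group_topology subset_iff)
next
  assume sub: "U \<subseteq> carrier E"
    and nbhd: "\<forall>u\<in>U. \<exists>W. openin N W \<and> \<one> \<in> W \<and> (\<forall>w\<in>W. u \<otimes> w \<in> U)"
  show "openin group_topology U"
    unfolding openin_group_topology
  proof (intro conjI ballI sub)
    fix e assume e: "e \<in> carrier E"
    show "openin N {x \<in> topspace N. e \<otimes> x \<in> U}"
    proof (subst openin_subopen, safe)
      fix x assume x: "x \<in> topspace N" "e \<otimes> x \<in> U"
      with chart_carrier have xE: "x \<in> carrier E" by blast
      from bspec[OF nbhd x(2)]
      obtain W where W: "openin N W" "\<one> \<in> W" "\<And>w. w \<in> W \<Longrightarrow> e \<otimes> x \<otimes> w \<in> U"
        by auto
      let ?T = "{y \<in> topspace N. inv x \<otimes> y \<in> W}"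
      have "e \<otimes> y \<in> U" if "y \<in> ?T" for y
      proof -
        have "y \<in> carrier E" using that chart_carrier by blast
        then have "e \<otimes> x \<otimes> (inv x \<otimes> y) = e \<otimes> y"
          using e xE by (metis inv_closed inv_solve_left m_assoc m_closed)
        then show ?thesis
          using W(3)[of "inv x \<otimes> y"] that by simp
      qed
      moreover have "x \<in> ?T"
        using x xE W(2) by simp
      moreover have "openin N ?T"
        using translate W(1) xE by simp
      ultimately show "\<exists>T. openin N T \<and> x \<in> T \<and> T \<subseteq> {x \<in> topspace N. e \<otimes> x \<in> U}"
        by blast
    qed
  qed
qed (auto simp: openin_group_topology)

lemma openin_chart: "openin N U \<Longrightarrow> openin group_topology U"
  using translate openin_subset chart_carrier by (fastforce simp: openin_group_topology)

text \<open>The chart keeps its original topology: \<open>translate\<close> keeps its open sets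
  open, and the trace condition for e = 1 gives the converse. Later proofs of local continuity can
  therefore be done in the product topology.\<close>

lemma subtopology_group_topology: "subtopology group_topology (topspace N) = N"
proof -
  have "openin N (U \<inter> topspace N)" if "openin group_topology U" for U
  proof -
    have "openin N {x \<in> topspace N. \<one> \<otimes> x \<in> U}"
      using that by (simp add: openin_group_topology)
    moreover have "{x \<in> topspace N. \<one> \<otimes> x \<in> U} = U \<inter> topspace N"
      using chart_carrier by auto
    ultimately show ?thesis by simp
  qed
  moreover have "\<exists>T. openin group_topology T \<and> U = T \<inter> topspace N" if "openin N U" for U
    using openin_chart[OF that] openin_subset[OF that] by (intro exI[of _ U]) auto
  ultimately show ?thesis
    unfolding topology_eq openin_subtopology by blast
qed

text \<open>With a = x v' and b = y v one has a b = x y (y^-1 v' y) v. Moving v' past y costs a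
  conjugation by the arbitrary element y^-1, which is where \<open>conj_nbhd\<close> enters.\<close>

lemma continuous_map_mult_group_topology:
  "continuous_map (prod_topology group_topology group_topology) group_topology (\<lambda>(x, y). x \<otimes> y)"
  unfolding continuous_map_def topspace_prod_topology topspace_group_topology
proof (intro conjI allI impI)
  fix U assume U: "openin group_topology U"
  show "openin (prod_topology group_topology group_topology)
      {p \<in> carrier E \<times> carrier E. (case p of (x, y) \<Rightarrow> x \<otimes> y) \<in> U}"
    unfolding openin_prod_topology_alt
  proof (intro allI impI)
    fix x y assume "(x, y) \<in> {p \<in> carrier E \<times> carrier E. (case p of (x, y) \<Rightarrow> x \<otimes> y) \<in> U}"
    then have xy: "x \<in> carrier E" "y \<in> carrier E" "x \<otimes> y \<in> U" by auto
    with U obtain W where W: "openin N W" "\<one> \<in> W" "\<And>w. w \<in> W \<Longrightarrow> x \<otimes> y \<otimes> w \<in> U"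
      by (auto simp: openin_group_topology_nbhd)
    from mult_nbhd[OF W(1,2)] obtain V where
      V: "openin N V" "\<one> \<in> V" "\<And>a b. a \<in> V \<Longrightarrow> b \<in> V \<Longrightarrow> a \<otimes> b \<in> W" by blast
    from conj_nbhd[of "inv y", OF _ V(1,2)] xy obtain V' where
      V': "openin N V'" "\<one> \<in> V'" "\<And>a. a \<in> V' \<Longrightarrow> inv y \<otimes> a \<otimes> y \<in> V" by auto
    let ?A = "{a \<in> carrier E. inv x \<otimes> a \<in> V'}" and ?B = "{b \<in> carrier E. inv y \<otimes> b \<in> V}"
    have translate_open: "openin group_topology {a \<in> carrier E. inv z \<otimes> a \<in> T}"
      if "openin N T" "z \<in> carrier E" for z T
    proof -
      have "openin N {u \<in> topspace N. e \<otimes> u \<in> {a \<in> carrier E. inv z \<otimes> a \<in> T}}"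
        if e: "e \<in> carrier E" for e
      proof -
        have "{u \<in> topspace N. e \<otimes> u \<in> {a \<in> carrier E. inv z \<otimes> a \<in> T}} =
            {u \<in> topspace N. (inv z \<otimes> e) \<otimes> u \<in> T}"
          using e \<open>z \<in> carrier E\<close> chart_carrier by (auto simp: m_assoc subset_iff)
        with translate[OF _ \<open>openin N T\<close>, of "inv z \<otimes> e"] e \<open>z \<in> carrier E\<close> show ?thesis
          by simp
      qed
      then show ?thesis
        by (auto simp: openin_group_topology)
    qed
    have "a \<otimes> b \<in> U" if a: "a \<in> ?A" and b: "b \<in> ?B" for a b
    proof -
      have "x \<otimes> y \<otimes> ((inv y \<otimes> (inv x \<otimes> a) \<otimes> y) \<otimes> (inv y \<otimes> b)) \<in> U"
        using a b V'(3) by (intro W(3) V(3)) auto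
      moreover have "x \<otimes> y \<otimes> ((inv y \<otimes> (inv x \<otimes> a) \<otimes> y) \<otimes> (inv y \<otimes> b)) = a \<otimes> b"
        using a b xy by (simp add: m_assoc mult_inv_cancel)
      ultimately show ?thesis by simp
    qed
    moreover have "x \<in> ?A" "y \<in> ?B"
      using xy V(2) V'(2) by simp_all
    moreover have "openin group_topology ?A" "openin group_topology ?B"
      using translate_open V(1) V'(1) xy by simp_all
    ultimately show "\<exists>A B. openin group_topology A \<and> openin group_topology B \<and> x \<in> A \<and> y \<in> B \<and>
        A \<times> B \<subseteq> {p \<in> carrier E \<times> carrier E. (case p of (x, y) \<Rightarrow> x \<otimes> y) \<in> U}"
      by (intro exI[of _ ?A] exI[of _ ?B]) auto
  qed
qed auto

text \<open>The identity (x w)^-1 = x^-1 (x w^-1 x^-1) reduces the claim to inversion at the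
  identity followed by conjugation by x.\<close>

lemma continuous_map_inv_group_topology:
  "continuous_map group_topology group_topology (\<lambda>x. inv x)"
  unfolding continuous_map_def topspace_group_topology
proof (intro conjI allI impI)
  fix U assume U: "openin group_topology U"
  show "openin group_topology {x \<in> carrier E. inv x \<in> U}"
    unfolding openin_group_topology_nbhd
  proof (intro conjI ballI)
    fix x assume "x \<in> {x \<in> carrier E. inv x \<in> U}"
    then have x: "x \<in> carrier E" "inv x \<in> U" by auto
    with U obtain W where W: "openin N W" "\<one> \<in> W" "\<And>w. w \<in> W \<Longrightarrow> inv x \<otimes> w \<in> U"
      by (auto simp: openin_group_topology_nbhd)
    from conj_nbhd[OF x(1) W(1,2)] obtain V where
      V: "openin N V" "\<one> \<in> V" "\<And>a. a \<in> V \<Longrightarrow> x \<otimes> a \<otimes> inv x \<in> W" by blast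
    from inv_nbhd[OF V(1,2)] obtain V' where
      V': "openin N V'" "\<one> \<in> V'" "\<And>a. a \<in> V' \<Longrightarrow> inv a \<in> V" by blast
    have "x \<otimes> w \<in> {x \<in> carrier E. inv x \<in> U}" if "w \<in> V'" for w
    proof -
      have w: "w \<in> carrier E"
        using that openin_subset[OF V'(1)] chart_carrier by blast
      have "inv x \<otimes> (x \<otimes> inv w \<otimes> inv x) \<in> U"
        using that V'(3) V(3) by (intro W(3)) auto
      moreover have "inv x \<otimes> (x \<otimes> inv w \<otimes> inv x) = inv (x \<otimes> w)"
        using x w by (simp add: inv_mult_group flip: m_assoc)
      ultimately show ?thesis
        using x w by simp
    qed
    with V' show "\<exists>W. openin N W \<and> \<one> \<in> W \<and> (\<forall>w\<in>W. x \<otimes> w \<in> {x \<in> carrier E. inv x \<in> U})"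
      by blast
  qed auto
qed auto

theorem topological_group_chart:
  "topological_group \<lparr>carrier = carrier E, mult = mult E, one = one E, topo = group_topology\<rparr>"
proof -
  let ?E = "\<lparr>carrier = carrier E, mult = mult E, one = one E, topo = group_topology\<rparr>"
  have "group ?E"
    by (rule groupI) (auto simp: m_assoc intro: l_inv_ex)
  moreover have "inv\<^bsub>?E\<^esub> x = inv x" for x
    by (simp add: m_inv_def)
  ultimately show ?thesis
    using continuous_map_mult_group_topology continuous_map_inv_group_topology
    by (simp add: topological_group_def topspace_group_topology)
qed

end

section \<open>Cochains of degree one and two\<close>

definition point1 :: "'g \<Rightarrow> nat \<Rightarrow> 'g" where
  "point1 s = (\<lambda>k\<in>{1..1}. s)"

definition point2 :: "'g \<Rightarrow> 'g \<Rightarrow> nat \<Rightarrow> 'g" where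
  "point2 s t = (\<lambda>k\<in>{1..2}. if k = 1 then s else t)"

definition point3 :: "'g \<Rightarrow> 'g \<Rightarrow> 'g \<Rightarrow> nat \<Rightarrow> 'g" where
  "point3 s t u = (\<lambda>k\<in>{1..3}. if k = 1 then s else if k = 2 then t else u)"

lemma point_apply [simp]:
  "point1 s 1 = s" "point1 s (Suc 0) = s" "point2 s t 1 = s" "point2 s t (Suc 0) = s" "point2 s t 2 = t"
  "point3 s t u 1 = s" "point3 s t u (Suc 0) = s" "point3 s t u 2 = t" "point3 s t u 3 = u"
  by (simp_all add: point1_def point2_def point3_def)

lemma (in topgroup) point_in_power_top:
  "s \<in> carrier G \<Longrightarrow> point1 s \<in> topspace (power_top G 1)"
  "s \<in> carrier G \<Longrightarrow> t \<in> carrier G \<Longrightarrow> point2 s t \<in> topspace (power_top G 2)"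
  "s \<in> carrier G \<Longrightarrow> t \<in> carrier G \<Longrightarrow> u \<in> carrier G \<Longrightarrow> point3 s t u \<in> topspace (power_top G 3)"
  by (simp_all add: point1_def point2_def point3_def)

lemma (in topgroup) power_top_point1:
  assumes "x \<in> topspace (power_top G 1)"
  shows "x 1 \<in> carrier G" and "point1 (x 1) = x"
  using assms by (auto simp: PiE_iff point1_def extensional_def fun_eq_iff)

lemma (in topgroup) power_top_point2:
  assumes "x \<in> topspace (power_top G 2)"
  shows "x 1 \<in> carrier G" and "x 2 \<in> carrier G" and "point2 (x 1) (x 2) = x"
proof -
  have x: "x \<in> {1..2} \<rightarrow>\<^sub>E carrier G" using assms by simp
  then show "x 1 \<in> carrier G" "x 2 \<in> carrier G" by (auto simp: PiE_iff)
  have "{1..2::nat} = {1, 2}" by auto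
  with x show "point2 (x 1) (x 2) = x"
    by (auto simp: point2_def PiE_iff extensional_def fun_eq_iff)
qed

lemma (in topgroup) power_top_point3:
  assumes "x \<in> topspace (power_top G 3)"
  shows "x 1 \<in> carrier G" and "x 2 \<in> carrier G" and "x 3 \<in> carrier G"
    and "point3 (x 1) (x 2) (x 3) = x"
proof -
  have x: "x \<in> {1..3} \<rightarrow>\<^sub>E carrier G" using assms by simp
  then show "x 1 \<in> carrier G" "x 2 \<in> carrier G" "x 3 \<in> carrier G" by (auto simp: PiE_iff)
  have "{1..3::nat} = {1, 2, 3}" by auto
  with x show "point3 (x 1) (x 2) (x 3) = x"
    by (auto simp: point3_def PiE_iff extensional_def fun_eq_iff)
qed

lemma (in topgroup) continuous_map_point1: "continuous_map (topo G) (power_top G 1) point1"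
  unfolding continuous_map_componentwise by (auto simp: point1_def)

lemma (in topgroup) continuous_map_point2:
  "continuous_map (prod_topology (topo G) (topo G)) (power_top G 2) (\<lambda>(s, t). point2 s t)"
proof -
  have "continuous_map (prod_topology (topo G) (topo G)) (topo G) (\<lambda>p. (case p of (s, t) \<Rightarrow> point2 s t) k)"
    if "k \<in> {1..2}" for k
  proof -
    have "(\<lambda>p. (case p of (s, t) \<Rightarrow> point2 s t) k) = (if k = 1 then fst else snd :: _ \<Rightarrow> 'a)"
      using that by (auto simp: point2_def fun_eq_iff)
    then show ?thesis
      by (simp add: continuous_map_fst continuous_map_snd)
  qed
  moreover have "(\<lambda>(s, t). point2 s t) ` topspace (prod_topology (topo G) (topo G)) \<subseteq> extensional {1..2}"
    by (auto simp: point2_def)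
  ultimately show ?thesis
    unfolding continuous_map_componentwise by blast
qed

text \<open>Both conditions on a cochain are invariant under a homeomorphism of its domain. With Z =
  G and Z = G x G, cochains on spaces of tuples become functions of one and of two group
  variables.\<close>

lemma cochains_iff_homeomorphic:
  assumes p: "continuous_map Z (power_top G n) p" and q: "continuous_map (power_top G n) Z q"
    and qp: "\<And>z. z \<in> topspace Z \<Longrightarrow> q (p z) = z"
    and pq: "\<And>x. x \<in> topspace (power_top G n) \<Longrightarrow> p (q x) = x"
    and f: "f \<in> extensional (topspace (power_top G n))"
    and e: "e \<in> topspace Z" "p e = (\<lambda>i\<in>{1..n}. \<one>\<^bsub>G\<^esub>)"
  shows "f \<in> carrier (lcm_cochains G A n) \<longleftrightarrow>
    (\<lambda>z. f (p z)) \<in> measurable (borel_of Z) (borel_of (topo A)) \<and>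
    (\<exists>U. openin Z U \<and> e \<in> U \<and> continuous_map (subtopology Z U) (topo A) (\<lambda>z. f (p z)))"
    (is "?L \<longleftrightarrow> ?M \<and> ?C")
proof
  assume L: ?L
  then obtain U where U: "openin (power_top G n) U" "p e \<in> U"
      "continuous_map (subtopology (power_top G n) U) (topo A) f"
    by (auto simp: lcm_cochains_def e(2))
  from L have "f \<in> measurable (borel_of (power_top G n)) (borel_of (topo A))"
    by (simp add: lcm_cochains_def)
  then have ?M
    by (rule measurable_compose[OF continuous_imp_borel_measurable[OF p]])
  moreover have ?C
  proof (intro exI conjI)
    let ?U = "{z \<in> topspace Z. p z \<in> U}"
    show "openin Z ?U"
      using p U(1) by (rule openin_continuous_map_preimage)
    show "e \<in> ?U"
      using e(1) U(2) by simp
    have "continuous_map (subtopology Z ?U) (subtopology (power_top G n) U) p"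
      using p by (intro continuous_map_into_subtopology continuous_map_from_subtopology) auto
    then show "continuous_map (subtopology Z ?U) (topo A) (\<lambda>z. f (p z))"
      using U(3) by (rule continuous_map_compose')
  qed
  ultimately show "?M \<and> ?C" ..
next
  assume R: "?M \<and> ?C"
  then obtain U where U: "openin Z U" "e \<in> U"
      "continuous_map (subtopology Z U) (topo A) (\<lambda>z. f (p z))"
    by blast
  have "(\<lambda>x. f (p (q x))) \<in> measurable (borel_of (power_top G n)) (borel_of (topo A))"
    using measurable_compose[OF continuous_imp_borel_measurable[OF q] conjunct1[OF R]] .
  then have "f \<in> measurable (borel_of (power_top G n)) (borel_of (topo A))"
    by (rule measurable_cong[THEN iffD1, rotated]) (simp add: pq)
  moreover have "\<exists>U. openin (power_top G n) U \<and> (\<lambda>i\<in>{1..n}. \<one>\<^bsub>G\<^esub>) \<in> U \<and>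
      continuous_map (subtopology (power_top G n) U) (topo A) f"
  proof (intro exI conjI)
    let ?U = "{x \<in> topspace (power_top G n). q x \<in> U}"
    show "openin (power_top G n) ?U"
      using q U(1) by (rule openin_continuous_map_preimage)
    have "p e \<in> topspace (power_top G n)"
      using p e(1) by (auto simp: continuous_map_def)
    then show "(\<lambda>i\<in>{1..n}. \<one>\<^bsub>G\<^esub>) \<in> ?U"
      using U(2) qp[OF e(1)] unfolding e(2)[symmetric] by simp
    have "continuous_map (subtopology (power_top G n) ?U) (subtopology Z U) q"
      using q by (intro continuous_map_into_subtopology continuous_map_from_subtopology) auto
    from continuous_map_compose'[OF this U(3)]
    show "continuous_map (subtopology (power_top G n) ?U) (topo A) f"
      by (rule continuous_map_eq) (simp add: pq)
  qed
  ultimately show ?L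
    using f by (simp add: lcm_cochains_def)
qed

locale lcm_module = G: topgroup G + A: topgroup A + A: comm_group A
  for G :: "'g topgroup" (structure) and A :: "'a topgroup" +
  fixes act :: "'g \<Rightarrow> 'a \<Rightarrow> 'a"
  assumes lcsc_G: "lcsc_group G" and lcsc_A: "lcsc_group A"
    and action: "continuous_action G A act"
begin

lemma second_countable_G: "second_countable (topo G)"
  and second_countable_A: "second_countable (topo A)"
  using lcsc_G lcsc_A by (simp_all add: lcsc_group_def)

lemma act_auto: "g \<in> carrier G \<Longrightarrow> act g \<in> auto A"
  using action by (auto simp: continuous_action_def AutoGroup_def hom_def)

lemma act_closed [simp]: "g \<in> carrier G \<Longrightarrow> a \<in> carrier A \<Longrightarrow> act g a \<in> carrier A"
  using act_auto[of g] by (auto simp: auto_def hom_def)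

lemma act_mult: "g \<in> carrier G \<Longrightarrow> a \<in> carrier A \<Longrightarrow> b \<in> carrier A \<Longrightarrow>
    act g (a \<otimes>\<^bsub>A\<^esub> b) = act g a \<otimes>\<^bsub>A\<^esub> act g b"
  using act_auto[of g] by (auto simp: auto_def hom_def)

lemma act_act:
  assumes "g \<in> carrier G" "h \<in> carrier G" "a \<in> carrier A"
  shows "act (g \<otimes> h) a = act g (act h a)"
proof -
  have "act (g \<otimes> h) = act g \<otimes>\<^bsub>AutoGroup A\<^esub> act h"
    using action assms by (simp add: continuous_action_def hom_def)
  then show ?thesis
    using act_auto[OF assms(1)] act_auto[OF assms(2)] assms(3)
    by (simp add: AutoGroup_def BijGroup_def auto_def compose_eq)
qed

lemma act_one [simp]: "g \<in> carrier G \<Longrightarrow> act g \<one>\<^bsub>A\<^esub> = \<one>\<^bsub>A\<^esub>"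
  using act_mult[of g "\<one>\<^bsub>A\<^esub>" "\<one>\<^bsub>A\<^esub>"] by simp

lemma act_inv: "g \<in> carrier G \<Longrightarrow> a \<in> carrier A \<Longrightarrow> act g (inv\<^bsub>A\<^esub> a) = inv\<^bsub>A\<^esub> (act g a)"
  using act_mult[of g "inv\<^bsub>A\<^esub> a" a] by (intro A.inv_equality[symmetric]) simp_all

text \<open>\<open>act \<one>\<close> is idempotent and injective, hence the identity on the
  carrier.\<close>

lemma act_by_one [simp]:
  assumes "a \<in> carrier A" shows "act \<one> a = a"
proof -
  have "act \<one> (act \<one> a) = act \<one> a"
    using assms by (simp flip: act_act)
  moreover have "inj_on (act \<one>) (carrier A)"
    using act_auto[of "\<one>"] by (auto simp: auto_def Bij_def bij_betw_def)
  ultimately show ?thesis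
    using assms by (auto dest: inj_onD)
qed

lemma continuous_map_act:
  assumes "continuous_map X (topo G) f" and "continuous_map X (topo A) a"
  shows "continuous_map X (topo A) (\<lambda>x. act (f x) (a x))"
proof -
  have "continuous_map (prod_topology (topo G) (topo A)) (topo A) (\<lambda>(g, a). act g a)"
    using action by (simp add: continuous_action_def)
  from continuous_map_compose'[OF continuous_map_pairedI[OF assms] this] show ?thesis by simp
qed

lemma measurable_act:
  assumes "f \<in> measurable M (borel_of (topo G))" and "a \<in> measurable M (borel_of (topo A))"
  shows "(\<lambda>x. act (f x) (a x)) \<in> measurable M (borel_of (topo A))"
proof -
  have "continuous_map (prod_topology (topo G) (topo A)) (topo A) (\<lambda>(g, a). act g a)"
    using action by (simp add: continuous_action_def)
  from measurable_continuous_compose2[OF this assms second_countable_G second_countable_A]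
  show ?thesis .
qed

lemmas measurable_mult_A = A.measurable_mult[OF second_countable_A]
lemmas measurable_mult_G = G.measurable_mult[OF second_countable_G]

definition cochain1 :: "('g \<Rightarrow> 'a) \<Rightarrow> bool" where
  "cochain1 h \<longleftrightarrow> h \<in> measurable (borel_of (topo G)) (borel_of (topo A)) \<and>
     (\<exists>V. openin (topo G) V \<and> \<one> \<in> V \<and> continuous_map (subtopology (topo G) V) (topo A) h)"

abbreviation GG :: "('g \<times> 'g) topology" where
  "GG \<equiv> prod_topology (topo G) (topo G)"

text \<open>The neighbourhood of the identity is taken as a square V x V, which always fits into an
  open neighbourhood; a single set V in the group is what the construction of a chart starts
  from.\<close>

definition cochain2 :: "('g \<Rightarrow> 'g \<Rightarrow> 'a) \<Rightarrow> bool" where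
  "cochain2 f \<longleftrightarrow>
     (\<lambda>(s, t). f s t) \<in> measurable (borel_of (GG)) (borel_of (topo A)) \<and>
     (\<exists>V. openin (topo G) V \<and> \<one> \<in> V \<and>
        continuous_map (subtopology (GG) (V \<times> V)) (topo A) (\<lambda>(s, t). f s t))"

lemma cochain1_closed: "cochain1 h \<Longrightarrow> s \<in> carrier G \<Longrightarrow> h s \<in> carrier A"
  using measurable_space[of h "borel_of (topo G)" "borel_of (topo A)"] by (auto simp: cochain1_def)

lemma cochain2_closed: "cochain2 f \<Longrightarrow> s \<in> carrier G \<Longrightarrow> t \<in> carrier G \<Longrightarrow> f s t \<in> carrier A"
  using measurable_space[of "\<lambda>(s, t). f s t" "borel_of (GG)"
      "borel_of (topo A)" "(s, t)"]
  by (auto simp: cochain2_def)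

lemma cochain1_mult:
  assumes "cochain1 h" "cochain1 k"
  shows "cochain1 (\<lambda>s. h s \<otimes>\<^bsub>A\<^esub> k s)"
proof -
  obtain V W where V: "openin (topo G) V" "\<one> \<in> V" "continuous_map (subtopology (topo G) V) (topo A) h"
    and W: "openin (topo G) W" "\<one> \<in> W" "continuous_map (subtopology (topo G) W) (topo A) k"
    using assms by (auto simp: cochain1_def)
  have "continuous_map (subtopology (topo G) (V \<inter> W)) (topo A) (\<lambda>s. h s \<otimes>\<^bsub>A\<^esub> k s)"
    using V(3) W(3) by (intro A.continuous_map_mult) (auto elim: continuous_map_from_subtopology_mono)
  with V W assms show ?thesis
    unfolding cochain1_def by (blast intro: measurable_mult_A)
qed

lemma cochain1_inv: "cochain1 h \<Longrightarrow> cochain1 (\<lambda>s. inv\<^bsub>A\<^esub> (h s))"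
  unfolding cochain1_def by (blast intro: A.measurable_inv A.continuous_map_inv)

lemma cochain1_const: "c \<in> carrier A \<Longrightarrow> cochain1 (\<lambda>s. c)"
  unfolding cochain1_def
  by (intro conjI exI[of _ "carrier G"] A.measurable_const_carrier A.continuous_map_const_carrier)
    (use openin_topspace[of "topo G"] in auto)

lemma cochain2_cong:
  assumes "\<And>s t. s \<in> carrier G \<Longrightarrow> t \<in> carrier G \<Longrightarrow> f s t = g s t" and "cochain2 g"
  shows "cochain2 f"
proof -
  obtain V where V: "openin (topo G) V" "\<one> \<in> V" "continuous_map
      (subtopology (GG) (V \<times> V)) (topo A) (\<lambda>(s, t). g s t)"
    and g: "(\<lambda>(s, t). g s t) \<in> measurable (borel_of (GG)) (borel_of (topo A))"
    using assms(2) by (auto simp: cochain2_def)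
  have "continuous_map (subtopology (GG) (V \<times> V)) (topo A) (\<lambda>(s, t). f s t)"
    using V(3) by (rule continuous_map_eq) (auto simp: assms(1))
  moreover have "(\<lambda>(s, t). f s t) \<in> measurable (borel_of (GG)) (borel_of (topo A))"
    using g by (rule measurable_cong[THEN iffD1, rotated]) (auto simp: assms(1))
  ultimately show ?thesis
    using V(1,2) by (auto simp: cochain2_def)
qed

lemma in_cochains1_iff:
  assumes "h \<in> extensional (topspace (power_top G 1))"
  shows "h \<in> carrier (lcm_cochains G A 1) \<longleftrightarrow> cochain1 (\<lambda>s. h (point1 s))"
  unfolding cochain1_def
proof (rule cochains_iff_homeomorphic[where q = "\<lambda>x. x 1"])
  show "continuous_map (power_top G 1) (topo G) (\<lambda>x. x 1)"
    by (rule continuous_map_product_coordinates) simp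
  show "continuous_map (topo G) (power_top G 1) point1"
    by (rule G.continuous_map_point1)
qed (use assms G.power_top_point1(2) in \<open>simp_all add: point1_def\<close>)

lemma in_cochains2_iff:
  assumes "f \<in> extensional (topspace (power_top G 2))"
  shows "f \<in> carrier (lcm_cochains G A 2) \<longleftrightarrow> cochain2 (\<lambda>s t. f (point2 s t))"
proof -
  let ?Z = "GG"
  have eq: "(\<lambda>z. f ((\<lambda>(s, t). point2 s t) z)) = (\<lambda>(s, t). f (point2 s t))"
    by auto
  have "f \<in> carrier (lcm_cochains G A 2) \<longleftrightarrow>
    (\<lambda>(s, t). f (point2 s t)) \<in> measurable (borel_of ?Z) (borel_of (topo A)) \<and>
    (\<exists>U. openin ?Z U \<and> (\<one>, \<one>) \<in> U \<and> continuous_map (subtopology ?Z U) (topo A) (\<lambda>(s, t). f (point2 s t)))"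
  proof (rule cochains_iff_homeomorphic[where f = f and p = "\<lambda>(s, t). point2 s t", unfolded eq])
    show "continuous_map (power_top G 2) ?Z (\<lambda>x. (x 1, x 2))"
      by (intro continuous_map_pairedI continuous_map_product_coordinates) auto
    show "(case (\<one>, \<one>) of (s, t) \<Rightarrow> point2 s t) = (\<lambda>i\<in>{1..2}. \<one>)"
      by (auto simp: point2_def)
  qed (use assms G.continuous_map_point2 G.power_top_point2 in auto)
  also have "(\<exists>U. openin ?Z U \<and> (\<one>, \<one>) \<in> U \<and>
      continuous_map (subtopology ?Z U) (topo A) (\<lambda>(s, t). f (point2 s t))) \<longleftrightarrow>
    (\<exists>V. openin (topo G) V \<and> \<one> \<in> V \<and>
      continuous_map (subtopology ?Z (V \<times> V)) (topo A) (\<lambda>(s, t). f (point2 s t)))" (is "?L \<longleftrightarrow> ?R")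
  proof
    assume ?L
    then obtain U where U: "openin ?Z U" "(\<one>, \<one>) \<in> U"
        "continuous_map (subtopology ?Z U) (topo A) (\<lambda>(s, t). f (point2 s t))" by blast
    then obtain V W where VW: "openin (topo G) V" "openin (topo G) W" "\<one> \<in> V" "\<one> \<in> W" "V \<times> W \<subseteq> U"
      unfolding openin_prod_topology_alt by metis
    show ?R
    proof (intro exI[of _ "V \<inter> W"] conjI)
      show "continuous_map (subtopology ?Z ((V \<inter> W) \<times> (V \<inter> W))) (topo A) (\<lambda>(s, t). f (point2 s t))"
        using U(3) by (rule continuous_map_from_subtopology_mono) (use VW(5) in auto)
    qed (use VW in auto)
  next
    assume ?R
    then obtain V where "openin (topo G) V" "\<one> \<in> V"
        "continuous_map (subtopology ?Z (V \<times> V)) (topo A) (\<lambda>(s, t). f (point2 s t))" by blast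
    then show ?L
      by (intro exI[of _ "V \<times> V"]) (auto simp: openin_prod_Times_iff)
  qed
  finally show ?thesis
    by (simp add: cochain2_def)
qed

section \<open>Low-degree cocycles and coboundaries, and equality of cohomology classes\<close>

definition coboundary1 :: "('g \<Rightarrow> 'a) \<Rightarrow> 'g \<Rightarrow> 'g \<Rightarrow> 'a" where
  "coboundary1 h s t = act s (h t) \<otimes>\<^bsub>A\<^esub> inv\<^bsub>A\<^esub> (h (s \<otimes> t)) \<otimes>\<^bsub>A\<^esub> h s"

text \<open>The two negative terms of the coboundary are moved to the right-hand side. In this form
  the identity is exactly what associativity of the twisted product requires.\<close>

definition cocycle2 :: "('g \<Rightarrow> 'g \<Rightarrow> 'a) \<Rightarrow> bool" where
  "cocycle2 f \<longleftrightarrow> cochain2 f \<and>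
     (\<forall>s\<in>carrier G. \<forall>t\<in>carrier G. \<forall>u\<in>carrier G.
        act s (f t u) \<otimes>\<^bsub>A\<^esub> f s (t \<otimes> u) = f s t \<otimes>\<^bsub>A\<^esub> f (s \<otimes> t) u)"

lemma cocycle2_cong:
  assumes "\<And>s t. s \<in> carrier G \<Longrightarrow> t \<in> carrier G \<Longrightarrow> f s t = g s t" and "cocycle2 g"
  shows "cocycle2 f"
  using assms cochain2_cong[of f g] by (auto simp: cocycle2_def)

lemma coboundary1_closed:
  "cochain1 h \<Longrightarrow> s \<in> carrier G \<Longrightarrow> t \<in> carrier G \<Longrightarrow> coboundary1 h s t \<in> carrier A"
  by (simp add: coboundary1_def cochain1_closed)

lemma coboundary1_mult:
  assumes "cochain1 h" "cochain1 k" "s \<in> carrier G" "t \<in> carrier G"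
  shows "coboundary1 (\<lambda>s. h s \<otimes>\<^bsub>A\<^esub> k s) s t = coboundary1 h s t \<otimes>\<^bsub>A\<^esub> coboundary1 k s t"
  using assms by (simp add: coboundary1_def cochain1_closed act_mult A.inv_mult A.m_ac)

lemma coboundary1_inv:
  assumes "cochain1 h" "s \<in> carrier G" "t \<in> carrier G"
  shows "coboundary1 (\<lambda>s. inv\<^bsub>A\<^esub> (h s)) s t = inv\<^bsub>A\<^esub> (coboundary1 h s t)"
  using assms by (simp add: coboundary1_def cochain1_closed act_inv A.inv_mult A.m_ac)

lemma coboundary1_one:
  assumes "s \<in> carrier G" "t \<in> carrier G"
  shows "coboundary1 (\<lambda>s. \<one>\<^bsub>A\<^esub>) s t = \<one>\<^bsub>A\<^esub>"
  using assms by (simp add: coboundary1_def)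

lemma lcm_coboundary_1:
  assumes h: "cochain1 (\<lambda>s. h (point1 s))"
  shows "lcm_coboundary G A act 1 h = (\<lambda>x\<in>topspace (power_top G 2). coboundary1 (\<lambda>s. h (point1 s)) (x 1) (x 2))"
proof -
  have "act (x 1) (h (\<lambda>k\<in>{1..1}. x (k + 1))) \<otimes>\<^bsub>A\<^esub>
        (\<Otimes>\<^bsub>A\<^esub>i\<in>{1..1}. h (merge_at G 1 i x) [^]\<^bsub>A\<^esub> ((-1) ^ i :: int)) \<otimes>\<^bsub>A\<^esub>
        h (restrict x {1..1}) [^]\<^bsub>A\<^esub> ((-1) ^ (1 + 1) :: int)
      = coboundary1 (\<lambda>s. h (point1 s)) (x 1) (x 2)" if x: "x \<in> topspace (power_top G 2)" for x
  proof -
    note xG = G.power_top_point2[OF x]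
    have "(\<lambda>k\<in>{1..1}. x (k + 1)) = point1 (x 2)" "restrict x {1..1} = point1 (x 1)"
      "merge_at G 1 1 x = point1 (x 1 \<otimes> x 2)"
      by (auto simp: point1_def merge_at_def fun_eq_iff numeral_2_eq_2)
    moreover have "h (point1 s) \<in> carrier A" if "s \<in> carrier G" for s
      using cochain1_closed[OF h that] .
    ultimately show ?thesis
      using xG by (simp add: coboundary1_def A.int_pow_neg)
  qed
  then show ?thesis
    unfolding lcm_coboundary_def one_add_one by (intro restrict_ext) simp
qed

text \<open>At a triple (s, t, u) the finite product has the two merge terms (st, u) and (s, tu)
  with exponents -1 and 1, and the last term has exponent -1; clearing the inverses gives the
  identity in \<open>cocycle2\<close>.\<close>

lemma in_cocycles2_iff:
  assumes f: "f \<in> extensional (topspace (power_top G 2))"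
  shows "f \<in> carrier (lcm_cocycles G A act 2) \<longleftrightarrow> cocycle2 (\<lambda>s t. f (point2 s t))"
proof -
  have *: "lcm_coboundary G A act 2 f = \<one>\<^bsub>lcm_cochains G A (2 + 1)\<^esub> \<longleftrightarrow>
    (\<forall>s\<in>carrier G. \<forall>t\<in>carrier G. \<forall>u\<in>carrier G.
        act s (f (point2 t u)) \<otimes>\<^bsub>A\<^esub> f (point2 s (t \<otimes> u))
          = f (point2 s t) \<otimes>\<^bsub>A\<^esub> f (point2 (s \<otimes> t) u))" if f2: "cochain2 (\<lambda>s t. f (point2 s t))"
  proof -
    let ?d = "\<lambda>s t u. act s (f (point2 t u)) \<otimes>\<^bsub>A\<^esub>
       (inv\<^bsub>A\<^esub> (f (point2 (s \<otimes> t) u)) \<otimes>\<^bsub>A\<^esub> f (point2 s (t \<otimes> u))) \<otimes>\<^bsub>A\<^esub> inv\<^bsub>A\<^esub> (f (point2 s t))"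
    have f_closed: "f (point2 s t) \<in> carrier A" if "s \<in> carrier G" "t \<in> carrier G" for s t
      using cochain2_closed[OF f2 that] .
    have d: "lcm_coboundary G A act 2 f (point3 s t u) = ?d s t u"
      if G: "s \<in> carrier G" "t \<in> carrier G" "u \<in> carrier G" for s t u
    proof -
      let ?x = "point3 s t u"
      have x: "?x \<in> topspace (power_top G (2 + 1))"
        using G.point_in_power_top(3)[OF G] by simp
      have eqs: "(\<lambda>k\<in>{1..2}. ?x (k + 1)) = point2 t u" "restrict ?x {1..2} = point2 s t"
        "merge_at G 2 1 ?x = point2 (s \<otimes> t) u" "merge_at G 2 (Suc 0) ?x = point2 (s \<otimes> t) u"
        "merge_at G 2 2 ?x = point2 s (t \<otimes> u)"
        by (auto simp: point2_def point3_def merge_at_def fun_eq_iff)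
      have set: "{1..2::nat} = {1, 2}" by auto
      have "(\<Otimes>\<^bsub>A\<^esub>i\<in>{1..2}. f (merge_at G 2 i ?x) [^]\<^bsub>A\<^esub> ((-1) ^ i :: int))
          = inv\<^bsub>A\<^esub> (f (point2 (s \<otimes> t) u)) \<otimes>\<^bsub>A\<^esub> f (point2 s (t \<otimes> u))"
        unfolding set using G f_closed by (simp add: A.int_pow_neg eqs)
      with x G f_closed show ?thesis
        unfolding lcm_coboundary_def by (simp add: A.int_pow_neg eqs[simplified])
    qed
    have *: "?d s t u = \<one>\<^bsub>A\<^esub> \<longleftrightarrow> act s (f (point2 t u)) \<otimes>\<^bsub>A\<^esub> f (point2 s (t \<otimes> u))
          = f (point2 s t) \<otimes>\<^bsub>A\<^esub> f (point2 (s \<otimes> t) u)"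
      if "s \<in> carrier G" "t \<in> carrier G" "u \<in> carrier G" for s t u
    proof -
      let ?P = "act s (f (point2 t u)) \<otimes>\<^bsub>A\<^esub> f (point2 s (t \<otimes> u))"
      let ?Q = "f (point2 s t) \<otimes>\<^bsub>A\<^esub> f (point2 (s \<otimes> t) u)"
      have PQ: "?P \<in> carrier A" "?Q \<in> carrier A" "?d s t u = ?P \<otimes>\<^bsub>A\<^esub> inv\<^bsub>A\<^esub> ?Q"
        using that f_closed by (simp_all add: A.inv_mult A.m_ac)
      then show ?thesis
        by (metis A.inv_closed A.inv_inv A.inv_equality A.r_inv)
    qed
    have "lcm_coboundary G A act 2 f = \<one>\<^bsub>lcm_cochains G A (2 + 1)\<^esub> \<longleftrightarrow>
        (\<forall>x\<in>topspace (power_top G 3). lcm_coboundary G A act 2 f x = \<one>\<^bsub>A\<^esub>)"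
      unfolding lcm_coboundary_def lcm_cochains_def by (auto simp: fun_eq_iff)
    also have "\<dots> \<longleftrightarrow> (\<forall>s\<in>carrier G. \<forall>t\<in>carrier G. \<forall>u\<in>carrier G. ?d s t u = \<one>\<^bsub>A\<^esub>)"
      using G.power_top_point3 G.point_in_power_top(3) d by metis
    finally show ?thesis
      using * by simp
  qed
  show ?thesis
    using in_cochains2_iff[OF f] * unfolding cocycle2_def
    by (simp add: lcm_cocycles_def kernel_def) blast
qed

lemma carrier_lcm_cohomology_2:
  "carrier (lcm_cohomology G A act 2) = lcm_class G A act 2 ` carrier (lcm_cocycles G A act 2)"
  unfolding lcm_cohomology_def carrier_FactGroup lcm_class_def ..

lemma in_lcm_class_iff:
  "k \<in> lcm_class G A act 2 f \<longleftrightarrow>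
     (\<exists>h. cochain1 h \<and> k = (\<lambda>x\<in>topspace (power_top G 2). coboundary1 h (x 1) (x 2) \<otimes>\<^bsub>A\<^esub> f x))"
proof -
  have "k \<in> lcm_class G A act 2 f \<longleftrightarrow> (\<exists>h\<in>carrier (lcm_cochains G A 1).
      k = (\<lambda>x\<in>topspace (power_top G 2). lcm_coboundary G A act 1 h x \<otimes>\<^bsub>A\<^esub> f x))"
    by (auto simp: lcm_class_def r_coset_def lcm_coboundaries_def lcm_cocycles_def lcm_cochains_def)
  also have "\<dots> \<longleftrightarrow>
     (\<exists>h. cochain1 h \<and> k = (\<lambda>x\<in>topspace (power_top G 2). coboundary1 h (x 1) (x 2) \<otimes>\<^bsub>A\<^esub> f x))"
    (is "?L \<longleftrightarrow> ?R")
  proof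
    assume ?L
    then obtain h where h: "h \<in> carrier (lcm_cochains G A 1)"
      "k = (\<lambda>x\<in>topspace (power_top G 2). lcm_coboundary G A act 1 h x \<otimes>\<^bsub>A\<^esub> f x)" by blast
    then have c: "cochain1 (\<lambda>s. h (point1 s))"
      using in_cochains1_iff[of h] by (simp add: lcm_cochains_def)
    have "k = (\<lambda>x\<in>topspace (power_top G 2). coboundary1 (\<lambda>s. h (point1 s)) (x 1) (x 2) \<otimes>\<^bsub>A\<^esub> f x)"
      unfolding h(2) lcm_coboundary_1[OF c] by (rule restrict_ext) simp
    with c show ?R by blast
  next
    assume ?R
    then obtain h where h: "cochain1 h"
      "k = (\<lambda>x\<in>topspace (power_top G 2). coboundary1 h (x 1) (x 2) \<otimes>\<^bsub>A\<^esub> f x)" by blast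
    \<comment> \<open>A function h on the group corresponds to an extensional function on one-point
      tuples, the form demanded of a cochain; values of h outside the carrier are discarded.\<close>
    define h' where "h' = (\<lambda>x\<in>topspace (power_top G 1). h (x 1))"
    have h': "h' (point1 s) = h s" if "s \<in> carrier G" for s
      using G.point_in_power_top(1)[OF that] by (simp add: h'_def)
    have c': "cochain1 (\<lambda>s. h' (point1 s))"
      using h(1) unfolding cochain1_def
      by (auto simp: h' elim!: measurable_cong[THEN iffD1, rotated] continuous_map_eq)
    then have "h' \<in> carrier (lcm_cochains G A 1)"
      using in_cochains1_iff[of h'] by (simp add: h'_def)
    moreover have "k = (\<lambda>x\<in>topspace (power_top G 2). lcm_coboundary G A act 1 h' x \<otimes>\<^bsub>A\<^esub> f x)"
      unfolding h(2) lcm_coboundary_1[OF c']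
    proof (rule restrict_ext)
      fix x assume x: "x \<in> topspace (power_top G 2)"
      with G.power_top_point2[OF x] h' show "coboundary1 h (x 1) (x 2) \<otimes>\<^bsub>A\<^esub> f x =
        (\<lambda>x\<in>topspace (power_top G 2). coboundary1 (\<lambda>s. h' (point1 s)) (x 1) (x 2)) x \<otimes>\<^bsub>A\<^esub> f x"
        by (simp add: coboundary1_def)
    qed
    ultimately show ?L by blast
  qed
  finally show ?thesis .
qed

text \<open>If f is g twisted by h, multiplying cochains by h gives one inclusion of cosets, and the
  inverse cochain gives the other. Conversely, f lies in its own class through the trivial cochain,
  and membership in the class of g provides h.\<close>

lemma lcm_class_eq_iff:
  assumes f: "f \<in> carrier (lcm_cocycles G A act 2)" and g: "g \<in> carrier (lcm_cocycles G A act 2)"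
  shows "lcm_class G A act 2 f = lcm_class G A act 2 g \<longleftrightarrow>
    (\<exists>h. cochain1 h \<and> (\<forall>s\<in>carrier G. \<forall>t\<in>carrier G.
       f (point2 s t) = coboundary1 h s t \<otimes>\<^bsub>A\<^esub> g (point2 s t)))" (is "?L \<longleftrightarrow> ?R")
proof -
  let ?T = "topspace (power_top G 2)"
  have ext: "k \<in> extensional ?T" and closed: "x \<in> ?T \<Longrightarrow> k x \<in> carrier A"
    if "k \<in> carrier (lcm_cocycles G A act 2)" for k x
    using that measurable_space[of k "borel_of (power_top G 2)" "borel_of (topo A)" x]
    by (auto simp: lcm_cocycles_def kernel_def lcm_cochains_def simp del: topspace_product_topology)
  have mono: "lcm_class G A act 2 f \<subseteq> lcm_class G A act 2 g"
    if h: "cochain1 h" and fg: "\<And>x. x \<in> ?T \<Longrightarrow> f x = coboundary1 h (x 1) (x 2) \<otimes>\<^bsub>A\<^esub> g x"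
      and g: "g \<in> carrier (lcm_cocycles G A act 2)" for f g h
  proof
    fix k assume "k \<in> lcm_class G A act 2 f"
    then obtain h' where h': "cochain1 h'" "k = (\<lambda>x\<in>?T. coboundary1 h' (x 1) (x 2) \<otimes>\<^bsub>A\<^esub> f x)"
      unfolding in_lcm_class_iff by blast
    have "k = (\<lambda>x\<in>?T. coboundary1 (\<lambda>s. h' s \<otimes>\<^bsub>A\<^esub> h s) (x 1) (x 2) \<otimes>\<^bsub>A\<^esub> g x)"
      unfolding h'(2)
    proof (rule restrict_ext)
      fix x assume x: "x \<in> ?T"
      then show "coboundary1 h' (x 1) (x 2) \<otimes>\<^bsub>A\<^esub> f x =
          coboundary1 (\<lambda>s. h' s \<otimes>\<^bsub>A\<^esub> h s) (x 1) (x 2) \<otimes>\<^bsub>A\<^esub> g x"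
        using h h'(1) G.power_top_point2[OF x] closed[OF g x]
        by (simp add: fg coboundary1_mult coboundary1_closed A.m_assoc)
    qed
    then show "k \<in> lcm_class G A act 2 g"
      unfolding in_lcm_class_iff using cochain1_mult[OF h'(1) h] by blast
  qed
  have iff: "?R \<longleftrightarrow> (\<exists>h. cochain1 h \<and> (\<forall>x\<in>?T. f x = coboundary1 h (x 1) (x 2) \<otimes>\<^bsub>A\<^esub> g x))"
  proof -
    have "(\<forall>s\<in>carrier G. \<forall>t\<in>carrier G. P (point2 s t) s t) \<longleftrightarrow> (\<forall>x\<in>?T. P x (x 1) (x 2))" for P
      using G.power_top_point2 G.point_in_power_top(2) point_apply(3,5) by metis
    from this[of "\<lambda>x s t. f x = coboundary1 _ s t \<otimes>\<^bsub>A\<^esub> g x"] show ?thesis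
      by (simp only:)
  qed
  show ?thesis
    unfolding iff
  proof
    assume L: ?L
    have "f = (\<lambda>x\<in>?T. coboundary1 (\<lambda>s. \<one>\<^bsub>A\<^esub>) (x 1) (x 2) \<otimes>\<^bsub>A\<^esub> f x)"
      using ext[OF f]
    proof (rule extensionalityI)
      fix x assume x: "x \<in> ?T"
      then show "f x = (\<lambda>x\<in>?T. coboundary1 (\<lambda>s. \<one>\<^bsub>A\<^esub>) (x 1) (x 2) \<otimes>\<^bsub>A\<^esub> f x) x"
        using G.power_top_point2[OF x] closed[OF f x] by (simp add: coboundary1_one)
    qed auto
    then have "f \<in> lcm_class G A act 2 f"
      unfolding in_lcm_class_iff using cochain1_const[OF A.one_closed] by blast
    with L obtain h where h: "cochain1 h" "f = (\<lambda>x\<in>?T. coboundary1 h (x 1) (x 2) \<otimes>\<^bsub>A\<^esub> g x)"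
      using in_lcm_class_iff[of f g] by blast
    have "f x = coboundary1 h (x 1) (x 2) \<otimes>\<^bsub>A\<^esub> g x" if "x \<in> ?T" for x
      using fun_cong[OF h(2), of x] that by (simp only: restrict_apply if_True)
    with h(1) show "\<exists>h. cochain1 h \<and> (\<forall>x\<in>?T. f x = coboundary1 h (x 1) (x 2) \<otimes>\<^bsub>A\<^esub> g x)"
      by blast
  next
    assume "\<exists>h. cochain1 h \<and> (\<forall>x\<in>?T. f x = coboundary1 h (x 1) (x 2) \<otimes>\<^bsub>A\<^esub> g x)"
    then obtain h where h: "cochain1 h" "\<And>x. x \<in> ?T \<Longrightarrow> f x = coboundary1 h (x 1) (x 2) \<otimes>\<^bsub>A\<^esub> g x"
      by blast
    have "g x = coboundary1 (\<lambda>s. inv\<^bsub>A\<^esub> (h s)) (x 1) (x 2) \<otimes>\<^bsub>A\<^esub> f x" if x: "x \<in> ?T" for x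
      using h G.power_top_point2[OF x] closed[OF g x] x
      by (simp add: coboundary1_inv coboundary1_closed A.mult_inv_cancel)
    with mono[OF h g] mono[OF cochain1_inv[OF h(1)] _ f] show ?L
      by blast
  qed
qed

end

section \<open>Locally split extensions and their sections\<close>

locale split_extension = lcm_module G A act
  for G :: "'g topgroup" (structure) and A :: "'a topgroup" and act :: "'g \<Rightarrow> 'a \<Rightarrow> 'a" +
  fixes X :: "('a, 'e, 'g) extension"
  assumes X: "X \<in> locally_split_extensions G A act"

sublocale split_extension \<subseteq> E: topgroup "total X"
  using X by (auto simp: topgroup_iff locally_split_extensions_def is_extension_def)

context split_extension
begin

abbreviation "E \<equiv> total X"
abbreviation "\<iota> \<equiv> incl X"
abbreviation "\<pi> \<equiv> proj X"

text \<open>Meaningful on the kernel of the projection, where it inverts the inclusion. Elsewhere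
  \<open>inv_into\<close> returns an unspecified value, hence the kernel hypotheses in the lemmas
  below.\<close>

definition retract :: "'e \<Rightarrow> 'a" where
  "retract = inv_into (carrier A) \<iota>"

lemma incl_hom: "\<iota> \<in> hom A E" and incl_inj: "inj_on \<iota> (carrier A)"
  and proj_hom: "\<pi> \<in> hom E G" and proj_surj: "\<pi> ` carrier E = carrier G"
  and incl_image: "\<iota> ` carrier A = kernel E G \<pi>"
  and continuous_map_incl: "continuous_map (topo A) (topo E) \<iota>"
  and closed_map_incl: "closed_map (topo A) (topo E) \<iota>"
  and continuous_map_proj: "continuous_map (topo E) (topo G) \<pi>"
  and conjugation: "e \<in> carrier E \<Longrightarrow> a \<in> carrier A \<Longrightarrow>
    e \<otimes>\<^bsub>E\<^esub> \<iota> a \<otimes>\<^bsub>E\<^esub> inv\<^bsub>E\<^esub> e = \<iota> (act (\<pi> e) a)"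
  using X unfolding locally_split_extensions_def is_extension_def by blast+

lemma incl_closed [simp]: "a \<in> carrier A \<Longrightarrow> \<iota> a \<in> carrier E"
  using incl_hom by (auto simp: hom_def)

lemma proj_closed [simp]: "e \<in> carrier E \<Longrightarrow> \<pi> e \<in> carrier G"
  using proj_hom by (auto simp: hom_def)

lemma incl_mult: "a \<in> carrier A \<Longrightarrow> b \<in> carrier A \<Longrightarrow> \<iota> (a \<otimes>\<^bsub>A\<^esub> b) = \<iota> a \<otimes>\<^bsub>E\<^esub> \<iota> b"
  using incl_hom by (auto simp: hom_def)

lemma proj_mult [simp]: "e \<in> carrier E \<Longrightarrow> d \<in> carrier E \<Longrightarrow> \<pi> (e \<otimes>\<^bsub>E\<^esub> d) = \<pi> e \<otimes> \<pi> d"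
  using proj_hom by (auto simp: hom_def)

lemma proj_inv [simp]: "e \<in> carrier E \<Longrightarrow> \<pi> (inv\<^bsub>E\<^esub> e) = inv (\<pi> e)"
proof -
  interpret group_hom E G \<pi>
    by unfold_locales (rule proj_hom)
  show "e \<in> carrier E \<Longrightarrow> \<pi> (inv\<^bsub>E\<^esub> e) = inv (\<pi> e)" by simp
qed

lemma proj_incl [simp]: "a \<in> carrier A \<Longrightarrow> \<pi> (\<iota> a) = \<one>"
  using incl_image by (auto simp: kernel_def)

lemma incl_swap:
  assumes "e \<in> carrier E" "a \<in> carrier A"
  shows "e \<otimes>\<^bsub>E\<^esub> \<iota> a = \<iota> (act (\<pi> e) a) \<otimes>\<^bsub>E\<^esub> e"
proof -
  have "\<iota> (act (\<pi> e) a) \<otimes>\<^bsub>E\<^esub> e = e \<otimes>\<^bsub>E\<^esub> \<iota> a \<otimes>\<^bsub>E\<^esub> inv\<^bsub>E\<^esub> e \<otimes>\<^bsub>E\<^esub> e"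
    using assms by (simp add: conjugation)
  also have "\<dots> = e \<otimes>\<^bsub>E\<^esub> \<iota> a"
    using assms by (simp add: E.m_assoc)
  finally show ?thesis ..
qed

lemma retract_incl [simp]: "a \<in> carrier A \<Longrightarrow> retract (\<iota> a) = a"
  by (simp add: retract_def incl_inj)

lemma
  assumes "e \<in> carrier E" "\<pi> e = \<one>"
  shows incl_retract: "\<iota> (retract e) = e" and retract_closed: "retract e \<in> carrier A"
proof -
  have "e \<in> \<iota> ` carrier A"
    using assms by (simp add: incl_image kernel_def)
  then show "\<iota> (retract e) = e" "retract e \<in> carrier A"
    by (auto simp: retract_def f_inv_into_f inv_into_into)
qed

lemma incl_cancel:
  assumes "a \<in> carrier A" "b \<in> carrier A" "e \<in> carrier E" "\<iota> a \<otimes>\<^bsub>E\<^esub> e = \<iota> b \<otimes>\<^bsub>E\<^esub> e"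
  shows "a = b"
proof -
  have "\<iota> a = \<iota> b"
    using assms by simp
  then show ?thesis
    using assms incl_inj by (auto dest: inj_onD)
qed

lemma retract_preimage:
  assumes "e \<in> carrier E" "\<pi> e = \<one>" "C \<subseteq> carrier A"
  shows "retract e \<in> C \<longleftrightarrow> e \<in> \<iota> ` C"
proof
  assume "retract e \<in> C"
  then show "e \<in> \<iota> ` C"
    using incl_retract[OF assms(1,2)] by (metis image_eqI)
qed (use assms(3) in auto)

text \<open>Since the inclusion is a closed map, the preimage of a closed set C under
  \<open>retract\<close> is the trace on the kernel of the closed image of C in the total
  group.\<close>

lemma continuous_map_retract:
  assumes f: "continuous_map Z (topo E) f" and ker: "\<And>z. z \<in> topspace Z \<Longrightarrow> \<pi> (f z) = \<one>"
  shows "continuous_map Z (topo A) (\<lambda>z. retract (f z))"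
  unfolding continuous_map_closedin
proof (intro conjI allI impI ballI)
  have fE: "f z \<in> carrier E" if "z \<in> topspace Z" for z
    using f that by (rule E.continuous_map_carrier)
  then show "(\<lambda>z. retract (f z)) \<in> topspace Z \<rightarrow> topspace (topo A)"
    using retract_closed ker by simp
  fix C assume C: "closedin (topo A) C"
  then have "{z \<in> topspace Z. retract (f z) \<in> C} = {z \<in> topspace Z. f z \<in> \<iota> ` C}"
    using retract_preimage fE ker closedin_subset[OF C] by auto
  moreover have "closedin (topo E) (\<iota> ` C)"
    using closed_map_incl C by (auto simp: closed_map_def)
  ultimately show "closedin Z {z \<in> topspace Z. retract (f z) \<in> C}"
    using closedin_continuous_map_preimage[OF f] by simp
qed

lemma measurable_retract:
  assumes f: "f \<in> measurable M (borel_of (topo E))" and ker: "\<And>z. z \<in> space M \<Longrightarrow> \<pi> (f z) = \<one>"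
  shows "(\<lambda>z. retract (f z)) \<in> measurable M (borel_of (topo A))"
proof (rule measurable_borel_ofI)
  have fE: "f z \<in> carrier E" if "z \<in> space M" for z
    using measurable_space[OF f that] by simp
  then have rA: "retract (f z) \<in> carrier A" if "z \<in> space M" for z
    using retract_closed ker that by simp
  then show "(\<lambda>z. retract (f z)) \<in> space M \<rightarrow> topspace (topo A)"
    by simp
  fix V assume V: "openin (topo A) V"
  \<comment> \<open>The inclusion is known to be closed rather than open, so an open
    \<open>V\<close> is tested through the image of its complement.\<close>
  let ?C = "topspace (topo A) - V"
  have "closedin (topo E) (\<iota> ` ?C)"
    using closed_map_incl closedin_diff[OF closedin_topspace V] unfolding closed_map_def by blast
  then have "openin (topo E) (topspace (topo E) - \<iota> ` ?C)"
    by blast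
  then have "{z \<in> space M. f z \<in> topspace (topo E) - \<iota> ` ?C} \<in> sets M"
    by (rule measurable_borel_of_preimage[OF f])
  moreover have "f z \<in> topspace (topo E) - \<iota> ` ?C \<longleftrightarrow> retract (f z) \<in> V" if "z \<in> space M" for z
    using retract_preimage[of "f z" ?C] fE[OF that] ker[OF that] rA[OF that] by auto
  then have "{z \<in> space M. f z \<in> topspace (topo E) - \<iota> ` ?C} = {z \<in> space M. retract (f z) \<in> V}"
    by blast
  ultimately show "{z \<in> space M. retract (f z) \<in> V} \<in> sets M"
    by simp
qed

lemma local_section:
  obtains U \<sigma> where "openin (topo G) U" "\<one> \<in> U"
    "continuous_map (subtopology (topo G) U) (topo E) \<sigma>" "\<And>s. s \<in> U \<Longrightarrow> \<pi> (\<sigma> s) = s"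
    "\<And>s. s \<in> U \<Longrightarrow> \<sigma> s \<in> carrier E"
proof -
  obtain U \<sigma> where U: "openin (topo G) U" "\<one> \<in> U"
    "continuous_map (subtopology (topo G) U) (topo E) \<sigma>" "\<And>s. s \<in> U \<Longrightarrow> \<pi> (\<sigma> s) = s"
    using X by (auto simp: locally_split_extensions_def locally_split_def)
  moreover have "\<sigma> s \<in> carrier E" if "s \<in> U" for s
    using that G.openin_carrier[OF U(1)] by (intro E.continuous_map_carrier[OF U(3)]) auto
  ultimately show ?thesis using that by blast
qed

text \<open>Lifts of the centres of a countable cover of G. Left translation by these lifts covers
  the total group by countably many copies of the part over \<open>U\<close>; this serves both its
  second countability and the construction of a section.\<close>

lemma ex_lifted_translates:
  assumes "openin (topo G) U" and "\<one> \<in> U"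
  shows "\<exists>g d. (\<forall>n. g n \<in> carrier G) \<and> g (0::nat) = \<one> \<and>
    (\<forall>s\<in>carrier G. \<exists>n. inv (g n) \<otimes> s \<in> U) \<and> (\<forall>n. d n \<in> carrier E \<and> \<pi> (d n) = g n)"
proof -
  obtain g :: "nat \<Rightarrow> 'g" where g: "range g \<subseteq> carrier G" "g 0 = \<one>"
      "\<And>s. s \<in> carrier G \<Longrightarrow> \<exists>n. inv (g n) \<otimes> s \<in> U"
    using G.second_countable_translates[OF second_countable_G assms] by metis
  have gG: "g n \<in> carrier G" for n using g(1) by auto
  have "\<forall>n. \<exists>e. e \<in> carrier E \<and> \<pi> e = g n"
  proof
    fix n
    have "g n \<in> \<pi> ` carrier E"
      using gG proj_surj by simp
    then show "\<exists>e. e \<in> carrier E \<and> \<pi> e = g n" by auto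
  qed
  then have "\<exists>d. \<forall>n. d n \<in> carrier E \<and> \<pi> (d n) = g n"
    by (rule choice)
  with gG g(2,3) show ?thesis by blast
qed

text \<open>Over \<open>U\<close> the local section identifies the total group with A x U, which has
  a countable base, and countably many translates of this open part cover everything. The result is
  what makes products of measurable maps into the total group measurable.\<close>

lemma second_countable_E: "second_countable (topo E)"
proof -
  obtain U \<sigma> where U: "openin (topo G) U" "\<one> \<in> U"
    and \<sigma>: "continuous_map (subtopology (topo G) U) (topo E) \<sigma>" "\<And>s. s \<in> U \<Longrightarrow> \<pi> (\<sigma> s) = s"
      "\<And>s. s \<in> U \<Longrightarrow> \<sigma> s \<in> carrier E"
    by (rule local_section) (rule that)
  have U_G: "U \<subseteq> carrier G" using U(1) by (rule G.openin_carrier)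
  define P where "P = {e \<in> carrier E. \<pi> e \<in> U}"
  let ?AU = "prod_topology (topo A) (subtopology (topo G) U)"
  let ?\<mu> = "\<lambda>(a, s). \<iota> a \<otimes>\<^bsub>E\<^esub> \<sigma> s"
  let ?\<nu> = "\<lambda>e. (retract (e \<otimes>\<^bsub>E\<^esub> inv\<^bsub>E\<^esub> (\<sigma> (\<pi> e))), \<pi> e)"
  have "openin (topo E) P"
    using openin_continuous_map_preimage[OF continuous_map_proj U(1)] by (simp add: P_def)
  have \<pi>: "continuous_map (subtopology (topo E) P) (subtopology (topo G) U) \<pi>"
    using continuous_map_proj by (intro continuous_map_into_subtopology continuous_map_from_subtopology)
      (auto simp: P_def)
  have "homeomorphic_maps ?AU (subtopology (topo E) P) ?\<mu> ?\<nu>"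
    unfolding homeomorphic_maps_def
  proof (intro conjI ballI)
    have "continuous_map ?AU (topo E) (\<lambda>x. \<iota> (fst x) \<otimes>\<^bsub>E\<^esub> \<sigma> (snd x))"
      by (intro E.continuous_map_mult continuous_map_compose'[OF continuous_map_fst continuous_map_incl]
        continuous_map_compose'[OF continuous_map_snd \<sigma>(1)])
    then show "continuous_map ?AU (subtopology (topo E) P) ?\<mu>"
      using U_G \<sigma> by (intro continuous_map_into_subtopology) (auto simp: case_prod_beta' P_def subset_iff)
    have "continuous_map (subtopology (topo E) P) (topo A) (\<lambda>e. retract (e \<otimes>\<^bsub>E\<^esub> inv\<^bsub>E\<^esub> (\<sigma> (\<pi> e))))"
      using \<sigma>(2,3) U_G
      by (intro continuous_map_retract E.continuous_map_mult E.continuous_map_inv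
        continuous_map_compose'[OF \<pi> \<sigma>(1)] continuous_map_from_subtopology continuous_map_ident)
        (auto simp: P_def)
    then show "continuous_map (subtopology (topo E) P) ?AU ?\<nu>"
      using \<pi> by (rule continuous_map_pairedI)
    fix x assume "x \<in> topspace ?AU"
    then show "?\<nu> (?\<mu> x) = x"
      using U_G \<sigma>(2,3) by (auto simp: subset_iff E.m_assoc)
  next
    fix e assume "e \<in> topspace (subtopology (topo E) P)"
    then show "?\<mu> (?\<nu> e) = e"
      using \<sigma>(2,3) by (auto simp: P_def incl_retract E.m_assoc)
  qed
  then have "second_countable (subtopology (topo E) P)"
    using homeomorphic_space_second_countability[of ?AU "subtopology (topo E) P"]
    by (auto simp: homeomorphic_space_def intro: second_countable_A second_countable_G
        second_countable_prod_topology second_countable_subtopology)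
  then obtain \<B> where \<B>: "countable \<B>" "\<And>B. B \<in> \<B> \<Longrightarrow> openin (subtopology (topo E) P) B"
      "\<And>U x. openin (subtopology (topo E) P) U \<Longrightarrow> x \<in> U \<Longrightarrow> \<exists>B\<in>\<B>. x \<in> B \<and> B \<subseteq> U"
    unfolding second_countable_def by metis
  obtain g d where g: "\<And>n. g n \<in> carrier G" "g (0::nat) = \<one>"
      "\<And>s. s \<in> carrier G \<Longrightarrow> \<exists>n. inv (g n) \<otimes> s \<in> U"
    and d: "\<And>n. d n \<in> carrier E" "\<And>n. \<pi> (d n) = g n"
    using ex_lifted_translates[OF U] by metis
  define \<C> where "\<C> = (\<lambda>(n, B). {x \<in> carrier E. inv\<^bsub>E\<^esub> (d n) \<otimes>\<^bsub>E\<^esub> x \<in> B}) ` (UNIV \<times> \<B>)"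
  show ?thesis
    unfolding second_countable_def
  proof (intro exI conjI ballI allI impI)
    show "countable \<C>"
      using \<B>(1) by (simp add: \<C>_def)
    fix V assume "V \<in> \<C>"
    then obtain n B where V: "B \<in> \<B>" "V = {x \<in> carrier E. inv\<^bsub>E\<^esub> (d n) \<otimes>\<^bsub>E\<^esub> x \<in> B}"
      by (auto simp: \<C>_def)
    have "openin (topo E) B"
      using \<B>(2)[OF V(1)] \<open>openin (topo E) P\<close> by (rule openin_trans_full)
    then show "openin (topo E) V"
      unfolding V(2) using d by (intro E.openin_l_translate) simp_all
  next
    fix V x assume V: "openin (topo E) V \<and> x \<in> V"
    then have x: "x \<in> carrier E" using E.openin_carrier by blast
    then obtain n where n: "inv (g n) \<otimes> \<pi> x \<in> U"
      using g(3)[of "\<pi> x"] by auto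
    \<comment> \<open>\<open>V\<close> is moved back by \<open>d n\<close> into the trivialised part
      \<open>P\<close>; a basic set is chosen there and moved forward again.\<close>
    let ?W = "{y \<in> carrier E. d n \<otimes>\<^bsub>E\<^esub> y \<in> V} \<inter> P"
    have "openin (subtopology (topo E) P) ?W"
      using V d by (intro openin_subtopology_Int E.openin_l_translate) auto
    moreover have "inv\<^bsub>E\<^esub> (d n) \<otimes>\<^bsub>E\<^esub> x \<in> ?W"
      using x d n V by (simp add: P_def E.mult_inv_cancel)
    ultimately have "\<exists>B\<in>\<B>. inv\<^bsub>E\<^esub> (d n) \<otimes>\<^bsub>E\<^esub> x \<in> B \<and> B \<subseteq> ?W"
      by (rule \<B>(3))
    then obtain B where B: "B \<in> \<B>" "inv\<^bsub>E\<^esub> (d n) \<otimes>\<^bsub>E\<^esub> x \<in> B" "B \<subseteq> ?W"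
      by auto
    let ?C = "{x \<in> carrier E. inv\<^bsub>E\<^esub> (d n) \<otimes>\<^bsub>E\<^esub> x \<in> B}"
    have "?C \<subseteq> V"
    proof
      fix y assume y: "y \<in> ?C"
      then have "d n \<otimes>\<^bsub>E\<^esub> (inv\<^bsub>E\<^esub> (d n) \<otimes>\<^bsub>E\<^esub> y) \<in> V"
        using B(3) by blast
      then show "y \<in> V"
        using y d by (simp add: E.mult_inv_cancel)
    qed
    moreover have "?C \<in> \<C>"
      using B(1) by (force simp: \<C>_def)
    ultimately show "\<exists>C\<in>\<C>. x \<in> C \<and> C \<subseteq> V"
      using x B(2) by (intro bexI[of _ ?C]) simp_all
  qed
qed

lemmas measurable_mult_E = E.measurable_mult[OF second_countable_E]

text \<open>Over the n-th translate of \<open>U\<close> the formula d_n \<sigma>(g_n^-1 s) is a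
  continuous section, and the first applicable n is used at each s. Index 0 belongs to a
  neighbourhood of the identity and always wins there, which gives continuity near the
  identity.\<close>

lemma ex_lcm_section: "\<exists>\<sigma>. lcm_section G X \<sigma>"
proof -
  obtain U \<sigma> where U: "openin (topo G) U" "\<one> \<in> U"
    and \<sigma>: "continuous_map (subtopology (topo G) U) (topo E) \<sigma>" "\<And>s. s \<in> U \<Longrightarrow> \<pi> (\<sigma> s) = s"
      "\<And>s. s \<in> U \<Longrightarrow> \<sigma> s \<in> carrier E"
    by (rule local_section) (rule that)
  obtain g d where g: "\<And>n. g n \<in> carrier G" "g (0::nat) = \<one>"
      "\<And>s. s \<in> carrier G \<Longrightarrow> \<exists>n. inv (g n) \<otimes> s \<in> U"
    and d: "\<And>n. d n \<in> carrier E" "\<And>n. \<pi> (d n) = g n"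
    using ex_lifted_translates[OF U] by metis
  define T where "T n = {s \<in> carrier G. inv (g n) \<otimes> s \<in> U}" for n
  define f where "f n s = d n \<otimes>\<^bsub>E\<^esub> \<sigma> (inv (g n) \<otimes> s)" for n s
  have T: "openin (topo G) (T n)" for n
    using U(1) g(1) by (auto simp: T_def intro: G.openin_l_translate)
  have f: "continuous_map (subtopology (topo G) (T n)) (topo E) (f n)" for n
    unfolding f_def
  proof (intro E.continuous_map_mult E.continuous_map_const_carrier d)
    have "continuous_map (subtopology (topo G) (T n)) (subtopology (topo G) U)
        (\<lambda>s. inv (g n) \<otimes> s)"
      using g(1) by (intro continuous_map_into_subtopology continuous_map_from_subtopology
        G.continuous_map_l_translate) (auto simp: T_def)
    then show "continuous_map (subtopology (topo G) (T n)) (topo E) (\<lambda>s. \<sigma> (inv (g n) \<otimes> s))"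
      using \<sigma>(1) by (rule continuous_map_compose')
  qed
  have cover: "topspace (topo G) \<subseteq> (\<Union>n. T n)"
    using g(3) by (auto simp: T_def)
  have "lcm_section G X (\<lambda>s. f (LEAST n. s \<in> T n) s)"
    unfolding lcm_section_def
  proof (intro conjI ballI exI)
    show "(\<lambda>s. f (LEAST n. s \<in> T n) s) \<in> measurable (borel_of (topo G)) (borel_of (topo E))"
      using T cover f by (rule measurable_first_piece)
    show "\<pi> (f (LEAST n. s \<in> T n) s) = s" if "s \<in> carrier G" for s
    proof -
      let ?n = "LEAST n. s \<in> T n"
      have "s \<in> T ?n"
        using cover that by (auto intro: LeastI)
      then show ?thesis
        using d g(1) that \<sigma>(2,3) by (simp add: f_def T_def G.mult_inv_cancel)
    qed
    show "openin (topo G) (T 0)" by (rule T)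
    show "\<one> \<in> T 0"
      using U(2) g(2) by (simp add: T_def)
    show "continuous_map (subtopology (topo G) (T 0)) (topo E) (\<lambda>s. f (LEAST n. s \<in> T n) s)"
      using f[of 0]
    proof (rule continuous_map_eq)
      fix s assume "s \<in> topspace (subtopology (topo G) (T 0))"
      then have "(LEAST n. s \<in> T n) = 0"
        by (intro Least_eq_0) simp
      then show "f 0 s = f (LEAST n. s \<in> T n) s" by simp
    qed
  qed
  then show ?thesis by blast
qed

section \<open>The cocycle of a section and the coordinates it defines\<close>

definition section_factor :: "('g \<Rightarrow> 'e) \<Rightarrow> 'g \<Rightarrow> 'g \<Rightarrow> 'a" where
  "section_factor \<sigma> s t = retract (\<sigma> s \<otimes>\<^bsub>E\<^esub> \<sigma> t \<otimes>\<^bsub>E\<^esub> inv\<^bsub>E\<^esub> (\<sigma> (s \<otimes> t)))"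

lemma section_cocycle_point2:
  "s \<in> carrier G \<Longrightarrow> t \<in> carrier G \<Longrightarrow> section_cocycle G A X \<sigma> (point2 s t) = section_factor \<sigma> s t"
  using G.point_in_power_top(2)[of s t]
  by (simp add: section_cocycle_def section_factor_def retract_def)

lemma section_cocycle_extensional: "section_cocycle G A X \<sigma> \<in> extensional (topspace (power_top G 2))"
  by (simp add: section_cocycle_def)

context
  fixes \<sigma> assumes \<sigma>: "lcm_section G X \<sigma>"
begin

lemma section_measurable: "\<sigma> \<in> measurable (borel_of (topo G)) (borel_of (topo E))"
  using \<sigma> by (simp add: lcm_section_def)

lemma section_closed [simp]: "s \<in> carrier G \<Longrightarrow> \<sigma> s \<in> carrier E"
  using measurable_space[OF section_measurable] by simp

lemma proj_section [simp]: "s \<in> carrier G \<Longrightarrow> \<pi> (\<sigma> s) = s"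
  using \<sigma> by (simp add: lcm_section_def)

lemma section_factor_closed [simp]:
  "s \<in> carrier G \<Longrightarrow> t \<in> carrier G \<Longrightarrow> section_factor \<sigma> s t \<in> carrier A"
  by (simp add: section_factor_def retract_closed)

lemma section_mult:
  assumes "s \<in> carrier G" "t \<in> carrier G"
  shows "\<sigma> s \<otimes>\<^bsub>E\<^esub> \<sigma> t = \<iota> (section_factor \<sigma> s t) \<otimes>\<^bsub>E\<^esub> \<sigma> (s \<otimes> t)"
proof -
  have "\<iota> (section_factor \<sigma> s t) = \<sigma> s \<otimes>\<^bsub>E\<^esub> \<sigma> t \<otimes>\<^bsub>E\<^esub> inv\<^bsub>E\<^esub> (\<sigma> (s \<otimes> t))"
    using assms by (simp add: section_factor_def incl_retract)
  then show ?thesis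
    using assms by (simp add: E.m_assoc)
qed

lemma cochain2_section_factor: "cochain2 (section_factor \<sigma>)"
proof -
  have fst: "fst \<in> measurable (borel_of GG) (borel_of (topo G))"
    and snd: "snd \<in> measurable (borel_of GG) (borel_of (topo G))"
    by (auto intro: continuous_imp_borel_measurable continuous_map_fst continuous_map_snd)
  have meas: "(\<lambda>x. section_factor \<sigma> (fst x) (snd x)) \<in> measurable (borel_of GG) (borel_of (topo A))"
    unfolding section_factor_def
    by (intro measurable_retract measurable_mult_E E.measurable_inv
        measurable_compose[OF _ section_measurable] measurable_mult_G fst snd) auto
  obtain U where U: "openin (topo G) U" "\<one> \<in> U"
      "continuous_map (subtopology (topo G) U) (topo E) \<sigma>"
    using \<sigma> by (auto simp: lcm_section_def)
  have "continuous_map GG (topo G) (\<lambda>x. fst x \<otimes> snd x)"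
    by (intro G.continuous_map_mult continuous_map_fst continuous_map_snd)
  then have *: "openin GG {x \<in> topspace GG. fst x \<otimes> snd x \<in> U}"
    using U(1) by (rule openin_continuous_map_preimage)
  have **: "(\<one>, \<one>) \<in> {x \<in> topspace GG. fst x \<otimes> snd x \<in> U}"
    using U(2) by simp
  obtain V W where VW: "openin (topo G) V" "openin (topo G) W" "\<one> \<in> V" "\<one> \<in> W"
      "V \<times> W \<subseteq> {x \<in> topspace GG. fst x \<otimes> snd x \<in> U}"
    using openin_prod_topologyE[OF * **] .
  \<comment> \<open>On the square of \<open>?V\<close> both arguments and also their product lie in
    \<open>U\<close>, so all three values of \<sigma> vary continuously.\<close>
  let ?V = "U \<inter> V \<inter> W"
  let ?S = "subtopology GG (?V \<times> ?V)"
  have sub: "continuous_map ?S (subtopology (topo G) U) f"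
    if "continuous_map ?S (topo G) f" "f \<in> topspace ?S \<rightarrow> U" for f
    using that by (intro continuous_map_into_subtopology)
  have fst': "continuous_map ?S (topo G) fst" and snd': "continuous_map ?S (topo G) snd"
    by (intro continuous_map_from_subtopology continuous_map_fst continuous_map_snd)+
  have "continuous_map ?S (topo A) (\<lambda>x. section_factor \<sigma> (fst x) (snd x))"
    unfolding section_factor_def
    by (intro continuous_map_retract E.continuous_map_mult E.continuous_map_inv
        continuous_map_compose'[OF sub U(3)] G.continuous_map_mult fst' snd') (use VW(5) in auto)
  moreover have "openin (topo G) ?V" "\<one> \<in> ?V"
    using U VW by auto
  ultimately show ?thesis
    using meas unfolding cochain2_def case_prod_beta' by blast
qed

text \<open>After multiplication by \<sigma>(stu), both sides are expansions of \<sigma>(s)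
  \<sigma>(t) \<sigma>(u) according to its two bracketings. Moving the factor of (t, u) to the left
  past \<sigma>(s) produces the action of s.\<close>

lemma cocycle2_section_factor: "cocycle2 (section_factor \<sigma>)"
  unfolding cocycle2_def
proof (intro conjI ballI cochain2_section_factor)
  fix s t u assume G: "s \<in> carrier G" "t \<in> carrier G" "u \<in> carrier G"
  let ?f = "section_factor \<sigma>" and ?w = "\<sigma> (s \<otimes> t \<otimes> u)"
  have "\<iota> (act s (?f t u) \<otimes>\<^bsub>A\<^esub> ?f s (t \<otimes> u)) \<otimes>\<^bsub>E\<^esub> ?w
      = \<iota> (act s (?f t u)) \<otimes>\<^bsub>E\<^esub> (\<sigma> s \<otimes>\<^bsub>E\<^esub> \<sigma> (t \<otimes> u))"
    using G by (simp add: incl_mult section_mult E.m_assoc G.m_assoc)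
  also have "\<dots> = \<sigma> s \<otimes>\<^bsub>E\<^esub> \<iota> (?f t u) \<otimes>\<^bsub>E\<^esub> \<sigma> (t \<otimes> u)"
    using G by (simp add: incl_swap[of "\<sigma> s" "?f t u"] E.m_assoc)
  also have "\<dots> = \<sigma> s \<otimes>\<^bsub>E\<^esub> \<sigma> t \<otimes>\<^bsub>E\<^esub> \<sigma> u"
    using G section_mult[of t u] by (simp add: E.m_assoc)
  also have "\<dots> = \<iota> (?f s t \<otimes>\<^bsub>A\<^esub> ?f (s \<otimes> t) u) \<otimes>\<^bsub>E\<^esub> ?w"
    using G by (simp add: section_mult incl_mult E.m_assoc)
  finally show "act s (?f t u) \<otimes>\<^bsub>A\<^esub> ?f s (t \<otimes> u) = ?f s t \<otimes>\<^bsub>A\<^esub> ?f (s \<otimes> t) u"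
    by (rule incl_cancel[rotated -1]) (use G in simp_all)
qed

lemma section_cocycle_in_cocycles: "section_cocycle G A X \<sigma> \<in> carrier (lcm_cocycles G A act 2)"
  unfolding in_cocycles2_iff[OF section_cocycle_extensional]
  using section_cocycle_point2 cocycle2_section_factor by (rule cocycle2_cong)

text \<open>Together with the projection it identifies the total group as a set with A x G; by
  \<open>fibre_coord_mult\<close> the product becomes the twisted product of the section's
  cocycle.\<close>

definition fibre_coord :: "'e \<Rightarrow> 'a" where
  "fibre_coord e = retract (e \<otimes>\<^bsub>E\<^esub> inv\<^bsub>E\<^esub> (\<sigma> (\<pi> e)))"

lemma fibre_coord_closed [simp]: "e \<in> carrier E \<Longrightarrow> fibre_coord e \<in> carrier A"
  by (simp add: fibre_coord_def retract_closed)

lemma incl_fibre_coord: "e \<in> carrier E \<Longrightarrow> \<iota> (fibre_coord e) \<otimes>\<^bsub>E\<^esub> \<sigma> (\<pi> e) = e"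
  by (simp add: fibre_coord_def incl_retract E.m_assoc)

lemma fibre_coord_incl [simp]:
  "a \<in> carrier A \<Longrightarrow> s \<in> carrier G \<Longrightarrow> fibre_coord (\<iota> a \<otimes>\<^bsub>E\<^esub> \<sigma> s) = a"
  by (simp add: fibre_coord_def E.m_assoc)

lemma incl_section_mult:
  assumes "a \<in> carrier A" "b \<in> carrier A" "s \<in> carrier G" "t \<in> carrier G"
  shows "(\<iota> a \<otimes>\<^bsub>E\<^esub> \<sigma> s) \<otimes>\<^bsub>E\<^esub> (\<iota> b \<otimes>\<^bsub>E\<^esub> \<sigma> t) =
    \<iota> (a \<otimes>\<^bsub>A\<^esub> act s b \<otimes>\<^bsub>A\<^esub> section_factor \<sigma> s t) \<otimes>\<^bsub>E\<^esub> \<sigma> (s \<otimes> t)"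
proof -
  have "(\<iota> a \<otimes>\<^bsub>E\<^esub> \<sigma> s) \<otimes>\<^bsub>E\<^esub> (\<iota> b \<otimes>\<^bsub>E\<^esub> \<sigma> t) = \<iota> a \<otimes>\<^bsub>E\<^esub> (\<sigma> s \<otimes>\<^bsub>E\<^esub> \<iota> b) \<otimes>\<^bsub>E\<^esub> \<sigma> t"
    using assms by (simp add: E.m_assoc)
  also have "\<dots> = \<iota> a \<otimes>\<^bsub>E\<^esub> \<iota> (act s b) \<otimes>\<^bsub>E\<^esub> (\<sigma> s \<otimes>\<^bsub>E\<^esub> \<sigma> t)"
    using assms by (simp add: incl_swap[of "\<sigma> s" b] E.m_assoc)
  also have "\<dots> = \<iota> (a \<otimes>\<^bsub>A\<^esub> act s b \<otimes>\<^bsub>A\<^esub> section_factor \<sigma> s t) \<otimes>\<^bsub>E\<^esub> \<sigma> (s \<otimes> t)"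
    using assms by (simp add: section_mult incl_mult E.m_assoc)
  finally show ?thesis .
qed

lemma fibre_coord_mult:
  assumes "e \<in> carrier E" "d \<in> carrier E"
  shows "fibre_coord (e \<otimes>\<^bsub>E\<^esub> d) =
    fibre_coord e \<otimes>\<^bsub>A\<^esub> act (\<pi> e) (fibre_coord d) \<otimes>\<^bsub>A\<^esub> section_factor \<sigma> (\<pi> e) (\<pi> d)"
proof -
  have "fibre_coord (e \<otimes>\<^bsub>E\<^esub> d) =
      fibre_coord ((\<iota> (fibre_coord e) \<otimes>\<^bsub>E\<^esub> \<sigma> (\<pi> e)) \<otimes>\<^bsub>E\<^esub> (\<iota> (fibre_coord d) \<otimes>\<^bsub>E\<^esub> \<sigma> (\<pi> d)))"
    using assms by (simp add: incl_fibre_coord)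
  then show ?thesis
    using assms by (simp add: incl_section_mult)
qed

lemma continuous_map_fibre_coord:
  assumes U: "U \<subseteq> carrier G" "continuous_map (subtopology (topo G) U) (topo E) \<sigma>"
  shows "continuous_map (subtopology (topo E) {e \<in> carrier E. \<pi> e \<in> U}) (topo A) fibre_coord"
proof -
  let ?P = "{e \<in> carrier E. \<pi> e \<in> U}"
  have "continuous_map (subtopology (topo E) ?P) (subtopology (topo G) U) \<pi>"
    using continuous_map_proj by (intro continuous_map_into_subtopology continuous_map_from_subtopology) auto
  from continuous_map_compose'[OF this U(2)]
  have "continuous_map (subtopology (topo E) ?P) (topo E) (\<lambda>e. \<sigma> (\<pi> e))" .
  moreover have "continuous_map (subtopology (topo E) ?P) (topo E) (\<lambda>e. e)"
    by (intro continuous_map_from_subtopology continuous_map_ident)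
  ultimately show ?thesis
    unfolding fibre_coord_def
    by (intro continuous_map_retract E.continuous_map_mult E.continuous_map_inv) auto
qed

end

text \<open>The product \<sigma>(s) \<sigma>(t) is computed once by substituting the expression
  through \<tau> and once through the factor of \<sigma>; cancelling \<tau>(st) leaves an identity
  in A.\<close>

lemma section_factor_twist:
  assumes \<sigma>: "lcm_section G X \<sigma>" and \<tau>: "lcm_section G X \<tau>"
    and h: "\<And>s. s \<in> carrier G \<Longrightarrow> h s \<in> carrier A"
    and \<sigma>\<tau>: "\<And>s. s \<in> carrier G \<Longrightarrow> \<sigma> s = \<iota> (h s) \<otimes>\<^bsub>E\<^esub> \<tau> s"
    and G: "s \<in> carrier G" "t \<in> carrier G"
  shows "section_factor \<sigma> s t = coboundary1 h s t \<otimes>\<^bsub>A\<^esub> section_factor \<tau> s t"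
proof -
  note [simp] = section_closed[OF \<sigma>] section_closed[OF \<tau>] section_factor_closed[OF \<sigma>]
    section_factor_closed[OF \<tau>] h
  have "\<iota> (h s \<otimes>\<^bsub>A\<^esub> act s (h t) \<otimes>\<^bsub>A\<^esub> section_factor \<tau> s t) \<otimes>\<^bsub>E\<^esub> \<tau> (s \<otimes> t) = \<sigma> s \<otimes>\<^bsub>E\<^esub> \<sigma> t"
    using G by (simp add: \<sigma>\<tau> incl_section_mult[OF \<tau>])
  also have "\<dots> = \<iota> (section_factor \<sigma> s t \<otimes>\<^bsub>A\<^esub> h (s \<otimes> t)) \<otimes>\<^bsub>E\<^esub> \<tau> (s \<otimes> t)"
    using G by (simp add: section_mult[OF \<sigma>] incl_mult E.m_assoc flip: \<sigma>\<tau>)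
  finally have eq: "h s \<otimes>\<^bsub>A\<^esub> act s (h t) \<otimes>\<^bsub>A\<^esub> section_factor \<tau> s t = section_factor \<sigma> s t \<otimes>\<^bsub>A\<^esub> h (s \<otimes> t)"
    by (rule incl_cancel[rotated -1]) (use G in simp_all)
  have "coboundary1 h s t \<otimes>\<^bsub>A\<^esub> section_factor \<tau> s t
      = inv\<^bsub>A\<^esub> (h (s \<otimes> t)) \<otimes>\<^bsub>A\<^esub> (h s \<otimes>\<^bsub>A\<^esub> act s (h t) \<otimes>\<^bsub>A\<^esub> section_factor \<tau> s t)"
    using G by (simp add: coboundary1_def A.m_ac)
  also have "\<dots> = section_factor \<sigma> s t"
    unfolding eq using G by (simp add: A.m_comm[of "section_factor \<sigma> s t"] A.mult_inv_cancel)
  finally show ?thesis ..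
qed

lemma sections_differ_by_cochain:
  assumes \<sigma>: "lcm_section G X \<sigma>" and \<tau>: "lcm_section G X \<tau>"
  obtains h where "cochain1 h" "\<And>s. s \<in> carrier G \<Longrightarrow> \<sigma> s = \<iota> (h s) \<otimes>\<^bsub>E\<^esub> \<tau> s"
proof
  note [simp] = section_closed[OF \<sigma>] section_closed[OF \<tau>] proj_section[OF \<sigma>] proj_section[OF \<tau>]
  let ?h = "\<lambda>s. retract (\<sigma> s \<otimes>\<^bsub>E\<^esub> inv\<^bsub>E\<^esub> (\<tau> s))"
  obtain U V where U: "openin (topo G) U" "\<one> \<in> U" "continuous_map (subtopology (topo G) U) (topo E) \<sigma>"
    and V: "openin (topo G) V" "\<one> \<in> V" "continuous_map (subtopology (topo G) V) (topo E) \<tau>"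
    using \<sigma> \<tau> by (auto simp: lcm_section_def)
  have "continuous_map (subtopology (topo G) (U \<inter> V)) (topo E) \<sigma>"
    "continuous_map (subtopology (topo G) (U \<inter> V)) (topo E) \<tau>"
    using U(3) V(3) by (auto elim: continuous_map_from_subtopology_mono)
  then have "continuous_map (subtopology (topo G) (U \<inter> V)) (topo A) ?h"
    by (intro continuous_map_retract E.continuous_map_mult E.continuous_map_inv) auto
  moreover have "?h \<in> measurable (borel_of (topo G)) (borel_of (topo A))"
    using section_measurable[OF \<sigma>] section_measurable[OF \<tau>]
    by (intro measurable_retract measurable_mult_E E.measurable_inv) auto
  moreover have "openin (topo G) (U \<inter> V)" "\<one> \<in> U \<inter> V"
    using U V by auto
  ultimately show "cochain1 ?h"
    unfolding cochain1_def by blast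
  show "\<sigma> s = \<iota> (?h s) \<otimes>\<^bsub>E\<^esub> \<tau> s" if "s \<in> carrier G" for s
    using that by (simp add: incl_retract E.m_assoc)
qed

text \<open>Together with \<open>section_factor_twist\<close>, this lets a section be changed within
  its extension so that cohomologous cocycles become equal ones.\<close>

lemma lcm_section_twist:
  assumes \<tau>: "lcm_section G X \<tau>" and h: "cochain1 h"
  shows "lcm_section G X (\<lambda>s. \<iota> (h s) \<otimes>\<^bsub>E\<^esub> \<tau> s)"
  unfolding lcm_section_def
proof (intro conjI ballI)
  show "(\<lambda>s. \<iota> (h s) \<otimes>\<^bsub>E\<^esub> \<tau> s) \<in> measurable (borel_of (topo G)) (borel_of (topo E))"
    using section_measurable[OF \<tau>] h continuous_map_incl
    by (auto simp: cochain1_def intro!: measurable_mult_E intro: measurable_continuous_compose)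
  show "\<pi> (\<iota> (h s) \<otimes>\<^bsub>E\<^esub> \<tau> s) = s" if "s \<in> carrier G" for s
    using that cochain1_closed[OF h] section_closed[OF \<tau>] proj_section[OF \<tau>] by simp
  obtain U V where U: "openin (topo G) U" "\<one> \<in> U" "continuous_map (subtopology (topo G) U) (topo A) h"
    and V: "openin (topo G) V" "\<one> \<in> V" "continuous_map (subtopology (topo G) V) (topo E) \<tau>"
    using h \<tau> by (auto simp: lcm_section_def cochain1_def)
  have "continuous_map (subtopology (topo G) (U \<inter> V)) (topo A) h"
    "continuous_map (subtopology (topo G) (U \<inter> V)) (topo E) \<tau>"
    using U(3) V(3) by (auto elim: continuous_map_from_subtopology_mono)
  then have "continuous_map (subtopology (topo G) (U \<inter> V)) (topo E) (\<lambda>s. \<iota> (h s) \<otimes>\<^bsub>E\<^esub> \<tau> s)"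
    by (intro E.continuous_map_mult continuous_map_compose'[OF _ continuous_map_incl])
  moreover have "openin (topo G) (U \<inter> V)" "\<one> \<in> U \<inter> V"
    using U V by auto
  ultimately show "\<exists>U. openin (topo G) U \<and> \<one> \<in> U \<and>
      continuous_map (subtopology (topo G) U) (topo E) (\<lambda>s. \<iota> (h s) \<otimes>\<^bsub>E\<^esub> \<tau> s)"
    by blast
qed

end

section \<open>Comparing extensions\<close>

text \<open>Sections are not normalised. The relation \<sigma>(1) \<sigma>(1) = \<iota>(c)
  \<sigma>(1), with c the factor at (1, 1), determines the value at the identity.\<close>

lemma (in split_extension) section_one:
  assumes "lcm_section G X \<sigma>"
  shows "\<sigma> \<one> = \<iota> (section_factor \<sigma> \<one> \<one>)"
proof -
  have "\<sigma> \<one> \<otimes>\<^bsub>E\<^esub> \<sigma> \<one> = \<iota> (section_factor \<sigma> \<one> \<one>) \<otimes>\<^bsub>E\<^esub> \<sigma> \<one>"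
    using section_mult[OF assms, of "\<one>" "\<one>"] by simp
  then show ?thesis
    using section_closed[OF assms, of "\<one>"] section_factor_closed[OF assms, of "\<one>" "\<one>"] by simp
qed

locale extension_comparison = X: split_extension G A act X + Y: split_extension G A act Y
  for G :: "'g topgroup" (structure) and A :: "'a topgroup" and act :: "'g \<Rightarrow> 'a \<Rightarrow> 'a"
    and X :: "('a, 'e, 'g) extension" and Y :: "('a, 'f, 'g) extension" +
  fixes \<sigma> :: "'g \<Rightarrow> 'e" and \<tau> :: "'g \<Rightarrow> 'f"
  assumes \<sigma>: "lcm_section G X \<sigma>" and \<tau>: "lcm_section G Y \<tau>"
    and factors_eq: "\<And>s t. s \<in> carrier G \<Longrightarrow> t \<in> carrier G \<Longrightarrow>
      X.section_factor \<sigma> s t = Y.section_factor \<tau> s t"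
begin

definition compare :: "'e \<Rightarrow> 'f" where
  "compare e = Y.\<iota> (X.fibre_coord \<sigma> e) \<otimes>\<^bsub>Y.E\<^esub> \<tau> (X.\<pi> e)"

lemma compare_closed: "e \<in> carrier X.E \<Longrightarrow> compare e \<in> carrier Y.E"
  by (simp add: compare_def Y.section_closed[OF \<tau>] X.fibre_coord_closed[OF \<sigma>])

lemma proj_compare: "e \<in> carrier X.E \<Longrightarrow> Y.\<pi> (compare e) = X.\<pi> e"
  by (simp add: compare_def Y.section_closed[OF \<tau>] Y.proj_section[OF \<tau>] X.fibre_coord_closed[OF \<sigma>])

lemma fibre_coord_compare: "e \<in> carrier X.E \<Longrightarrow> Y.fibre_coord \<tau> (compare e) = X.fibre_coord \<sigma> e"
  by (simp add: compare_def Y.fibre_coord_incl[OF \<tau>] X.fibre_coord_closed[OF \<sigma>])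

lemma compare_hom: "compare \<in> hom X.E Y.E"
proof (rule homI)
  fix e d assume ed: "e \<in> carrier X.E" "d \<in> carrier X.E"
  then show "compare (e \<otimes>\<^bsub>X.E\<^esub> d) = compare e \<otimes>\<^bsub>Y.E\<^esub> compare d"
    by (simp add: compare_def X.fibre_coord_mult[OF \<sigma>] Y.incl_section_mult[OF \<tau>] factors_eq
        X.fibre_coord_closed[OF \<sigma>])
qed (rule compare_closed)

text \<open>The element \<iota>(a) lies over 1, and both sections take there the image of the same
  c, as their factors agree at (1, 1). Its coordinate is thus a c^-1 in either extension.\<close>

lemma compare_incl:
  assumes a: "a \<in> carrier A"
  shows "compare (X.\<iota> a) = Y.\<iota> a"
proof -
  let ?c = "X.section_factor \<sigma> \<one> \<one>"
  have c: "?c \<in> carrier A"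
    by (simp add: X.section_factor_closed[OF \<sigma>])
  have b: "X.fibre_coord \<sigma> (X.\<iota> a) \<in> carrier A"
    using a by (simp add: X.fibre_coord_closed[OF \<sigma>])
  have "X.\<iota> (X.fibre_coord \<sigma> (X.\<iota> a) \<otimes>\<^bsub>A\<^esub> ?c) = X.\<iota> a"
    using X.incl_fibre_coord[OF \<sigma>, of "X.\<iota> a"] a b c by (simp add: X.incl_mult X.section_one[OF \<sigma>])
  then have "X.fibre_coord \<sigma> (X.\<iota> a) \<otimes>\<^bsub>A\<^esub> ?c = a"
    using X.incl_inj a b c by (auto dest: inj_onD)
  moreover have "compare (X.\<iota> a) = Y.\<iota> (X.fibre_coord \<sigma> (X.\<iota> a) \<otimes>\<^bsub>A\<^esub> ?c)"
    using a b c by (simp add: compare_def Y.section_one[OF \<tau>] Y.incl_mult factors_eq)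
  ultimately show ?thesis by simp
qed

lemma continuous_map_compare: "continuous_map (topo X.E) (topo Y.E) compare"
proof -
  obtain U where U: "openin (topo G) U" "\<one> \<in> U" "continuous_map (subtopology (topo G) U) (topo X.E) \<sigma>"
    using \<sigma> by (auto simp: lcm_section_def)
  obtain V where V: "openin (topo G) V" "\<one> \<in> V" "continuous_map (subtopology (topo G) V) (topo Y.E) \<tau>"
    using \<tau> by (auto simp: lcm_section_def)
  let ?W = "U \<inter> V"
  let ?P = "{e \<in> carrier X.E. X.\<pi> e \<in> ?W}"
  have W: "?W \<subseteq> carrier G" "continuous_map (subtopology (topo G) ?W) (topo X.E) \<sigma>"
      "continuous_map (subtopology (topo G) ?W) (topo Y.E) \<tau>"
    using X.G.openin_carrier[OF U(1)] U(3) V(3) by (auto elim: continuous_map_from_subtopology_mono)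
  have "continuous_map (subtopology (topo X.E) ?P) (subtopology (topo G) ?W) X.\<pi>"
    using X.continuous_map_proj
    by (intro continuous_map_into_subtopology continuous_map_from_subtopology) auto
  from continuous_map_compose'[OF this W(3)]
    continuous_map_compose'[OF X.continuous_map_fibre_coord[OF \<sigma> W(1,2)] Y.continuous_map_incl]
  have cont: "continuous_map (subtopology (topo X.E) ?P) (topo Y.E) compare"
    unfolding compare_def by (intro Y.E.continuous_map_mult)
  have "openin (topo X.E) {e \<in> topspace (topo X.E). X.\<pi> e \<in> ?W}"
    using X.continuous_map_proj openin_Int[OF U(1) V(1)] by (rule openin_continuous_map_preimage)
  moreover have "X.\<pi> \<one>\<^bsub>X.E\<^esub> = \<one>"
    using X.proj_hom X.E.is_group X.G.is_group by (rule hom_one)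
  ultimately show ?thesis
    using U(2) V(2) by (intro hom_continuous_map[OF X.E.topological Y.E.topological compare_hom _ _ cont]) auto
qed

lemma comparison_sym: "extension_comparison G A act Y X \<tau> \<sigma>"
  by unfold_locales (simp_all add: \<sigma> \<tau> factors_eq)

text \<open>The inverse is the comparison map with the two extensions exchanged; it satisfies the
  same hypotheses, so its continuity is an instance of the result already proved.\<close>

theorem isomorphic: "isomorphic_extensions A X Y"
proof -
  interpret conv: extension_comparison G A act Y X \<tau> \<sigma>
    by (rule comparison_sym)
  have inv1: "conv.compare (compare e) = e" if "e \<in> carrier X.E" for e
    using that unfolding conv.compare_def
    by (simp add: fibre_coord_compare proj_compare X.incl_fibre_coord[OF \<sigma>])
  have inv2: "compare (conv.compare e) = e" if "e \<in> carrier Y.E" for e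
    using that unfolding compare_def
    by (simp add: conv.fibre_coord_compare conv.proj_compare Y.incl_fibre_coord[OF \<tau>])
  have "bij_betw compare (carrier X.E) (carrier Y.E)"
    by (rule bij_betw_byWitness[where f' = conv.compare])
      (auto simp: inv1 inv2 compare_closed conv.compare_closed)
  then have "compare \<in> iso X.E Y.E"
    using compare_hom by (simp add: iso_def)
  moreover have "homeomorphic_maps (topo X.E) (topo Y.E) compare conv.compare"
    unfolding homeomorphic_maps_def
    by (simp add: continuous_map_compare conv.continuous_map_compare inv1 inv2)
  ultimately show ?thesis
    unfolding isomorphic_extensions_def
    by (intro exI[of _ compare]) (simp add: compare_incl proj_compare homeomorphic_maps_imp_map)
qed

end

section \<open>Cohomology classes against isomorphism classes\<close>

context lcm_module
begin

lemma ex_lcm_section_of: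
  assumes "X \<in> locally_split_extensions G A act"
  shows "\<exists>\<sigma>. lcm_section G X \<sigma>"
proof -
  interpret split_extension G A act X using assms by unfold_locales
  show ?thesis by (rule ex_lcm_section)
qed

lemma section_cocycle_in_cocycles_of:
  assumes "X \<in> locally_split_extensions G A act" and "lcm_section G X \<sigma>"
  shows "section_cocycle G A X \<sigma> \<in> carrier (lcm_cocycles G A act 2)"
proof -
  interpret split_extension G A act X using assms(1) by unfold_locales
  show ?thesis using assms(2) by (rule section_cocycle_in_cocycles)
qed

lemma section_cocycle_class_eq:
  assumes X: "X \<in> locally_split_extensions G A act" and \<sigma>: "lcm_section G X \<sigma>" and \<tau>: "lcm_section G X \<tau>"
  shows "lcm_class G A act 2 (section_cocycle G A X \<sigma>) = lcm_class G A act 2 (section_cocycle G A X \<tau>)"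
proof -
  interpret X: split_extension G A act X using X by unfold_locales
  obtain h where h: "cochain1 h" "\<And>s. s \<in> carrier G \<Longrightarrow> \<sigma> s = incl X (h s) \<otimes>\<^bsub>total X\<^esub> \<tau> s"
    using X.sections_differ_by_cochain[OF \<sigma> \<tau>] by metis
  have "section_cocycle G A X \<sigma> (point2 s t) = coboundary1 h s t \<otimes>\<^bsub>A\<^esub> section_cocycle G A X \<tau> (point2 s t)"
    if "s \<in> carrier G" "t \<in> carrier G" for s t
    using X.section_factor_twist[OF \<sigma> \<tau> cochain1_closed[OF h(1)] h(2) that] that
    by (simp add: X.section_cocycle_point2)
  with h(1) show ?thesis
    by (subst lcm_class_eq_iff) (auto intro: X.section_cocycle_in_cocycles \<sigma> \<tau>)
qed

lemma isomorphic_if_class_eq: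
  fixes X :: "('a, 'e, 'g) extension" and Y :: "('a, 'f, 'g) extension"
  assumes X: "X \<in> locally_split_extensions G A act" and Y: "Y \<in> locally_split_extensions G A act"
    and \<sigma>: "lcm_section G X \<sigma>" and \<tau>: "lcm_section G Y \<tau>"
    and eq: "lcm_class G A act 2 (section_cocycle G A X \<sigma>) = lcm_class G A act 2 (section_cocycle G A Y \<tau>)"
  shows "isomorphic_extensions A X Y"
proof -
  interpret X: split_extension G A act X using X by unfold_locales
  interpret Y: split_extension G A act Y using Y by unfold_locales
  obtain h where h: "cochain1 h" "\<And>s t. s \<in> carrier G \<Longrightarrow> t \<in> carrier G \<Longrightarrow>
      section_cocycle G A X \<sigma> (point2 s t) = coboundary1 h s t \<otimes>\<^bsub>A\<^esub> section_cocycle G A Y \<tau> (point2 s t)"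
    using lcm_class_eq_iff[OF X.section_cocycle_in_cocycles[OF \<sigma>] Y.section_cocycle_in_cocycles[OF \<tau>]] eq
    by auto
  \<comment> \<open>Twisting \<tau> by h multiplies its cocycle by the coboundary of h, which turns
    it into the cocycle of \<sigma>.\<close>
  let ?\<tau> = "\<lambda>s. incl Y (h s) \<otimes>\<^bsub>total Y\<^esub> \<tau> s"
  have \<tau>': "lcm_section G Y ?\<tau>"
    using \<tau> h(1) by (rule Y.lcm_section_twist)
  interpret extension_comparison G A act X Y \<sigma> ?\<tau>
  proof
    fix s t assume "s \<in> carrier G" "t \<in> carrier G"
    then show "X.section_factor \<sigma> s t = Y.section_factor ?\<tau> s t"
      using h(2) Y.section_factor_twist[OF \<tau>' \<tau> cochain1_closed[OF h(1)] refl]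
      by (simp add: X.section_cocycle_point2 Y.section_cocycle_point2)
  qed (fact \<sigma> \<tau>')+
  show ?thesis by (rule isomorphic)
qed

text \<open>An isomorphism fixes A and lies over the identity of G, so it carries a section to a
  section with literally the same cocycle. This shows that the class is an isomorphism invariant,
  and also moves a realised cocycle to an extension on another type.\<close>

lemma isomorphic_section:
  fixes X :: "('a, 'e, 'g) extension" and Y :: "('a, 'f, 'g) extension"
  assumes X: "X \<in> locally_split_extensions G A act" and Y: "Y \<in> locally_split_extensions G A act"
    and iso: "isomorphic_extensions A X Y" and \<sigma>: "lcm_section G X \<sigma>"
  obtains \<tau> where "lcm_section G Y \<tau>" "section_cocycle G A Y \<tau> = section_cocycle G A X \<sigma>"
proof -
  interpret X: split_extension G A act X using X by unfold_locales
  interpret Y: split_extension G A act Y using Y by unfold_locales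
  obtain \<phi> where \<phi>: "\<phi> \<in> iso X.E Y.E" "homeomorphic_map (topo X.E) (topo Y.E) \<phi>"
    "\<And>a. a \<in> carrier A \<Longrightarrow> \<phi> (X.\<iota> a) = Y.\<iota> a" "\<And>e. e \<in> carrier X.E \<Longrightarrow> Y.\<pi> (\<phi> e) = X.\<pi> e"
    using iso by (auto simp: isomorphic_extensions_def)
  have cont: "continuous_map (topo X.E) (topo Y.E) \<phi>"
    using \<phi>(2) by (rule homeomorphic_imp_continuous_map)
  interpret \<phi>: group_hom X.E Y.E \<phi>
    using \<phi>(1) by unfold_locales (simp add: iso_def)
  note [simp] = X.section_closed[OF \<sigma>] X.proj_section[OF \<sigma>]
  have "lcm_section G Y (\<lambda>s. \<phi> (\<sigma> s))"
    unfolding lcm_section_def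
  proof (intro conjI ballI)
    show "(\<lambda>s. \<phi> (\<sigma> s)) \<in> measurable (borel_of (topo G)) (borel_of (topo Y.E))"
      using X.section_measurable[OF \<sigma>] cont by (rule measurable_continuous_compose)
    show "Y.\<pi> (\<phi> (\<sigma> s)) = s" if "s \<in> carrier G" for s
      using that \<phi>(4) by simp
    obtain U where "openin (topo G) U" "\<one> \<in> U" "continuous_map (subtopology (topo G) U) (topo X.E) \<sigma>"
      using \<sigma> by (auto simp: lcm_section_def)
    then show "\<exists>U. openin (topo G) U \<and> \<one> \<in> U \<and>
        continuous_map (subtopology (topo G) U) (topo Y.E) (\<lambda>s. \<phi> (\<sigma> s))"
      using continuous_map_compose'[OF _ cont] by blast
  qed
  moreover have "section_cocycle G A Y (\<lambda>s. \<phi> (\<sigma> s)) = section_cocycle G A X \<sigma>"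
  proof (rule extensionalityI[OF Y.section_cocycle_extensional X.section_cocycle_extensional])
    fix x assume x: "x \<in> topspace (power_top G 2)"
    define s t where "s = x 1" and "t = x 2"
    have st: "s \<in> carrier G" "t \<in> carrier G" "x = point2 s t"
      using G.power_top_point2[OF x] by (simp_all add: s_def t_def)
    let ?a = "X.section_factor \<sigma> s t"
    have a: "?a \<in> carrier A"
      using st X.section_factor_closed[OF \<sigma>] by simp
    have "\<phi> (\<sigma> s) \<otimes>\<^bsub>Y.E\<^esub> \<phi> (\<sigma> t) = Y.\<iota> ?a \<otimes>\<^bsub>Y.E\<^esub> \<phi> (\<sigma> (s \<otimes> t))"
      using st a X.section_mult[OF \<sigma> st(1,2)] by (simp flip: \<phi>.hom_mult \<phi>(3))
    then have "Y.section_factor (\<lambda>s. \<phi> (\<sigma> s)) s t = Y.retract (Y.\<iota> ?a)"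
      unfolding Y.section_factor_def using st a by (simp add: Y.E.m_assoc)
    then show "section_cocycle G A Y (\<lambda>s. \<phi> (\<sigma> s)) x = section_cocycle G A X \<sigma> x"
      using st a by (simp add: X.section_cocycle_point2 Y.section_cocycle_point2)
  qed
  ultimately show ?thesis by (rule that)
qed

end

section \<open>The extension defined by a cocycle\<close>

locale crossed_extension = lcm_module G A act
  for G :: "'g topgroup" (structure) and A :: "'a topgroup" and act :: "'g \<Rightarrow> 'a \<Rightarrow> 'a" +
  fixes f :: "'g \<Rightarrow> 'g \<Rightarrow> 'a"
  assumes f: "cocycle2 f"
begin

lemma f_closed [simp]: "s \<in> carrier G \<Longrightarrow> t \<in> carrier G \<Longrightarrow> f s t \<in> carrier A"
  using f cochain2_closed by (auto simp: cocycle2_def)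

lemma f_cocycle:
  "s \<in> carrier G \<Longrightarrow> t \<in> carrier G \<Longrightarrow> u \<in> carrier G \<Longrightarrow>
    act s (f t u) \<otimes>\<^bsub>A\<^esub> f s (t \<otimes> u) = f s t \<otimes>\<^bsub>A\<^esub> f (s \<otimes> t) u"
  using f by (auto simp: cocycle2_def)

text \<open>
  Since \<open>f\<close> is not normalised, the identity and the inclusion of \<open>A\<close> in the twisted product carry
  the correction \<open>f(1, 1)\<^sup>-\<^sup>1\<close>.
\<close>

definition unit_value :: 'a where "unit_value = f \<one> \<one>"

lemma unit_value_closed [simp]: "unit_value \<in> carrier A"
  by (simp add: unit_value_def)

lemma f_one_left: "t \<in> carrier G \<Longrightarrow> f \<one> t = unit_value"
  using f_cocycle[of "\<one>" "\<one>" t] by (simp add: unit_value_def)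

lemma f_one_right: "s \<in> carrier G \<Longrightarrow> f s \<one> = act s unit_value"
  using f_cocycle[of s "\<one>" "\<one>"] by (simp add: unit_value_def)

definition cross :: "('a \<times> 'g) monoid" where
  "cross = \<lparr>carrier = carrier A \<times> carrier G,
     mult = (\<lambda>p q. (fst p \<otimes>\<^bsub>A\<^esub> act (snd p) (fst q) \<otimes>\<^bsub>A\<^esub> f (snd p) (snd q), snd p \<otimes> snd q)),
     one = (inv\<^bsub>A\<^esub> unit_value, \<one>)\<rparr>"

abbreviation cross_mult (infixl "\<odot>" 70) where
  "p \<odot> q \<equiv> p \<otimes>\<^bsub>cross\<^esub> q"

lemma carrier_cross [simp]: "carrier cross = carrier A \<times> carrier G"
  and one_cross: "\<one>\<^bsub>cross\<^esub> = (inv\<^bsub>A\<^esub> unit_value, \<one>)"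
  and mult_cross: "p \<odot> q =
    (fst p \<otimes>\<^bsub>A\<^esub> act (snd p) (fst q) \<otimes>\<^bsub>A\<^esub> f (snd p) (snd q), snd p \<otimes> snd q)"
  by (simp_all add: cross_def)

text \<open>The solution q of q p = 1. The explicit formula shows that inversion involves
  \<open>f\<close> only at (t^-1, t), which is near (1, 1) for t near 1.\<close>

definition cross_inv :: "'a \<times> 'g \<Rightarrow> 'a \<times> 'g" where
  "cross_inv p = (inv\<^bsub>A\<^esub> unit_value \<otimes>\<^bsub>A\<^esub> inv\<^bsub>A\<^esub> (act (inv (snd p)) (fst p)) \<otimes>\<^bsub>A\<^esub>
     inv\<^bsub>A\<^esub> (f (inv (snd p)) (snd p)), inv (snd p))"

lemma cross_inv_closed: "p \<in> carrier cross \<Longrightarrow> cross_inv p \<in> carrier cross"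
  by (auto simp: cross_inv_def)

lemma cross_inv_left:
  assumes "p \<in> carrier cross"
  shows "cross_inv p \<odot> p = \<one>\<^bsub>cross\<^esub>"
proof -
  obtain b t where p: "p = (b, t)" "b \<in> carrier A" "t \<in> carrier G" using assms by auto
  let ?b = "act (inv t) b" and ?f = "f (inv t) t"
  have "inv\<^bsub>A\<^esub> unit_value \<otimes>\<^bsub>A\<^esub> inv\<^bsub>A\<^esub> ?b \<otimes>\<^bsub>A\<^esub> inv\<^bsub>A\<^esub> ?f \<otimes>\<^bsub>A\<^esub> ?b \<otimes>\<^bsub>A\<^esub> ?f
      = inv\<^bsub>A\<^esub> unit_value \<otimes>\<^bsub>A\<^esub> (inv\<^bsub>A\<^esub> (?b \<otimes>\<^bsub>A\<^esub> ?f) \<otimes>\<^bsub>A\<^esub> (?b \<otimes>\<^bsub>A\<^esub> ?f))"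
    using p by (simp add: A.inv_mult A.m_assoc del: A.l_inv)
  then show ?thesis
    using p by (simp add: cross_inv_def mult_cross one_cross)
qed

lemma group_cross: "group cross"
proof (rule groupI)
  fix p q r assume "p \<in> carrier cross" "q \<in> carrier cross" "r \<in> carrier cross"
  then obtain a s b t d u where p: "p = (a, s)" "a \<in> carrier A" "s \<in> carrier G"
    and q: "q = (b, t)" "b \<in> carrier A" "t \<in> carrier G" and r: "r = (d, u)" "d \<in> carrier A" "u \<in> carrier G"
    by auto
  have "a \<otimes>\<^bsub>A\<^esub> act s (b \<otimes>\<^bsub>A\<^esub> act t d \<otimes>\<^bsub>A\<^esub> f t u) \<otimes>\<^bsub>A\<^esub> f s (t \<otimes> u)
      = a \<otimes>\<^bsub>A\<^esub> act s b \<otimes>\<^bsub>A\<^esub> act s (act t d) \<otimes>\<^bsub>A\<^esub> (act s (f t u) \<otimes>\<^bsub>A\<^esub> f s (t \<otimes> u))"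
    using p q r by (simp add: act_mult A.m_assoc)
  also have "\<dots> = a \<otimes>\<^bsub>A\<^esub> act s b \<otimes>\<^bsub>A\<^esub> f s t \<otimes>\<^bsub>A\<^esub> act (s \<otimes> t) d \<otimes>\<^bsub>A\<^esub> f (s \<otimes> t) u"
    using p q r by (simp add: f_cocycle act_act A.m_ac)
  finally show "p \<odot> q \<odot> r = p \<odot> (q \<odot> r)"
    using p q r by (simp add: mult_cross G.m_assoc)
next
  fix p assume p: "p \<in> carrier cross"
  then show "\<one>\<^bsub>cross\<^esub> \<odot> p = p"
    by (auto simp: mult_cross one_cross f_one_left A.m_ac A.mult_inv_cancel)
  show "\<exists>q\<in>carrier cross. q \<odot> p = \<one>\<^bsub>cross\<^esub>"
    using cross_inv_closed[OF p] cross_inv_left[OF p] by blast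
qed (auto simp: mult_cross one_cross)

end

sublocale crossed_extension \<subseteq> cross: group cross
  by (rule group_cross)

context crossed_extension
begin

lemma inv_cross: "p \<in> carrier cross \<Longrightarrow> inv\<^bsub>cross\<^esub> p = cross_inv p"
  using cross_inv_closed cross_inv_left by (intro cross.inv_equality)

definition cross_incl :: "'a \<Rightarrow> 'a \<times> 'g" where
  "cross_incl a = (a \<otimes>\<^bsub>A\<^esub> inv\<^bsub>A\<^esub> unit_value, \<one>)"

lemma cross_incl_closed: "a \<in> carrier A \<Longrightarrow> cross_incl a \<in> carrier cross"
  by (simp add: cross_incl_def)

text \<open>The correction in \<open>cross_incl\<close> cancels f(1, t) = f(1, 1), so A acts from
  the left by plain translation of the first coordinate, without any twist. This is why the section
  s -> (1, s) returns \<open>f\<close> itself as its cocycle.\<close>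

lemma cross_incl_mult_left:
  "a \<in> carrier A \<Longrightarrow> b \<in> carrier A \<Longrightarrow> t \<in> carrier G \<Longrightarrow>
    cross_incl a \<odot> (b, t) = (a \<otimes>\<^bsub>A\<^esub> b, t)"
  by (simp add: cross_incl_def mult_cross f_one_left A.m_ac A.mult_inv_cancel)

lemma cross_incl_mult:
  "a \<in> carrier A \<Longrightarrow> b \<in> carrier A \<Longrightarrow> cross_incl (a \<otimes>\<^bsub>A\<^esub> b) = cross_incl a \<odot> cross_incl b"
  using cross_incl_mult_left[of a "b \<otimes>\<^bsub>A\<^esub> inv\<^bsub>A\<^esub> unit_value" "\<one>"]
  by (simp add: cross_incl_def A.m_assoc)

lemma cross_incl_mult_right:
  "a \<in> carrier A \<Longrightarrow> b \<in> carrier A \<Longrightarrow> t \<in> carrier G \<Longrightarrow>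
    (b, t) \<odot> cross_incl a = (act t a \<otimes>\<^bsub>A\<^esub> b, t)"
  by (simp add: cross_incl_def mult_cross f_one_right act_mult act_inv A.m_ac A.mult_inv_cancel)

text \<open>The values of \<open>f\<close> cancel in both orders of multiplication and A is
  commutative, so only the G-component of \<open>e\<close> is felt.\<close>

lemma cross_conj_incl:
  assumes "e \<in> carrier cross" "a \<in> carrier A"
  shows "e \<odot> cross_incl a \<odot> inv\<^bsub>cross\<^esub> e = cross_incl (act (snd e) a)"
proof -
  obtain b t where e: "e = (b, t)" "b \<in> carrier A" "t \<in> carrier G" using assms(1) by auto
  have "e \<odot> cross_incl a = cross_incl (act (snd e) a) \<odot> e"
    using e assms(2) by (simp add: cross_incl_mult_right cross_incl_mult_left)
  moreover have "cross_incl (act (snd e) a) \<in> carrier cross"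
    using e assms(2) by (intro cross_incl_closed) simp
  ultimately show ?thesis
    using assms(1) by (simp add: cross.m_assoc del: carrier_cross)
qed

lemma measurable_f:
  assumes "p \<in> measurable M (borel_of (topo G))" "q \<in> measurable M (borel_of (topo G))"
  shows "(\<lambda>x. f (p x) (q x)) \<in> measurable M (borel_of (topo A))"
proof -
  have "(\<lambda>(s, t). f s t) \<in> measurable (borel_of (GG)) (borel_of (topo A))"
    using f by (simp add: cocycle2_def cochain2_def)
  from measurable_compose[OF measurable_borel_of_pair[OF assms second_countable_G second_countable_G] this]
  show ?thesis by simp
qed

text \<open>Far from the identity the twisted product is only known to be Borel for the product
  topology. That is enough to make conjugation coordinates and the canonical section
  measurable.\<close>

lemma measurable_mult_cross:
  assumes "p \<in> measurable M (borel_of (prod_topology (topo A) (topo G)))"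
    and "q \<in> measurable M (borel_of (prod_topology (topo A) (topo G)))"
  shows "(\<lambda>x. p x \<odot> q x) \<in> measurable M (borel_of (prod_topology (topo A) (topo G)))"
proof -
  note components = assms[THEN measurable_continuous_compose, OF continuous_map_fst]
    assms[THEN measurable_continuous_compose, OF continuous_map_snd]
  show ?thesis
    unfolding mult_cross
    by (intro measurable_borel_of_pair second_countable_A second_countable_G measurable_mult_A
        measurable_mult_G measurable_act measurable_f components)
qed

text \<open>Continuity of the \<open>f\<close> term is isolated as a hypothesis; it is available as
  soon as both of its arguments stay in the neighbourhood where \<open>f\<close> is
  continuous.\<close>

lemma continuous_map_mult_cross:
  assumes p: "continuous_map Z (prod_topology (topo A) (topo G)) p"
    and q: "continuous_map Z (prod_topology (topo A) (topo G)) q"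
    and "continuous_map Z (topo A) (\<lambda>z. f (snd (p z)) (snd (q z)))"
  shows "continuous_map Z (prod_topology (topo A) (topo G)) (\<lambda>z. p z \<odot> q z)"
  unfolding mult_cross
  by (intro continuous_map_pairedI A.continuous_map_mult G.continuous_map_mult continuous_map_act
      continuous_map_compose'[OF p continuous_map_fst] continuous_map_compose'[OF p continuous_map_snd]
      continuous_map_compose'[OF q continuous_map_fst] continuous_map_compose'[OF q continuous_map_snd]
      assms(3))

end

text \<open>\<open>f\<close> is continuous on V x V. Closure of \<open>U\<close> under inverses
  keeps the arguments (t^-1, t) of inversion inside V x V, and U U^-1 in \<open>V\<close> puts into
  \<open>V\<close> the G-component of any element that moves some point of the chart into the
  chart.\<close>

locale crossed_chart = crossed_extension G A act f
  for G :: "'g topgroup" (structure) and A :: "'a topgroup" and act :: "'g \<Rightarrow> 'a \<Rightarrow> 'a" and f :: "'g \<Rightarrow> 'g \<Rightarrow> 'a" +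
  fixes V U :: "'g set"
  assumes V: "openin (topo G) V"
    and f_cont: "continuous_map (subtopology (GG) (V \<times> V)) (topo A)
      (\<lambda>(s, t). f s t)"
    and U: "openin (topo G) U" "\<one> \<in> U" "U \<subseteq> V"
    and U_inv: "\<And>u. u \<in> U \<Longrightarrow> inv u \<in> U"
    and U_quot: "\<And>u v. u \<in> U \<Longrightarrow> v \<in> U \<Longrightarrow> u \<otimes> inv v \<in> V"
begin

section \<open>The product neighbourhood and its local group operations\<close>

abbreviation AG :: "('a \<times> 'g) topology" where
  "AG \<equiv> prod_topology (topo A) (topo G)"

definition chart :: "('a \<times> 'g) topology" where
  "chart = subtopology AG (carrier A \<times> U)"

lemma U_carrier: "U \<subseteq> carrier G"
  using U(1) by (rule G.openin_carrier)

lemma topspace_chart: "topspace chart = carrier A \<times> U"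
  using U_carrier by (auto simp: chart_def)

lemma openin_AU: "openin AG (carrier A \<times> U)"
  using U(1) openin_topspace[of "topo A"] by (simp add: openin_prod_Times_iff)

lemma openin_chart_imp: "openin chart W \<Longrightarrow> openin AG W"
  unfolding chart_def by (rule openin_trans_full[OF _ openin_AU])

lemma continuous_map_chart_id: "continuous_map chart AG (\<lambda>x. x)"
  unfolding chart_def by (intro continuous_map_from_subtopology continuous_map_ident)

lemma continuous_map_f:
  assumes "continuous_map Z (topo G) p" "continuous_map Z (topo G) q"
    and "\<And>z. z \<in> topspace Z \<Longrightarrow> p z \<in> V \<and> q z \<in> V"
  shows "continuous_map Z (topo A) (\<lambda>z. f (p z) (q z))"
proof -
  have "continuous_map Z (subtopology (GG) (V \<times> V)) (\<lambda>z. (p z, q z))"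
    using assms by (intro continuous_map_into_subtopology continuous_map_pairedI) auto
  from continuous_map_compose'[OF this f_cont] show ?thesis by simp
qed

text \<open>Translations and conjugations are continuous on the chart only over an open part
  \<open>S\<close> of the base; since the strip over \<open>S\<close> is open, preimages taken
  inside it are open in the whole chart.\<close>

lemma openin_preimage_chart:
  assumes S: "openin (topo G) S" and W: "openin AG W"
    and cont: "continuous_map (subtopology chart (carrier A \<times> S)) AG \<kappa>"
  shows "openin chart {x \<in> topspace chart. snd x \<in> S \<and> \<kappa> x \<in> W}"
proof -
  let ?S = "carrier A \<times> S"
  have "openin AG ?S"
    using S openin_topspace[of "topo A"] by (simp add: openin_prod_Times_iff)
  then have S': "openin chart (?S \<inter> (carrier A \<times> U))"
    unfolding chart_def by (rule openin_subtopology_Int)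
  have "openin (subtopology chart ?S) {x \<in> topspace (subtopology chart ?S). \<kappa> x \<in> W}"
    using cont W by (rule openin_continuous_map_preimage)
  also have "subtopology chart ?S = subtopology chart (?S \<inter> (carrier A \<times> U))"
    unfolding chart_def subtopology_subtopology by (simp add: Int_ac)
  finally have "openin chart {x \<in> topspace (subtopology chart (?S \<inter> (carrier A \<times> U))). \<kappa> x \<in> W}"
    using S' by (rule openin_trans_full)
  moreover have "{x \<in> topspace (subtopology chart (?S \<inter> (carrier A \<times> U))). \<kappa> x \<in> W} =
      {x \<in> topspace chart. snd x \<in> S \<and> \<kappa> x \<in> W}"
    by (auto simp: topspace_chart)
  ultimately show ?thesis by simp
qed

lemma chart_translate:
  assumes e: "e \<in> carrier cross" and W: "openin chart W"
  shows "openin chart {x \<in> topspace chart. e \<odot> x \<in> W}"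
proof -
  let ?S = "{t \<in> carrier G. snd e \<otimes> t \<in> U}"
  let ?Z = "subtopology chart (carrier A \<times> ?S)"
  have g: "snd e \<in> carrier G" using e by auto
  have S: "openin (topo G) ?S"
    using g U(1) by (rule G.openin_l_translate)
  have id: "continuous_map ?Z AG (\<lambda>x. x)"
    by (intro continuous_map_from_subtopology continuous_map_chart_id)
  \<comment> \<open>The G-component of \<open>e\<close> is a quotient of two elements of
    \<open>U\<close>. If no point of the chart is moved into the chart, the strip is empty and
    continuity on it holds vacuously.\<close>
  have "snd e \<in> V" if "z \<in> topspace ?Z" for z
  proof -
    have z: "snd z \<in> U" "snd e \<otimes> snd z \<in> U"
      using that by (auto simp: topspace_chart)
    then have "snd e \<otimes> snd z \<otimes> inv (snd z) \<in> V"
      using U_quot by blast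
    then show ?thesis
      using g z U_carrier by (auto simp: G.m_assoc subset_iff)
  qed
  then have "continuous_map ?Z (topo A) (\<lambda>z. f (snd e) (snd z))"
    using g U(3) by (intro continuous_map_f G.continuous_map_const_carrier
        continuous_map_compose'[OF id continuous_map_snd]) (auto simp: topspace_chart)
  then have "continuous_map ?Z AG (\<lambda>x. e \<odot> x)"
    using e by (intro continuous_map_mult_cross id) auto
  with S openin_chart_imp[OF W]
  have "openin chart {x \<in> topspace chart. snd x \<in> ?S \<and> e \<odot> x \<in> W}"
    by (rule openin_preimage_chart)
  moreover have "snd x \<in> ?S" if "x \<in> topspace chart" "e \<odot> x \<in> W" for x
  proof -
    have "e \<odot> x \<in> topspace chart"
      using that(2) openin_subset[OF W] by blast
    then show ?thesis
      using that(1) U_carrier by (auto simp: topspace_chart mult_cross)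
  qed
  then have "{x \<in> topspace chart. snd x \<in> ?S \<and> e \<odot> x \<in> W} = {x \<in> topspace chart. e \<odot> x \<in> W}"
    by blast
  ultimately show ?thesis by simp
qed

lemma chart_mult_nbhd:
  assumes W: "openin chart W" "\<one>\<^bsub>cross\<^esub> \<in> W"
  shows "\<exists>V. openin chart V \<and> \<one>\<^bsub>cross\<^esub> \<in> V \<and> (\<forall>x\<in>V. \<forall>y\<in>V. x \<odot> y \<in> W)"
proof -
  let ?Z = "prod_topology chart chart"
  have p: "continuous_map ?Z AG fst" and q: "continuous_map ?Z AG snd"
    using continuous_map_compose'[OF continuous_map_fst continuous_map_chart_id]
      continuous_map_compose'[OF continuous_map_snd continuous_map_chart_id] by auto
  have "continuous_map ?Z (topo A) (\<lambda>z. f (snd (fst z)) (snd (snd z)))"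
    using U(3) by (intro continuous_map_f continuous_map_compose'[OF p continuous_map_snd]
        continuous_map_compose'[OF q continuous_map_snd]) (auto simp: topspace_chart)
  then have "continuous_map ?Z AG (\<lambda>z. fst z \<odot> snd z)"
    by (intro continuous_map_mult_cross p q)
  then have *: "openin ?Z {z \<in> topspace ?Z. fst z \<odot> snd z \<in> W}"
    using openin_chart_imp[OF W(1)] by (rule openin_continuous_map_preimage)
  have "\<one>\<^bsub>cross\<^esub> \<in> topspace chart"
    using W openin_subset by fastforce
  then have **: "(\<one>\<^bsub>cross\<^esub>, \<one>\<^bsub>cross\<^esub>) \<in> {z \<in> topspace ?Z. fst z \<odot> snd z \<in> W}"
    using W(2) by (simp del: carrier_cross)
  obtain V1 V2 where V12: "openin chart V1" "openin chart V2" "\<one>\<^bsub>cross\<^esub> \<in> V1" "\<one>\<^bsub>cross\<^esub> \<in> V2"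
      "V1 \<times> V2 \<subseteq> {z \<in> topspace ?Z. fst z \<odot> snd z \<in> W}"
    using openin_prod_topologyE[OF * **] .
  then show ?thesis
    by (intro exI[of _ "V1 \<inter> V2"]) auto
qed

lemma chart_inv_nbhd:
  assumes W: "openin chart W" "\<one>\<^bsub>cross\<^esub> \<in> W"
  shows "\<exists>V. openin chart V \<and> \<one>\<^bsub>cross\<^esub> \<in> V \<and> (\<forall>x\<in>V. inv\<^bsub>cross\<^esub> x \<in> W)"
proof -
  have fst: "continuous_map chart (topo A) fst" and snd: "continuous_map chart (topo G) snd"
    using continuous_map_compose'[OF continuous_map_chart_id continuous_map_fst]
      continuous_map_compose'[OF continuous_map_chart_id continuous_map_snd] by auto
  have "continuous_map chart (topo A) (\<lambda>z. f (inv (snd z)) (snd z))"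
    using U(3) U_inv by (intro continuous_map_f G.continuous_map_inv snd) (auto simp: topspace_chart)
  then have "continuous_map chart AG cross_inv"
    unfolding cross_inv_def
    by (intro continuous_map_pairedI A.continuous_map_mult A.continuous_map_inv G.continuous_map_inv
        continuous_map_act fst snd A.continuous_map_const_carrier) auto
  then have "openin chart {x \<in> topspace chart. cross_inv x \<in> W}"
    using openin_chart_imp[OF W(1)] by (rule openin_continuous_map_preimage)
  moreover have inv: "inv\<^bsub>cross\<^esub> x = cross_inv x" if "x \<in> topspace chart" for x
    using that U_carrier by (intro inv_cross) (auto simp: topspace_chart)
  moreover have "\<one>\<^bsub>cross\<^esub> \<in> topspace chart"
    using W openin_subset by fastforce
  moreover then have "cross_inv \<one>\<^bsub>cross\<^esub> \<in> W"
    using W(2) inv[of "\<one>\<^bsub>cross\<^esub>"] by simp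
  ultimately show ?thesis
    by (intro exI[of _ "{x \<in> topspace chart. cross_inv x \<in> W}"]) auto
qed

text \<open>
  For fixed \<open>e\<close> this evaluates \<open>f\<close> far from the identity, where \<open>f\<close> is only measurable.
\<close>

definition conj_coord :: "'a \<times> 'g \<Rightarrow> 'g \<Rightarrow> 'a" where
  "conj_coord e t = fst (e \<odot> (\<one>\<^bsub>A\<^esub>, t) \<odot> inv\<^bsub>cross\<^esub> e)"

text \<open>Splitting (b, t) as the image of b times (1, t) separates two effects: conjugation of
  the first factor is the given action, which is continuous, and all irregularity is concentrated in
  a function of t alone.\<close>

lemma conj_cross:
  assumes e: "e \<in> carrier cross" and b: "b \<in> carrier A" and t: "t \<in> carrier G"
  shows "e \<odot> (b, t) \<odot> inv\<^bsub>cross\<^esub> e =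
    (act (snd e) b \<otimes>\<^bsub>A\<^esub> conj_coord e t, snd e \<otimes> t \<otimes> inv (snd e))"
    and conj_coord_closed: "conj_coord e t \<in> carrier A"
proof -
  let ?t = "(\<one>\<^bsub>A\<^esub>, t)" and ?e' = "inv\<^bsub>cross\<^esub> e"
  have t': "?t \<in> carrier cross" using t by simp
  have e': "?e' \<in> carrier cross" using e by (rule cross.inv_closed)
  have bi: "cross_incl b \<in> carrier cross" using b by (rule cross_incl_closed)
  have "snd ?e' = inv (snd e)"
    using e by (simp add: inv_cross cross_inv_def)
  then have snd: "snd (e \<odot> ?t \<odot> ?e') = snd e \<otimes> t \<otimes> inv (snd e)"
    by (simp add: mult_cross)
  have conj: "e \<odot> ?t \<odot> ?e' = (conj_coord e t, snd e \<otimes> t \<otimes> inv (snd e))"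
    by (rule prod_eqI) (simp_all add: conj_coord_def snd)
  have "e \<odot> ?t \<odot> ?e' \<in> carrier cross"
    using e t' e' by (intro cross.m_closed)
  then show closed: "conj_coord e t \<in> carrier A"
    unfolding conj by simp
  have "(b, t) = cross_incl b \<odot> ?t"
    using b t by (simp add: cross_incl_mult_left)
  then have "e \<odot> (b, t) \<odot> ?e' =
      (e \<odot> cross_incl b \<odot> ?e') \<odot> (e \<odot> ?t \<odot> ?e')"
    using e t' e' bi by (simp add: cross.m_assoc cross.mult_inv_cancel del: carrier_cross)
  also have "\<dots> = cross_incl (act (snd e) b) \<odot> (conj_coord e t, snd e \<otimes> t \<otimes> inv (snd e))"
    using e b by (simp only: cross_conj_incl conj)
  also have "\<dots> = (act (snd e) b \<otimes>\<^bsub>A\<^esub> conj_coord e t, snd e \<otimes> t \<otimes> inv (snd e))"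
    using e b t closed by (intro cross_incl_mult_left) auto
  finally show "e \<odot> (b, t) \<odot> ?e' =
    (act (snd e) b \<otimes>\<^bsub>A\<^esub> conj_coord e t, snd e \<otimes> t \<otimes> inv (snd e))" .
qed

text \<open>Conjugation is multiplicative; applying it to (1, x)(1, t) = (f(x, t), xt) and comparing
  first coordinates gives the crossed relation. It is solved for the quotient because, for fixed t,
  the coordinate at t on the right is a constant and everything else is continuous in x near
  1.\<close>

lemma conj_coord_mult:
  assumes e: "e \<in> carrier cross" and x: "x \<in> carrier G" and t: "t \<in> carrier G"
  defines "\<theta> \<equiv> \<lambda>t. snd e \<otimes> t \<otimes> inv (snd e)"
  shows "inv\<^bsub>A\<^esub> (conj_coord e (x \<otimes> t)) \<otimes>\<^bsub>A\<^esub> conj_coord e x =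
    act (snd e) (f x t) \<otimes>\<^bsub>A\<^esub> inv\<^bsub>A\<^esub> (act (\<theta> x) (conj_coord e t) \<otimes>\<^bsub>A\<^esub> f (\<theta> x) (\<theta> t))"
proof -
  let ?c = "\<lambda>p. e \<odot> p \<odot> inv\<^bsub>cross\<^esub> e"
  let ?x = "(\<one>\<^bsub>A\<^esub>, x)" and ?t = "(\<one>\<^bsub>A\<^esub>, t)"
  have g: "snd e \<in> carrier G" using e by auto
  have \<theta>: "\<theta> x \<in> carrier G" "\<theta> t \<in> carrier G"
    using g x t by (simp_all add: \<theta>_def)
  have k [simp]: "conj_coord e s \<in> carrier A" if "s \<in> carrier G" for s
    using conj_coord_closed[OF e A.one_closed that] .
  have xt: "?x \<in> carrier cross" "?t \<in> carrier cross"
    using x t by simp_all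
  have "?c (?x \<odot> ?t) = ?c ?x \<odot> ?c ?t"
    using e xt by (simp add: cross.m_assoc cross.mult_inv_cancel del: carrier_cross)
  moreover have "?x \<odot> ?t = (f x t, x \<otimes> t)"
    using x t by (simp add: mult_cross)
  moreover have "?c ?x = (conj_coord e x, \<theta> x)" "?c ?t = (conj_coord e t, \<theta> t)"
    using conj_cross[OF e A.one_closed x] conj_cross[OF e A.one_closed t] g x t by (simp_all add: \<theta>_def)
  moreover have "fst (?c (f x t, x \<otimes> t)) = act (snd e) (f x t) \<otimes>\<^bsub>A\<^esub> conj_coord e (x \<otimes> t)"
    using conj_cross[OF e, of "f x t" "x \<otimes> t"] x t by simp
  ultimately have "act (snd e) (f x t) \<otimes>\<^bsub>A\<^esub> conj_coord e (x \<otimes> t) =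
      fst ((conj_coord e x, \<theta> x) \<odot> (conj_coord e t, \<theta> t))"
    by metis
  then have eq: "act (snd e) (f x t) \<otimes>\<^bsub>A\<^esub> conj_coord e (x \<otimes> t) =
      conj_coord e x \<otimes>\<^bsub>A\<^esub> (act (\<theta> x) (conj_coord e t) \<otimes>\<^bsub>A\<^esub> f (\<theta> x) (\<theta> t))"
    using x t \<theta> by (simp add: mult_cross A.m_assoc)
  have quotient: "inv\<^bsub>A\<^esub> d \<otimes>\<^bsub>A\<^esub> b = a \<otimes>\<^bsub>A\<^esub> inv\<^bsub>A\<^esub> w"
    if "a \<otimes>\<^bsub>A\<^esub> d = b \<otimes>\<^bsub>A\<^esub> w" "a \<in> carrier A" "b \<in> carrier A" "d \<in> carrier A" "w \<in> carrier A" for a b d w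
  proof -
    have "b = a \<otimes>\<^bsub>A\<^esub> d \<otimes>\<^bsub>A\<^esub> inv\<^bsub>A\<^esub> w"
      unfolding that(1) using that(2-) by (simp add: A.m_assoc)
    then show ?thesis
      using that(2-) by (simp add: A.m_ac A.mult_inv_cancel)
  qed
  show ?thesis
    using quotient[OF eq] g x t \<theta> by simp
qed

text \<open>For x and t in \<open>W\<close>, both f(x, t) and the value of \<open>f\<close> at the
  conjugated arguments are taken in V x V. The same \<open>W\<close> serves as the range of x and as
  the source of t in the Baire argument; the product xt may leave \<open>W\<close>, since there only
  measurability of the coordinate is used.\<close>

lemma continuous_map_conj_coord:
  assumes e: "e \<in> carrier cross"
  defines "W \<equiv> {t \<in> carrier G. t \<in> V \<and> snd e \<otimes> t \<otimes> inv (snd e) \<in> V}"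
  shows "openin (topo G) W" and "\<one> \<in> W"
    and "continuous_map (subtopology (topo G) W) (topo A) (conj_coord e)"
proof -
  let ?\<theta> = "\<lambda>t. snd e \<otimes> t \<otimes> inv (snd e)"
  have g: "snd e \<in> carrier G" using e by auto
  have k: "conj_coord e s \<in> carrier A" if "s \<in> carrier G" for s
    using conj_coord_closed[OF e A.one_closed that] .
  have \<theta>: "continuous_map (topo G) (topo G) ?\<theta>"
    using g by (intro G.continuous_map_mult G.continuous_map_const_carrier continuous_map_ident)
      auto
  have "openin (topo G) (V \<inter> {t \<in> topspace (topo G). ?\<theta> t \<in> V})"
    using V openin_continuous_map_preimage[OF \<theta> V] by (rule openin_Int)
  moreover have "V \<inter> {t \<in> topspace (topo G). ?\<theta> t \<in> V} = W"
    by (auto simp: W_def)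
  ultimately show open_W: "openin (topo G) W" by simp
  show one_W: "\<one> \<in> W"
    using U g by (auto simp: W_def)
  show "continuous_map (subtopology (topo G) W) (topo A) (conj_coord e)"
  proof (rule G.borel_continuous_if_differences_continuous[OF _ _ _ A.topological second_countable_A _ _ open_W])
    show "locally_compact_space (topo G)" "Hausdorff_space (topo G)"
      using lcsc_G by (simp_all add: lcsc_group_def)
    show "first_countable (topo G)"
      using second_countable_G by (rule second_countable_imp_first_countable)
    show "W \<subseteq> carrier G" by (auto simp: W_def)
    show "W \<noteq> {}" using one_W by blast
    have "(\<lambda>t. (\<one>\<^bsub>A\<^esub>, t)) \<in> measurable (borel_of (topo G)) (borel_of AG)"
      by (intro continuous_imp_borel_measurable continuous_map_pairedI A.continuous_map_const_carrier
          continuous_map_ident) simp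
    then have "(\<lambda>t. e \<odot> (\<one>\<^bsub>A\<^esub>, t) \<odot> inv\<^bsub>cross\<^esub> e) \<in> measurable (borel_of (topo G)) (borel_of AG)"
      using e cross.inv_closed[OF e] by (intro measurable_mult_cross) auto
    from measurable_continuous_compose[OF this continuous_map_fst]
    show "conj_coord e \<in> measurable (borel_of (topo G)) (borel_of (topo A))"
      unfolding conj_coord_def .
    fix t assume t: "t \<in> W"
    then have tG: "t \<in> carrier G" "t \<in> V" "?\<theta> t \<in> V" by (auto simp: W_def)
    let ?Z = "subtopology (topo G) W"
    have id: "continuous_map ?Z (topo G) (\<lambda>x. x)"
      by (intro continuous_map_from_subtopology continuous_map_ident)
    have \<theta>': "continuous_map ?Z (topo G) ?\<theta>"
      using \<theta> by (rule continuous_map_from_subtopology)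
    have f1: "continuous_map ?Z (topo A) (\<lambda>x. f x t)"
      using tG by (intro continuous_map_f id G.continuous_map_const_carrier) (auto simp: W_def)
    have f2: "continuous_map ?Z (topo A) (\<lambda>x. f (?\<theta> x) (?\<theta> t))"
      using tG g by (intro continuous_map_f \<theta>' G.continuous_map_const_carrier) (auto simp: W_def)
    have "continuous_map ?Z (topo A) (\<lambda>x. act (snd e) (f x t) \<otimes>\<^bsub>A\<^esub>
        inv\<^bsub>A\<^esub> (act (?\<theta> x) (conj_coord e t) \<otimes>\<^bsub>A\<^esub> f (?\<theta> x) (?\<theta> t)))"
      using g k[OF tG(1)]
      by (intro A.continuous_map_mult A.continuous_map_inv continuous_map_act f1 f2 \<theta>'
          G.continuous_map_const_carrier A.continuous_map_const_carrier)
    then show "continuous_map ?Z (topo A) (\<lambda>x. inv\<^bsub>A\<^esub> (conj_coord e (x \<otimes> t)) \<otimes>\<^bsub>A\<^esub> conj_coord e x)"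
      by (rule continuous_map_eq) (simp add: conj_coord_mult[OF e _ tG(1)])
  qed
qed

lemma chart_conj_nbhd:
  assumes e: "e \<in> carrier cross" and W: "openin chart W" "\<one>\<^bsub>cross\<^esub> \<in> W"
  shows "\<exists>V. openin chart V \<and> \<one>\<^bsub>cross\<^esub> \<in> V \<and> (\<forall>x\<in>V. e \<odot> x \<odot> inv\<^bsub>cross\<^esub> e \<in> W)"
proof -
  let ?S = "{t \<in> carrier G. t \<in> V \<and> snd e \<otimes> t \<otimes> inv (snd e) \<in> V}"
  note S = continuous_map_conj_coord[OF e]
  have g: "snd e \<in> carrier G" using e by auto
  let ?Z = "subtopology chart (carrier A \<times> ?S)"
  have fst: "continuous_map ?Z (topo A) fst" and snd: "continuous_map ?Z (topo G) snd"
    using continuous_map_compose'[OF continuous_map_chart_id continuous_map_fst]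
      continuous_map_compose'[OF continuous_map_chart_id continuous_map_snd]
    by (auto intro: continuous_map_from_subtopology)
  have "continuous_map ?Z (subtopology (topo G) ?S) snd"
    using snd by (rule continuous_map_into_subtopology) auto
  from continuous_map_compose'[OF this S(3)]
  have k: "continuous_map ?Z (topo A) (\<lambda>x. conj_coord e (snd x))" .
  have "continuous_map ?Z AG (\<lambda>x. (act (snd e) (fst x) \<otimes>\<^bsub>A\<^esub> conj_coord e (snd x),
      snd e \<otimes> snd x \<otimes> inv (snd e)))"
    using g by (intro continuous_map_pairedI A.continuous_map_mult G.continuous_map_mult continuous_map_act
        fst snd k G.continuous_map_const_carrier G.inv_closed)
  then have "continuous_map ?Z AG (\<lambda>x. e \<odot> x \<odot> inv\<^bsub>cross\<^esub> e)"
    by (rule continuous_map_eq) (auto simp: topspace_chart conj_cross[OF e])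
  with S(1) openin_chart_imp[OF W(1)]
  have "openin chart {x \<in> topspace chart. snd x \<in> ?S \<and> e \<odot> x \<odot> inv\<^bsub>cross\<^esub> e \<in> W}"
    by (rule openin_preimage_chart)
  moreover have "\<one>\<^bsub>cross\<^esub> \<in> {x \<in> topspace chart. snd x \<in> ?S \<and> e \<odot> x \<odot> inv\<^bsub>cross\<^esub> e \<in> W}"
  proof -
    have "\<one>\<^bsub>cross\<^esub> \<in> topspace chart"
      using U(2) by (simp add: topspace_chart one_cross)
    moreover have "snd \<one>\<^bsub>cross\<^esub> \<in> ?S"
      using S(2) by (simp only: one_cross snd_conv)
    moreover have "e \<odot> \<one>\<^bsub>cross\<^esub> \<odot> inv\<^bsub>cross\<^esub> e \<in> W"
      using e W(2) by (simp del: carrier_cross)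
    ultimately show ?thesis by blast
  qed
  ultimately show ?thesis
    by (intro exI[of _ "{x \<in> topspace chart. snd x \<in> ?S \<and> e \<odot> x \<odot> inv\<^bsub>cross\<^esub> e \<in> W}"]) simp
qed

end

sublocale crossed_chart \<subseteq> group_chart cross chart
proof
  show "topspace chart \<subseteq> carrier cross" "\<one>\<^bsub>cross\<^esub> \<in> topspace chart"
    using U_carrier U(2) by (auto simp: topspace_chart one_cross)
qed (fact chart_translate chart_mult_nbhd chart_inv_nbhd chart_conj_nbhd)+

context crossed_chart
begin

end

section \<open>The twisted product as a locally split extension\<close>

context crossed_chart
begin

definition cross_extension :: "('a, 'a \<times> 'g, 'g) extension" where
  "cross_extension =
     \<lparr>total = \<lparr>carrier = carrier cross, mult = mult cross, one = one cross, topo = group_topology\<rparr>,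
      incl = cross_incl, proj = snd\<rparr>"

lemma cross_extension_simps:
  "carrier (total cross_extension) = carrier cross" "mult (total cross_extension) = mult cross"
  "one (total cross_extension) = one cross" "topo (total cross_extension) = group_topology"
  "incl cross_extension = cross_incl" "proj cross_extension = snd"
  "inv\<^bsub>total cross_extension\<^esub> p = inv\<^bsub>cross\<^esub> p"
  by (simp_all add: cross_extension_def m_inv_def)

lemma continuous_map_into_chart:
  assumes "continuous_map Z AG p" and "\<And>z. z \<in> topspace Z \<Longrightarrow> p z \<in> carrier A \<times> U"
  shows "continuous_map Z group_topology p"
proof -
  have "continuous_map Z (subtopology AG (carrier A \<times> U)) p"
    using assms by (intro continuous_map_into_subtopology) auto
  then have "continuous_map Z (subtopology group_topology (topspace chart)) p"
    unfolding subtopology_group_topology chart_def[symmetric] .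
  then show ?thesis
    by (rule continuous_map_into_fulltopology)
qed

lemma continuous_map_cross_incl: "continuous_map (topo A) group_topology cross_incl"
  unfolding cross_incl_def
  by (intro continuous_map_into_chart continuous_map_pairedI A.continuous_map_mult
      A.continuous_map_const_carrier G.continuous_map_const_carrier continuous_map_ident)
    (use U(2) in auto)

text \<open>Closedness is checked in each translated chart. Around e = (a, g), the image of C is the
  trace of a closed rectangle \<open>?B \<times> {inv g}\<close>; the Hausdorff axiom for G makes
  the point closed.\<close>

lemma closed_map_cross_incl: "closed_map (topo A) group_topology cross_incl"
  unfolding closed_map_def
proof (intro allI impI)
  fix C assume C: "closedin (topo A) C"
  then have C_A: "C \<subseteq> carrier A" using closedin_subset by fastforce
  have "openin group_topology (carrier cross - cross_incl ` C)"
    unfolding openin_group_topology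
  proof (intro conjI ballI)
    fix e assume e: "e \<in> carrier cross"
    then obtain a g where ag: "e = (a, g)" "a \<in> carrier A" "g \<in> carrier G" by auto
    \<comment> \<open>\<open>?m b\<close> is the element of A whose image is the product of
      \<open>e\<close> with (b, g^-1); the last factor undoes the correction in
      \<open>cross_incl\<close>. The value f(g, g^-1) is a constant here, so \<open>?m\<close> is
      continuous for every g.\<close>
    let ?m = "\<lambda>b. a \<otimes>\<^bsub>A\<^esub> act g b \<otimes>\<^bsub>A\<^esub> f g (inv g) \<otimes>\<^bsub>A\<^esub> unit_value"
    let ?B = "{b \<in> topspace (topo A). ?m b \<in> C}"
    have "continuous_map (topo A) (topo A) ?m"
      using ag by (intro A.continuous_map_mult continuous_map_act A.continuous_map_const_carrier
          G.continuous_map_const_carrier continuous_map_ident) auto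
    then have "closedin (topo A) ?B"
      using C by (rule closedin_continuous_map_preimage)
    moreover have "closedin (topo G) {inv g}"
      using lcsc_G ag by (simp add: lcsc_group_def closedin_Hausdorff_singleton)
    ultimately have "closedin AG (?B \<times> {inv g})"
      by (simp add: closedin_prod_Times_iff)
    then have "closedin chart ((carrier A \<times> U) \<inter> (?B \<times> {inv g}))"
      unfolding chart_def by (rule closedin_subtopology_Int_closed)
    then have "openin chart (topspace chart - (carrier A \<times> U) \<inter> (?B \<times> {inv g}))"
      by (intro openin_diff openin_topspace)
    moreover have "e \<odot> (b, t) \<in> cross_incl ` C \<longleftrightarrow> ?m b \<in> C \<and> t = inv g"
      if bt: "b \<in> carrier A" "t \<in> carrier G" for b t
    proof
      assume "e \<odot> (b, t) \<in> cross_incl ` C"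
      then obtain d where d: "d \<in> C" "a \<otimes>\<^bsub>A\<^esub> act g b \<otimes>\<^bsub>A\<^esub> f g t = d \<otimes>\<^bsub>A\<^esub> inv\<^bsub>A\<^esub> unit_value"
          "g \<otimes> t = \<one>"
        by (auto simp: cross_incl_def mult_cross ag(1))
      then have t: "t = inv g"
        using ag bt by (metis G.inv_comm G.inv_equality)
      have "?m b = d \<otimes>\<^bsub>A\<^esub> inv\<^bsub>A\<^esub> unit_value \<otimes>\<^bsub>A\<^esub> unit_value"
        using d(2) unfolding t by simp
      also have "\<dots> = d"
        using d(1) C_A by (auto simp: A.m_assoc)
      finally show "?m b \<in> C \<and> t = inv g"
        using d(1) t by simp
    next
      assume m: "?m b \<in> C \<and> t = inv g"
      have "e \<odot> (b, t) = cross_incl (?m b)"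
        using m ag bt by (simp add: cross_incl_def mult_cross A.m_assoc)
      then show "e \<odot> (b, t) \<in> cross_incl ` C"
        using m by blast
    qed
    then have mem: "e \<odot> (b, t) \<in> carrier cross - cross_incl ` C \<longleftrightarrow> \<not> (?m b \<in> C \<and> t = inv g)"
      if "b \<in> carrier A" "t \<in> carrier G" for b t
      using that cross.m_closed[OF e, of "(b, t)"] by simp
    have "{x \<in> topspace chart. e \<odot> x \<in> carrier cross - cross_incl ` C} =
        topspace chart - (carrier A \<times> U) \<inter> (?B \<times> {inv g})"
    proof (rule Set.set_eqI)
      fix x :: "'a \<times> 'g"
      obtain b t where x: "x = (b, t)" by fastforce
      show "x \<in> {x \<in> topspace chart. e \<odot> x \<in> carrier cross - cross_incl ` C} \<longleftrightarrow>
          x \<in> topspace chart - (carrier A \<times> U) \<inter> (?B \<times> {inv g})"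
      proof (cases "x \<in> topspace chart")
        case True
        then have bt: "b \<in> carrier A" "t \<in> U" "t \<in> carrier G"
          using U_carrier by (auto simp: topspace_chart x)
        have "x \<in> {x \<in> topspace chart. e \<odot> x \<in> carrier cross - cross_incl ` C} \<longleftrightarrow>
            \<not> (?m b \<in> C \<and> t = inv g)"
          using True mem[OF bt(1,3)] unfolding x by simp
        also have "\<dots> \<longleftrightarrow> x \<in> topspace chart - (carrier A \<times> U) \<inter> (?B \<times> {inv g})"
          using True bt unfolding x by auto
        finally show ?thesis .
      qed simp
    qed
    ultimately show "openin chart {x \<in> topspace chart. e \<odot> x \<in> carrier cross - cross_incl ` C}"
      by simp
  qed auto
  moreover have "cross_incl ` C \<subseteq> carrier cross"
    using C_A cross_incl_closed by blast
  ultimately show "closedin group_topology (cross_incl ` C)"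
    by (simp add: closedin_def topspace_group_topology)
qed

lemma continuous_map_cross_proj: "continuous_map group_topology (topo G) snd"
  unfolding continuous_map_def
proof (intro conjI allI impI)
  fix S assume S: "openin (topo G) S"
  show "openin group_topology {p \<in> topspace group_topology. snd p \<in> S}"
    unfolding openin_group_topology topspace_group_topology
  proof (intro conjI ballI)
    fix e assume e: "e \<in> carrier cross"
    then have g: "snd e \<in> carrier G" by auto
    have "continuous_map chart (topo G) (\<lambda>x. snd e \<otimes> snd x)"
      using g by (intro G.continuous_map_mult G.continuous_map_const_carrier
          continuous_map_compose'[OF continuous_map_chart_id continuous_map_snd])
    then have "openin chart {x \<in> topspace chart. snd e \<otimes> snd x \<in> S}"
      using S by (rule openin_continuous_map_preimage)
    moreover have "e \<odot> x \<in> carrier cross" if "x \<in> topspace chart" for x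
      using that chart_carrier e by (intro cross.m_closed) auto
    then have "{x \<in> topspace chart. snd e \<otimes> snd x \<in> S} =
        {x \<in> topspace chart. e \<odot> x \<in> {p \<in> carrier cross. snd p \<in> S}}"
      by (auto simp: mult_cross)
    ultimately show "openin chart {x \<in> topspace chart. e \<odot> x \<in> {p \<in> carrier cross. snd p \<in> S}}"
      by simp
  qed auto
qed (auto simp: topspace_group_topology)

text \<open>An open set containing (a, g) contains (a, g) W for some W open in the chart; its image
  then contains g times the image of W, which is open because the projection of a product
  is.\<close>

lemma open_map_cross_proj: "open_map group_topology (topo G) snd"
  unfolding open_map_def
proof (intro allI impI)
  fix S assume S: "openin group_topology S"
  show "openin (topo G) (snd ` S)"
  proof (subst openin_subopen, safe)
    fix a g assume p: "(a, g) \<in> S"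
    with S obtain W where W: "openin chart W" "\<one>\<^bsub>cross\<^esub> \<in> W" "\<And>w. w \<in> W \<Longrightarrow> (a, g) \<odot> w \<in> S"
      by (auto simp: openin_group_topology_nbhd)
    have g: "g \<in> carrier G"
      using p openin_subset[OF S] by (auto simp: topspace_group_topology)
    have "openin (topo G) (snd ` W)"
      using open_map_snd openin_chart_imp[OF W(1)] by (auto simp: open_map_def)
    then have "openin (topo G) {y \<in> carrier G. inv g \<otimes> y \<in> snd ` W}"
      using g by (intro G.openin_l_translate) auto
    moreover have "\<one> \<in> snd ` W"
      by (rule image_eqI[OF _ W(2)]) (simp add: one_cross)
    then have "g \<in> {y \<in> carrier G. inv g \<otimes> y \<in> snd ` W}"
      using g by simp
    moreover have "{y \<in> carrier G. inv g \<otimes> y \<in> snd ` W} \<subseteq> snd ` S"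
    proof
      fix y assume y: "y \<in> {y \<in> carrier G. inv g \<otimes> y \<in> snd ` W}"
      then obtain w where w: "w \<in> W" "snd w = inv g \<otimes> y" by auto
      then have "y = snd ((a, g) \<odot> w)"
        using y g by (simp add: mult_cross G.mult_inv_cancel)
      then show "y \<in> snd ` S"
        using W(3)[OF w(1)] by (rule image_eqI)
    qed
    ultimately show "\<exists>T. openin (topo G) T \<and> snd (a, g) \<in> T \<and> T \<subseteq> snd ` S"
      unfolding snd_conv by blast
  qed
qed

lemma continuous_map_cross_section:
  "continuous_map (subtopology (topo G) U) group_topology (\<lambda>s. (\<one>\<^bsub>A\<^esub>, s))"
  by (intro continuous_map_into_chart continuous_map_pairedI A.continuous_map_const_carrier
      continuous_map_from_subtopology continuous_map_ident) auto

lemma cross_extension_locally_split: "cross_extension \<in> locally_split_extensions G A act"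
proof -
  have "is_extension G A act cross_extension"
    unfolding is_extension_def cross_extension_simps
  proof (intro conjI ballI)
    show "topological_group (total cross_extension)"
      using topological_group_chart by (simp add: cross_extension_def)
    show "cross_incl \<in> hom A (total cross_extension)"
      by (rule homI) (simp_all only: cross_extension_simps cross_incl_closed cross_incl_mult)
    show "inj_on cross_incl (carrier A)"
      by (auto simp: inj_on_def cross_incl_def)
    show "snd \<in> hom (total cross_extension) G"
      by (rule homI) (auto simp: cross_extension_simps mult_cross)
    show "snd ` carrier cross = carrier G"
      using A.one_closed by force
    show "cross_incl ` carrier A = kernel (total cross_extension) G snd"
    proof
      show "kernel (total cross_extension) G snd \<subseteq> cross_incl ` carrier A"
      proof
        fix p assume "p \<in> kernel (total cross_extension) G snd"
        then obtain a where a: "p = (a, \<one>)" "a \<in> carrier A"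
          by (auto simp: kernel_def cross_extension_simps)
        then have "p = cross_incl (a \<otimes>\<^bsub>A\<^esub> unit_value)" "a \<otimes>\<^bsub>A\<^esub> unit_value \<in> carrier A"
          by (simp_all add: cross_incl_def A.m_assoc)
        then show "p \<in> cross_incl ` carrier A" by (rule image_eqI)
      qed
    qed (auto simp: kernel_def cross_extension_simps cross_incl_def)
    fix e a assume "e \<in> carrier cross" "a \<in> carrier A"
    then show "e \<odot> cross_incl a \<odot> inv\<^bsub>cross\<^esub> e = cross_incl (act (snd e) a)"
      by (rule cross_conj_incl)
  qed (fact continuous_map_cross_incl closed_map_cross_incl continuous_map_cross_proj open_map_cross_proj)+
  moreover have "locally_split G cross_extension"
    unfolding locally_split_def cross_extension_simps
    using U continuous_map_cross_section by (intro exI[of _ U] exI[of _ "\<lambda>s. (\<one>\<^bsub>A\<^esub>, s)"]) simp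
  ultimately show ?thesis
    by (simp add: locally_split_extensions_def)
qed

text \<open>Continuity on \<open>U\<close> is read off the chart. Measurability needs an argument,
  since sets open in the group topology are described only through translates of the chart: G is cut
  into countably many translates of \<open>U\<close>, and on each of them the section is compared
  with the chart by a Borel multiplication.\<close>

lemma cross_section: "lcm_section G cross_extension (\<lambda>s. (\<one>\<^bsub>A\<^esub>, s))"
  unfolding lcm_section_def cross_extension_simps
proof (intro conjI ballI)
  obtain g :: "nat \<Rightarrow> 'g" where g: "range g \<subseteq> carrier G"
      "\<And>s. s \<in> carrier G \<Longrightarrow> \<exists>n. inv (g n) \<otimes> s \<in> U"
    using G.second_countable_translates[OF second_countable_G U(1,2)] by metis
  let ?e = "\<lambda>n. (\<one>\<^bsub>A\<^esub>, g n)" and ?\<sigma> = "\<lambda>s. (\<one>\<^bsub>A\<^esub>, s)"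
  have e: "?e n \<in> carrier cross" for n using g(1) by auto
  show "?\<sigma> \<in> measurable (borel_of (topo G)) (borel_of group_topology)"
  proof (rule measurable_borel_ofI)
    show "?\<sigma> \<in> space (borel_of (topo G)) \<rightarrow> topspace group_topology"
      by (auto simp: topspace_group_topology)
    fix S assume S: "openin group_topology S"
    let ?O = "\<lambda>n. {x \<in> topspace chart. ?e n \<odot> x \<in> S}"
    \<comment> \<open>The point (1, s) moved back by the n-th translate; it lies in the chart
      exactly when g_n^-1 s lies in \<open>U\<close>.\<close>
    let ?x = "\<lambda>n s. inv\<^bsub>cross\<^esub> (?e n) \<odot> ?\<sigma> s"
    have "?\<sigma> \<in> measurable (borel_of (topo G)) (borel_of AG)"
      by (intro continuous_imp_borel_measurable continuous_map_pairedI A.continuous_map_const_carrier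
          continuous_map_ident) simp
    then have "?x n \<in> measurable (borel_of (topo G)) (borel_of AG)" for n
      using cross.inv_closed[OF e] by (intro measurable_mult_cross) auto
    moreover have "openin AG (?O n)" for n
      using S e by (intro openin_chart_imp) (simp add: openin_group_topology)
    ultimately have "{s \<in> space (borel_of (topo G)). ?x n s \<in> ?O n} \<in> sets (borel_of (topo G))" for n
      by (rule measurable_borel_of_preimage)
    then have "(\<Union>n. {s \<in> space (borel_of (topo G)). ?x n s \<in> ?O n}) \<in> sets (borel_of (topo G))"
      by blast
    moreover have x: "?x n s \<in> ?O n \<longleftrightarrow> inv (g n) \<otimes> s \<in> U \<and> ?\<sigma> s \<in> S" if "s \<in> carrier G" for n s
    proof -
      have s: "?\<sigma> s \<in> carrier cross" using that by simp
      then have "?x n s \<in> carrier cross"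
        using e by (intro cross.m_closed cross.inv_closed)
      moreover have "?e n \<odot> ?x n s = ?\<sigma> s"
        using e s by (rule cross.mult_inv_cancel)
      moreover have "snd (?x n s) = inv (g n) \<otimes> s"
        using e by (simp add: inv_cross[OF e] mult_cross cross_inv_def)
      ultimately show ?thesis
        by (simp add: topspace_chart mem_Times_iff)
    qed
    have "{s \<in> space (borel_of (topo G)). ?\<sigma> s \<in> S} = (\<Union>n. {s \<in> space (borel_of (topo G)). ?x n s \<in> ?O n})"
      using g(2) x by auto
    ultimately show "{s \<in> space (borel_of (topo G)). ?\<sigma> s \<in> S} \<in> sets (borel_of (topo G))"
      by simp
  qed
  show "\<exists>U. openin (topo G) U \<and> \<one> \<in> U \<and> continuous_map (subtopology (topo G) U) group_topology ?\<sigma>"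
    using U(1,2) continuous_map_cross_section by blast
qed simp

lemma cross_section_cocycle:
  assumes "s \<in> carrier G" "t \<in> carrier G"
  shows "section_cocycle G A cross_extension (\<lambda>s. (\<one>\<^bsub>A\<^esub>, s)) (point2 s t) = f s t"
proof -
  interpret X: split_extension G A act cross_extension
    using cross_extension_locally_split by unfold_locales
  let ?\<sigma> = "\<lambda>s. (\<one>\<^bsub>A\<^esub>, s)"
  have "?\<sigma> s \<odot> ?\<sigma> t = cross_incl (f s t) \<odot> ?\<sigma> (s \<otimes> t)"
    using assms by (simp add: cross_incl_mult_left) (simp add: mult_cross)
  moreover have "?\<sigma> (s \<otimes> t) \<in> carrier cross" "cross_incl (f s t) \<in> carrier cross"
    using assms cross_incl_closed[of "f s t"] by simp_all
  ultimately have "?\<sigma> s \<odot> ?\<sigma> t \<odot> inv\<^bsub>cross\<^esub> (?\<sigma> (s \<otimes> t)) = cross_incl (f s t)"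
    by (simp add: cross.m_assoc del: carrier_cross)
  then have "X.section_factor ?\<sigma> s t = X.retract (cross_incl (f s t))"
    by (simp only: X.section_factor_def cross_extension_simps)
  also have "\<dots> = f s t"
    using X.retract_incl[of "f s t"] assms by (simp add: cross_extension_simps)
  finally show ?thesis
    using assms by (simp add: X.section_cocycle_point2)
qed

end

text \<open>The carrier is recorded in the conclusion because \<open>code\<close> is assumed
  injective precisely on \<open>carrier A \<times> carrier G\<close>.\<close>

lemma (in lcm_module) ex_extension_of_cocycle:
  assumes f: "f \<in> carrier (lcm_cocycles G A act 2)"
  shows "\<exists>X :: ('a, 'a \<times> 'g, 'g) extension. \<exists>\<sigma>. X \<in> locally_split_extensions G A act \<and>
    carrier (total X) = carrier A \<times> carrier G \<and> lcm_section G X \<sigma> \<and> section_cocycle G A X \<sigma> = f"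
proof -
  have ext: "f \<in> extensional (topspace (power_top G 2))"
    using f by (simp add: lcm_cocycles_def kernel_def lcm_cochains_def)
  let ?f = "\<lambda>s t. f (point2 s t)"
  interpret crossed_extension G A act ?f
    by unfold_locales (use f in_cocycles2_iff[OF ext] in blast)
  obtain V where V: "openin (topo G) V" "\<one> \<in> V" "continuous_map
      (subtopology (GG) (V \<times> V)) (topo A) (\<lambda>(s, t). ?f s t)"
    using crossed_extension.f[OF crossed_extension_axioms] by (auto simp: cocycle2_def cochain2_def)
  have "continuous_map GG (topo G) (\<lambda>p. fst p \<otimes> inv (snd p))"
    by (intro G.continuous_map_mult G.continuous_map_inv continuous_map_fst continuous_map_snd)
  then have *: "openin GG {p \<in> topspace GG. fst p \<otimes> inv (snd p) \<in> V}"
    using V(1) by (rule openin_continuous_map_preimage)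
  have **: "(\<one>, \<one>) \<in> {p \<in> topspace GG. fst p \<otimes> inv (snd p) \<in> V}"
    using V(2) by simp
  obtain V1 V2 where V12: "openin (topo G) V1" "openin (topo G) V2" "\<one> \<in> V1" "\<one> \<in> V2"
      "V1 \<times> V2 \<subseteq> {p \<in> topspace GG. fst p \<otimes> inv (snd p) \<in> V}"
    using openin_prod_topologyE[OF * **] .
  \<comment> \<open>Quotients of elements of \<open>W\<close> lie in \<open>V\<close>, and
    \<open>U\<close> is the part of \<open>W\<close> that is stable under inversion; these are the
    two properties asked of a chart.\<close>
  define W where "W = V \<inter> V1 \<inter> V2"
  define U where "U = W \<inter> {x \<in> topspace (topo G). inv x \<in> W}"
  have W: "openin (topo G) W" "\<one> \<in> W"
    using V V12 by (auto simp: W_def)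
  have "openin (topo G) {x \<in> topspace (topo G). inv x \<in> W}"
    using G.continuous_map_inv[OF continuous_map_ident] W(1)
    by (rule openin_continuous_map_preimage)
  then have U: "openin (topo G) U" "\<one> \<in> U"
    using W by (auto simp: U_def)
  interpret crossed_chart G A act ?f V U
  proof
    show "inv u \<in> U" if "u \<in> U" for u
      using that by (auto simp: U_def)
    show "u \<otimes> inv v \<in> V" if "u \<in> U" "v \<in> U" for u v
      using that V12(5) by (auto simp: U_def W_def)
  qed (use V U in \<open>auto simp: U_def W_def\<close>)
  interpret X: split_extension G A act cross_extension
    using cross_extension_locally_split by unfold_locales
  have "section_cocycle G A cross_extension (\<lambda>s. (\<one>\<^bsub>A\<^esub>, s)) = f"
  proof (rule extensionalityI[OF X.section_cocycle_extensional ext])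
    fix x assume x: "x \<in> topspace (power_top G 2)"
    note G.power_top_point2[OF x]
    then show "section_cocycle G A cross_extension (\<lambda>s. (\<one>\<^bsub>A\<^esub>, s)) x = f x"
      using cross_section_cocycle[of "x 1" "x 2"] by simp
  qed
  then show ?thesis
    using cross_extension_locally_split cross_section cross_extension_simps(1) carrier_cross by blast
qed

text \<open>Transport of structure along \<open>code\<close>. The topology is pulled back along the
  decoding map, which makes \<open>code\<close> a homeomorphism onto the new carrier, and every
  axiom of an extension is carried over by composition with it.\<close>

lemma (in lcm_module) ex_isomorphic_extension:
  fixes X :: "('a, 'h, 'g) extension" and code :: "'h \<Rightarrow> 'e"
  assumes X: "X \<in> locally_split_extensions G A act" and code: "inj_on code (carrier (total X))"
  shows "\<exists>Y :: ('a, 'e, 'g) extension. Y \<in> locally_split_extensions G A act \<and> isomorphic_extensions A X Y"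
proof -
  interpret X: split_extension G A act X using X by unfold_locales
  define dec where "dec = inv_into (carrier X.E) code"
  have dec_code [simp]: "dec (code e) = e" if "e \<in> carrier X.E" for e
    using that code by (simp add: dec_def)
  define T where "T = pullback_topology (code ` carrier X.E) dec (topo X.E)"
  define Y where "Y = \<lparr>total = \<lparr>carrier = code ` carrier X.E, mult = (\<lambda>x y. code (dec x \<otimes>\<^bsub>X.E\<^esub> dec y)),
     one = code \<one>\<^bsub>X.E\<^esub>, topo = T\<rparr>, incl = \<lambda>a. code (X.\<iota> a), proj = \<lambda>y. X.\<pi> (dec y)\<rparr>"
  have Y_simps: "carrier (total Y) = code ` carrier X.E" "one (total Y) = code \<one>\<^bsub>X.E\<^esub>"
      "\<And>x y. x \<otimes>\<^bsub>total Y\<^esub> y = code (dec x \<otimes>\<^bsub>X.E\<^esub> dec y)" "topo (total Y) = T"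
      "incl Y = (\<lambda>a. code (X.\<iota> a))" "proj Y = (\<lambda>y. X.\<pi> (dec y))"
    by (simp_all add: Y_def)
  have top_T: "topspace T = code ` carrier X.E"
    by (auto simp: T_def topspace_pullback_topology)
  have homeo: "homeomorphic_maps (topo X.E) T code dec"
    unfolding homeomorphic_maps_def
  proof (intro conjI ballI)
    have "continuous_map (topo X.E) (topo X.E) (dec \<circ> code)"
      by (rule continuous_map_eq[OF continuous_map_id]) simp
    then show "continuous_map (topo X.E) T code"
      unfolding T_def by (rule continuous_map_pullback') auto
    show "continuous_map T (topo X.E) dec"
      using continuous_map_pullback[where A = "code ` carrier X.E" and f = dec, OF continuous_map_id[of "topo X.E"]]
      by (simp add: T_def)
  qed (auto simp: top_T)
  then have code_homeo: "homeomorphic_map (topo X.E) T code" and dec_homeo: "homeomorphic_map T (topo X.E) dec"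
    by (simp_all add: homeomorphic_maps_map)
  note code_cont = homeomorphic_imp_continuous_map[OF code_homeo]
    and dec_cont = homeomorphic_imp_continuous_map[OF dec_homeo]
  have group: "group (total Y)"
  proof (rule groupI)
    fix x assume "x \<in> carrier (total Y)"
    then obtain e where e: "x = code e" "e \<in> carrier X.E" by (auto simp: Y_simps)
    then show "\<exists>y\<in>carrier (total Y). y \<otimes>\<^bsub>total Y\<^esub> x = \<one>\<^bsub>total Y\<^esub>"
      by (intro bexI[of _ "code (inv\<^bsub>X.E\<^esub> e)"]) (auto simp: Y_simps)
  qed (auto simp: Y_simps X.E.m_assoc)
  have inv_Y: "inv\<^bsub>total Y\<^esub> (code e) = code (inv\<^bsub>X.E\<^esub> e)" if "e \<in> carrier X.E" for e
    using that by (intro group.inv_equality[OF group]) (auto simp: Y_simps)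
  have "is_extension G A act Y"
    unfolding is_extension_def
  proof (intro conjI ballI)
    have "continuous_map (prod_topology T T) T (\<lambda>p. code (dec (fst p) \<otimes>\<^bsub>X.E\<^esub> dec (snd p)))"
      by (intro continuous_map_compose'[OF _ code_cont] X.E.continuous_map_mult
          continuous_map_compose'[OF continuous_map_fst dec_cont]
          continuous_map_compose'[OF continuous_map_snd dec_cont])
    moreover have "continuous_map T T (\<lambda>x. inv\<^bsub>total Y\<^esub> x)"
    proof (rule continuous_map_eq)
      show "continuous_map T T (\<lambda>x. code (inv\<^bsub>X.E\<^esub> (dec x)))"
        by (intro continuous_map_compose'[OF _ code_cont] X.E.continuous_map_inv dec_cont)
    qed (auto simp: top_T inv_Y)
    ultimately show "topological_group (total Y)"
      using group by (simp add: topological_group_def Y_simps top_T case_prod_beta')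
    show "incl Y \<in> hom A (total Y)"
      by (rule homI) (auto simp: Y_simps X.incl_mult)
    show "inj_on (incl Y) (carrier A)"
      using X.incl_inj code by (auto simp: Y_simps inj_on_def)
    show "proj Y \<in> hom (total Y) G"
      by (rule homI) (auto simp: Y_simps)
    show "proj Y ` carrier (total Y) = carrier G"
      using X.proj_surj by (auto simp: Y_simps image_image)
    have "incl Y ` carrier A = code ` (X.\<iota> ` carrier A)"
      by (auto simp: Y_simps)
    also have "\<dots> = kernel (total Y) G (proj Y)"
      unfolding X.incl_image by (auto simp: kernel_def Y_simps)
    finally show "incl Y ` carrier A = kernel (total Y) G (proj Y)" .
    show "continuous_map (topo A) (topo (total Y)) (incl Y)"
      unfolding Y_simps using X.continuous_map_incl code_cont by (rule continuous_map_compose')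
    show "closed_map (topo A) (topo (total Y)) (incl Y)"
      unfolding Y_simps using closed_map_compose[OF X.closed_map_incl homeomorphic_imp_closed_map[OF code_homeo]]
      by (simp add: o_def)
    show "continuous_map (topo (total Y)) (topo G) (proj Y)"
      unfolding Y_simps using dec_cont X.continuous_map_proj by (rule continuous_map_compose')
    have "open_map (topo X.E) (topo G) X.\<pi>"
      using X by (simp add: locally_split_extensions_def is_extension_def)
    then show "open_map (topo (total Y)) (topo G) (proj Y)"
      unfolding Y_simps using open_map_compose[OF homeomorphic_imp_open_map[OF dec_homeo]]
      by (fastforce simp: o_def)
    fix y a assume "y \<in> carrier (total Y)" and a: "a \<in> carrier A"
    then obtain e where "y = code e" "e \<in> carrier X.E" by (auto simp: Y_simps)
    with a show "y \<otimes>\<^bsub>total Y\<^esub> incl Y a \<otimes>\<^bsub>total Y\<^esub> inv\<^bsub>total Y\<^esub> y = incl Y (act (proj Y y) a)"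
      by (simp add: inv_Y) (simp add: Y_simps X.conjugation)
  qed
  moreover have "locally_split G Y"
  proof -
    obtain U \<sigma> where "openin (topo G) U" "\<one> \<in> U"
      and \<sigma>: "continuous_map (subtopology (topo G) U) (topo X.E) \<sigma>" "\<And>s. s \<in> U \<Longrightarrow> X.\<pi> (\<sigma> s) = s"
        "\<And>s. s \<in> U \<Longrightarrow> \<sigma> s \<in> carrier X.E"
      by (rule X.local_section) (rule that)
    then show ?thesis
      unfolding locally_split_def using continuous_map_compose'[OF \<sigma>(1) code_cont]
      by (intro exI[of _ U] exI[of _ "\<lambda>s. code (\<sigma> s)"]) (simp add: Y_simps)
  qed
  ultimately have "Y \<in> locally_split_extensions G A act"
    by (simp add: locally_split_extensions_def)
  moreover have "isomorphic_extensions A X Y"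
    unfolding isomorphic_extensions_def
  proof (intro exI[of _ code] conjI ballI)
    show "code \<in> iso X.E (total Y)"
      using code by (auto simp: iso_def hom_def Y_simps bij_betw_def)
    show "homeomorphic_map (topo X.E) (topo (total Y)) code"
      using code_homeo by (simp add: Y_simps)
  qed (simp_all add: Y_simps)
  ultimately show ?thesis by blast
qed

text \<open>The type of the total groups is a parameter, and \<open>code\<close> ensures that every
  cocycle is realised on it. The final conjunct states that the choice loses nothing: extensions on
  any other type are isomorphic to one counted here.\<close>

theorem theorem1:
  fixes G :: "'g topgroup" and A :: "'a topgroup" and act :: "'g \<Rightarrow> 'a \<Rightarrow> 'a"
    and code :: "'a \<times> 'g \<Rightarrow> 'e"
  assumes "lcsc_group G" and "lcsc_group A" and "comm_group A"
    and "continuous_action G A act"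
    and "inj_on code (carrier A \<times> carrier G)"
  shows "(\<exists>\<Phi> :: ('a, 'e, 'g) extension set \<Rightarrow> ((nat \<Rightarrow> 'g) \<Rightarrow> 'a) set.
            bij_betw \<Phi> (locally_split_extensions G A act // extension_iso_rel G A act)
                       (carrier (lcm_cohomology G A act 2)) \<and>
            (\<forall>X\<in>locally_split_extensions G A act.
               (\<exists>\<sigma>. lcm_section G X \<sigma>) \<and>
               (\<forall>\<sigma>. lcm_section G X \<sigma> \<longrightarrow>
                  section_cocycle G A X \<sigma> \<in> carrier (lcm_cocycles G A act 2) \<and>
                  \<Phi> (extension_iso_rel G A act `` {X})
                    = lcm_class G A act 2 (section_cocycle G A X \<sigma>))))
         \<and> (\<forall>Y\<in>(locally_split_extensions G A act :: ('a, 'f, 'g) extension set).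
              \<exists>X\<in>(locally_split_extensions G A act :: ('a, 'e, 'g) extension set).
                isomorphic_extensions A Y X)"
proof -
  interpret lcm_module G A act
    using assms(1-4)
    by (auto simp: lcm_module_def lcm_module_axioms_def topgroup_iff lcsc_group_def)
  let ?E = "locally_split_extensions G A act :: ('a, 'e, 'g) extension set"
  let ?R = "extension_iso_rel G A act :: (('a, 'e, 'g) extension \<times> ('a, 'e, 'g) extension) set"
  let ?cls = "\<lambda>X \<sigma>. lcm_class G A act 2 (section_cocycle G A X \<sigma>)"
  \<comment> \<open>The class of an arbitrary section; it is independent of the choice because two
    sections differ by a one-cochain.\<close>
  define F where "F X = ?cls X (SOME \<sigma>. lcm_section G X \<sigma>)" for X :: "('a, 'e, 'g) extension"
  have F: "F X = ?cls X \<sigma>" if "X \<in> ?E" "lcm_section G X \<sigma>" for X \<sigma>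
    unfolding F_def using section_cocycle_class_eq[OF that(1) someI[of "lcm_section G X", OF that(2)] that(2)] .
  have F_eq_iff: "F X = F Y \<longleftrightarrow> isomorphic_extensions A X Y" if X: "X \<in> ?E" and Y: "Y \<in> ?E" for X Y
  proof -
    obtain \<sigma> \<tau> where \<sigma>: "lcm_section G X \<sigma>" and \<tau>: "lcm_section G Y \<tau>"
      using ex_lcm_section_of X Y by meson
    show ?thesis
    proof
      assume "F X = F Y"
      then show "isomorphic_extensions A X Y"
        unfolding F[OF X \<sigma>] F[OF Y \<tau>] by (rule isomorphic_if_class_eq[OF X Y \<sigma> \<tau>])
    next
      assume "isomorphic_extensions A X Y"
      then obtain \<tau>' where "lcm_section G Y \<tau>'" "section_cocycle G A Y \<tau>' = section_cocycle G A X \<sigma>"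
        by (rule isomorphic_section[OF X Y _ \<sigma>])
      then show "F X = F Y"
        using F[OF X \<sigma>] F[OF Y] by simp
    qed
  qed
  \<comment> \<open>Isomorphism classes are the fibres of \<open>F\<close>, so reflexivity, symmetry
    and transitivity of the relation come from equality of classes.\<close>
  have R: "?R `` {X} = {Y \<in> ?E. F Y = F X}" if "X \<in> ?E" for X
    using that F_eq_iff by (auto simp: extension_iso_rel_def)
  have surj: "\<exists>X\<in>?E. \<exists>\<sigma>. lcm_section G X \<sigma> \<and> section_cocycle G A X \<sigma> = f"
    if f: "f \<in> carrier (lcm_cocycles G A act 2)" for f
  proof -
    obtain X :: "('a, 'a \<times> 'g, 'g) extension" and \<sigma> where X: "X \<in> locally_split_extensions G A act"
      "carrier (total X) = carrier A \<times> carrier G" "lcm_section G X \<sigma>" "section_cocycle G A X \<sigma> = f"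
      using ex_extension_of_cocycle[OF f] by blast
    obtain Y where Y: "Y \<in> ?E" "isomorphic_extensions A X Y"
      using ex_isomorphic_extension[OF X(1), of code] assms(5) X(2) by auto
    obtain \<tau> where "lcm_section G Y \<tau>" "section_cocycle G A Y \<tau> = section_cocycle G A X \<sigma>"
      by (rule isomorphic_section[OF X(1) Y X(3)])
    with Y(1) X(4) show ?thesis by auto
  qed
  \<comment> \<open>\<open>\<Phi>\<close> evaluates \<open>F\<close> at some representative; as
    \<open>F\<close> is constant on a class, the choice is harmless.\<close>
  define \<Phi> where "\<Phi> C = F (SOME X. X \<in> C)" for C
  have \<Phi>: "\<Phi> (?R `` {X}) = F X" if "X \<in> ?E" for X
  proof -
    have "X \<in> ?R `` {X}"
      using that R by simp
    then have "(SOME Y. Y \<in> ?R `` {X}) \<in> ?R `` {X}"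
      by (rule someI)
    then show ?thesis
      unfolding \<Phi>_def R[OF that] by simp
  qed
  have "F ` ?E = carrier (lcm_cohomology G A act 2)"
    unfolding carrier_lcm_cohomology_2
  proof (intro equalityI image_subsetI)
    fix X assume X: "X \<in> ?E"
    then obtain \<sigma> where \<sigma>: "lcm_section G X \<sigma>" using ex_lcm_section_of by meson
    show "F X \<in> lcm_class G A act 2 ` carrier (lcm_cocycles G A act 2)"
      unfolding F[OF X \<sigma>] by (rule imageI) (rule section_cocycle_in_cocycles_of[OF X \<sigma>])
  next
    fix f assume "f \<in> carrier (lcm_cocycles G A act 2)"
    then obtain X \<sigma> where X: "X \<in> ?E" and \<sigma>: "lcm_section G X \<sigma>" "section_cocycle G A X \<sigma> = f"
      using surj by meson
    have "F X = lcm_class G A act 2 f"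
      using F[OF X \<sigma>(1)] \<sigma>(2) by simp
    with X show "lcm_class G A act 2 f \<in> F ` ?E"
      by (metis imageI)
  qed
  moreover have "\<Phi> ` (?E // ?R) = F ` ?E"
    using \<Phi> by (auto simp: quotient_def image_iff)
  moreover have "inj_on \<Phi> (?E // ?R)"
  proof (rule inj_onI)
    fix C D assume "C \<in> ?E // ?R" "D \<in> ?E // ?R" and eq: "\<Phi> C = \<Phi> D"
    then obtain X Y where X: "X \<in> ?E" "C = ?R `` {X}" and Y: "Y \<in> ?E" "D = ?R `` {Y}"
      by (auto simp: quotient_def)
    then show "C = D"
      using eq \<Phi> R by simp
  qed
  ultimately have "bij_betw \<Phi> (?E // ?R) (carrier (lcm_cohomology G A act 2))"
    by (simp add: bij_betw_def)
  moreover have "\<forall>X\<in>?E. (\<exists>\<sigma>. lcm_section G X \<sigma>) \<and> (\<forall>\<sigma>. lcm_section G X \<sigma> \<longrightarrow>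
      section_cocycle G A X \<sigma> \<in> carrier (lcm_cocycles G A act 2) \<and> \<Phi> (?R `` {X}) = ?cls X \<sigma>)"
    by (intro ballI conjI allI impI) (auto simp: \<Phi> F intro: ex_lcm_section_of section_cocycle_in_cocycles_of)
  moreover have "\<exists>X\<in>?E. isomorphic_extensions A Y X"
    if Y: "Y \<in> locally_split_extensions G A act" for Y :: "('a, 'f, 'g) extension"
  proof -
    obtain \<tau> where \<tau>: "lcm_section G Y \<tau>" using ex_lcm_section_of[OF Y] by blast
    \<comment> \<open>The cocycle of \<open>Y\<close>, whose type no longer mentions the total
      group, is realised on the chosen type, and equality of classes then gives the
      isomorphism.\<close>
    obtain X \<sigma> where X: "X \<in> ?E" and \<sigma>: "lcm_section G X \<sigma>" "section_cocycle G A X \<sigma> = section_cocycle G A Y \<tau>"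
      using surj[OF section_cocycle_in_cocycles_of[OF Y \<tau>]] by blast
    then show ?thesis
      using isomorphic_if_class_eq[OF Y X \<tau> \<sigma>(1)] by auto
  qed
  ultimately show ?thesis by blast
qed

end
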